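(* For every Stein manifold of complex dimension at least 2, the unique end of each component is Mittag-Leffler.
   Context: Ends. A neighborhood of infinity in a manifold $X$ is the complement of a compact set. A neighborhood system of infinity is a nested sequence $U_1\supset U_2\supset\cdots$ of neighborhoods of infinity with empty intersection and with $\overline{U_{i+1}}\subset U_i$. The space of ends is $\mathcal{E}(X)=\varprojlim\pi_0(U_i)$. A singular ray is a proper continuous map $\gamma\colon[0,\infty)\to X$; it determines an end (the components of the $U_i$ containing $\gamma([k,\infty))$ for large $k$). Mittag-Leffler. An inverse sequence of groups $G_1\leftarrow G_2\leftarrow\cdots$ is Mittag-Leffler if for each $i$ there is $j\ge i$ such that all $G_k$ with $k\ge j$ have the same image in $G_i$. Given a singular ray $\gamma$, parametrized so that $\gamma([i,\infty))\subset U_i$, the fundamental progroup of $X$ based at $\gamma$ is the inverse sequence $\pi_1(U_i,\gamma(i))$, with bonding maps given by inclusion followed by transport of the base point along $\gamma|[i,i+1]$. An end is Mittag-Leffler if the fundamental progroup based at a singular ray determining it is Mittag-Leffler (independent of the choice of ray). *)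

theory Defs
  imports "HOL-Analysis.Analysis" "HOL-Algebra.Group"
begin

text \<open>
  Every space here is a subset of a type of class \<open>topological_space\<close>, with the subspace
  topology.
\<close>

section \<open>Complex manifolds\<close>

text \<open>Complex differentiability, with a complex linear derivative at each point.\<close>

definition holo_on :: "(complex ^ 'n \<Rightarrow> complex) \<Rightarrow> (complex ^ 'n) set \<Rightarrow> bool" where
  "holo_on f V \<longleftrightarrow>
     (\<forall>z\<in>V. \<exists>D. (f has_derivative D) (at z) \<and> (\<forall>c v. D (c *s v) = c * D v))"

definition chart :: "'a::topological_space set \<Rightarrow> 'a set \<Rightarrow> ('a \<Rightarrow> complex ^ 'n) \<Rightarrow> bool" where
  "chart M W \<phi> \<longleftrightarrow>
     openin (top_of_set M) W \<and> open (\<phi> ` W) \<and> homeomorphism W (\<phi> ` W) \<phi> (inv_into W \<phi>)"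

definition transition_holo ::
    "'a set \<Rightarrow> ('a \<Rightarrow> complex ^ 'n) \<Rightarrow> 'a set \<Rightarrow> ('a \<Rightarrow> complex ^ 'n) \<Rightarrow> bool" where
  "transition_holo W \<phi> W' \<phi>' \<longleftrightarrow>
     (\<forall>i. holo_on (\<lambda>z. \<phi>' (inv_into W \<phi> z) $ i) (\<phi> ` (W \<inter> W')))"

definition complex_atlas ::
    "'a::topological_space set \<Rightarrow> ('a set \<times> ('a \<Rightarrow> complex ^ 'n)) set \<Rightarrow> bool" where
  "complex_atlas M \<A> \<longleftrightarrow>
     (\<forall>(W, \<phi>)\<in>\<A>. chart M W \<phi>) \<and>
     \<Union>(fst ` \<A>) = M \<and>
     (\<forall>(W, \<phi>)\<in>\<A>. \<forall>(W', \<phi>')\<in>\<A>. transition_holo W \<phi> W' \<phi>')"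

definition complex_manifold ::
    "'a::topological_space set \<Rightarrow> ('a set \<times> ('a \<Rightarrow> complex ^ 'n)) set \<Rightarrow> bool" where
  "complex_manifold M \<A> \<longleftrightarrow>
     Hausdorff_space (top_of_set M) \<and> second_countable (top_of_set M) \<and> complex_atlas M \<A>"

definition holomorphic_functions ::
    "('a set \<times> ('a \<Rightarrow> complex ^ 'n)) set \<Rightarrow> ('a \<Rightarrow> complex) set" where
  "holomorphic_functions \<A> = {f. \<forall>(W, \<phi>)\<in>\<A>. holo_on (\<lambda>z. f (inv_into W \<phi> z)) (\<phi> ` W)}"

definition holomorphic_coordinates ::
    "'a::topological_space set \<Rightarrow> ('a set \<times> ('a \<Rightarrow> complex ^ 'n)) set \<Rightarrow>
     'a set \<Rightarrow> ('a \<Rightarrow> complex ^ 'n) \<Rightarrow> bool" where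
  "holomorphic_coordinates M \<A> W \<phi> \<longleftrightarrow>
     chart M W \<phi> \<and>
     (\<forall>(W', \<phi>')\<in>\<A>. transition_holo W \<phi> W' \<phi>' \<and> transition_holo W' \<phi>' W \<phi>)"


section \<open>Stein manifolds\<close>

text \<open>
  The condition on \<open>z\<close> says \<open>\<bar>f z\<bar> \<le> sup {\<bar>f x\<bar> | x \<in> K}\<close>, spelled out with upper bounds so that
  the hull of the empty set is empty.
\<close>

definition holomorphic_hull ::
    "'a set \<Rightarrow> ('a set \<times> ('a \<Rightarrow> complex ^ 'n)) set \<Rightarrow> 'a set \<Rightarrow> 'a set" where
  "holomorphic_hull M \<A> K =
     {z \<in> M. \<forall>f\<in>holomorphic_functions \<A>. \<forall>B. (\<forall>x\<in>K. cmod (f x) \<le> B) \<longrightarrow> cmod (f z) \<le> B}"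

text \<open>
  The classical definition: holomorphic convexity, separation of points by global holomorphic
  functions, and local coordinates consisting of global holomorphic functions.
\<close>

definition stein_manifold ::
    "'a::topological_space set \<Rightarrow> ('a set \<times> ('a \<Rightarrow> complex ^ 'n)) set \<Rightarrow> bool" where
  "stein_manifold M \<A> \<longleftrightarrow>
     complex_manifold M \<A> \<and>
     (\<forall>K. K \<subseteq> M \<and> compact K \<longrightarrow> compact (holomorphic_hull M \<A> K)) \<and>
     (\<forall>x\<in>M. \<forall>y\<in>M. x \<noteq> y \<longrightarrow> (\<exists>f\<in>holomorphic_functions \<A>. f x \<noteq> f y)) \<and>
     (\<forall>x\<in>M. \<exists>W \<phi>. x \<in> W \<and> holomorphic_coordinates M \<A> W \<phi> \<and>
                   (\<forall>i. (\<lambda>y. \<phi> y $ i) \<in> holomorphic_functions \<A>))"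


section \<open>Ends\<close>

definition neighborhood_of_infinity :: "'a::topological_space set \<Rightarrow> 'a set \<Rightarrow> bool" where
  "neighborhood_of_infinity X V \<longleftrightarrow> (\<exists>K. K \<subseteq> X \<and> compact K \<and> V = X - K)"

text \<open>Sequences are indexed from 0, and rays start at parameter 0 inside \<open>U 0\<close>.\<close>

definition neighborhood_system :: "'a::topological_space set \<Rightarrow> (nat \<Rightarrow> 'a set) \<Rightarrow> bool" where
  "neighborhood_system X U \<longleftrightarrow>
     (\<forall>i. neighborhood_of_infinity X (U i)) \<and>
     (\<forall>i. U (Suc i) \<subseteq> U i) \<and>
     (\<forall>i. X \<inter> closure (U (Suc i)) \<subseteq> U i) \<and>
     (\<Inter>i. U i) = {}"

definition pi0 :: "'a::topological_space set \<Rightarrow> 'a set set" where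
  "pi0 V = path_component_set V ` V"

text \<open>
  The inverse limit of \<open>pi0 (U i)\<close>: the map induced by inclusion sends a path component of
  \<open>U (Suc i)\<close> to the path component of \<open>U i\<close> containing it.
\<close>

definition ends :: "(nat \<Rightarrow> 'a::topological_space set) \<Rightarrow> (nat \<Rightarrow> 'a set) set" where
  "ends U = {e. (\<forall>i. e i \<in> pi0 (U i)) \<and> (\<forall>i. e (Suc i) \<subseteq> e i)}"

definition singular_ray :: "'a::topological_space set \<Rightarrow> (real \<Rightarrow> 'a) \<Rightarrow> bool" where
  "singular_ray X \<gamma> \<longleftrightarrow>
     continuous_on {0..} \<gamma> \<and> \<gamma> ` {0..} \<subseteq> X \<and>
     (\<forall>K. K \<subseteq> X \<and> compact K \<longrightarrow> compact {t \<in> {0..}. \<gamma> t \<in> K})"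

definition determines_end :: "(real \<Rightarrow> 'a) \<Rightarrow> (nat \<Rightarrow> 'a set) \<Rightarrow> bool" where
  "determines_end \<gamma> e \<longleftrightarrow> (\<forall>i. \<exists>k::nat. \<gamma> ` {real k..} \<subseteq> e i)"


section \<open>The fundamental progroup\<close>

definition loops :: "'a::topological_space set \<Rightarrow> 'a \<Rightarrow> (real \<Rightarrow> 'a) set" where
  "loops X a = {p. path p \<and> path_image p \<subseteq> X \<and> pathstart p = a \<and> pathfinish p = a}"

definition path_class :: "'a::topological_space set \<Rightarrow> (real \<Rightarrow> 'a) \<Rightarrow> (real \<Rightarrow> 'a) set" where
  "path_class X p = {q. homotopic_paths X p q}"

definition fundamental_group :: "'a::topological_space set \<Rightarrow> 'a \<Rightarrow> (real \<Rightarrow> 'a) set monoid" where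
  "fundamental_group X a =
     \<lparr>carrier = path_class X ` loops X a,
      mult = (\<lambda>A B. \<Union>p\<in>A. \<Union>q\<in>B. path_class X (p +++ q)),
      one = path_class X (\<lambda>_. a)\<rparr>"

definition ray_segment :: "(real \<Rightarrow> 'a) \<Rightarrow> nat \<Rightarrow> real \<Rightarrow> 'a" where
  "ray_segment \<gamma> i = (\<lambda>t. \<gamma> (real i + t))"

text \<open>Conjugation by a path \<open>s\<close> in \<open>X\<close>, applied to a class of loops at the end point of \<open>s\<close>.\<close>

definition transport :: "'a::topological_space set \<Rightarrow> (real \<Rightarrow> 'a) \<Rightarrow> (real \<Rightarrow> 'a) set \<Rightarrow> (real \<Rightarrow> 'a) set"
  where "transport X s A = (\<Union>p\<in>A. path_class X (s +++ (p +++ reversepath s)))"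

definition progroup_group ::
    "(nat \<Rightarrow> 'a::topological_space set) \<Rightarrow> (real \<Rightarrow> 'a) \<Rightarrow> nat \<Rightarrow> (real \<Rightarrow> 'a) set monoid" where
  "progroup_group U \<gamma> i = fundamental_group (U i) (\<gamma> (real i))"

text \<open>
  \<open>progroup_bond U \<gamma> i\<close> maps the group with index \<open>Suc i\<close> to the one with index \<open>i\<close>. The inclusion
  of \<open>U (Suc i)\<close> in \<open>U i\<close> is absorbed in taking classes in \<open>U i\<close>.
\<close>

definition progroup_bond ::
    "(nat \<Rightarrow> 'a::topological_space set) \<Rightarrow> (real \<Rightarrow> 'a) \<Rightarrow> nat \<Rightarrow> (real \<Rightarrow> 'a) set \<Rightarrow> (real \<Rightarrow> 'a) set"
  where "progroup_bond U \<gamma> i = transport (U i) (ray_segment \<gamma> i)"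

definition inverse_sequence :: "(nat \<Rightarrow> 'g monoid) \<Rightarrow> (nat \<Rightarrow> 'g \<Rightarrow> 'g) \<Rightarrow> bool" where
  "inverse_sequence G f \<longleftrightarrow> (\<forall>i. group (G i) \<and> f i \<in> hom (G (Suc i)) (G i))"

text \<open>\<open>bond_comp f i m\<close> is the composite of bonding maps from index \<open>i + m\<close> to index \<open>i\<close>.\<close>

primrec bond_comp :: "(nat \<Rightarrow> 'g \<Rightarrow> 'g) \<Rightarrow> nat \<Rightarrow> nat \<Rightarrow> 'g \<Rightarrow> 'g" where
  "bond_comp f i 0 = id"
| "bond_comp f i (Suc m) = bond_comp f i m \<circ> f (i + m)"

definition mittag_leffler :: "(nat \<Rightarrow> 'g monoid) \<Rightarrow> (nat \<Rightarrow> 'g \<Rightarrow> 'g) \<Rightarrow> bool" where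
  "mittag_leffler G f \<longleftrightarrow>
     inverse_sequence G f \<and>
     (\<forall>i. \<exists>j\<ge>i. \<forall>k\<ge>j.
        bond_comp f i (k - i) ` carrier (G k) = bond_comp f i (j - i) ` carrier (G j))"

definition ray_for_end ::
    "'a::topological_space set \<Rightarrow> (nat \<Rightarrow> 'a set) \<Rightarrow> (nat \<Rightarrow> 'a set) \<Rightarrow> (real \<Rightarrow> 'a) \<Rightarrow> bool" where
  "ray_for_end X U e \<gamma> \<longleftrightarrow>
     singular_ray X \<gamma> \<and> (\<forall>i. \<gamma> ` {real i..} \<subseteq> U i) \<and> determines_end \<gamma> e"

text \<open>
  The property does not depend on the ray, so we ask for it for every ray determining the end;
  the first conjunct excludes vacuity.
\<close>

definition mittag_leffler_end ::
    "'a::topological_space set \<Rightarrow> (nat \<Rightarrow> 'a set) \<Rightarrow> (nat \<Rightarrow> 'a set) \<Rightarrow> bool" where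
  "mittag_leffler_end X U e \<longleftrightarrow>
     (\<exists>\<gamma>. ray_for_end X U e \<gamma>) \<and>
     (\<forall>\<gamma>. ray_for_end X U e \<gamma> \<longrightarrow>
        mittag_leffler (progroup_group U \<gamma>) (progroup_bond U \<gamma>))"


section \<open>The fundamental progroup is an inverse sequence of groups\<close>

text \<open>The library versions with \<open>linepath\<close> need a normed space.\<close>

lemma homotopic_paths_const_right:
  fixes p :: "real \<Rightarrow> 'a::topological_space"
  assumes "path p" "path_image p \<subseteq> X" "b = pathfinish p"
  shows "homotopic_paths X (p +++ (\<lambda>_. b)) p"
proof -
  let ?f = "\<lambda>t::real. min (2 * t) 1"
  have "homotopic_paths X p (p +++ (\<lambda>_. b))"
  proof (rule homotopic_paths_reparametrize[where f = ?f])
    show "continuous_on {0..1} ?f" by (intro continuous_intros)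
  qed (use assms in \<open>auto simp: joinpaths_def pathfinish_def min_def\<close>)
  then show ?thesis by (rule homotopic_paths_sym)
qed

lemma homotopic_paths_const_left:
  fixes p :: "real \<Rightarrow> 'a::topological_space"
  assumes "path p" "path_image p \<subseteq> X" "a = pathstart p"
  shows "homotopic_paths X ((\<lambda>_. a) +++ p) p"
proof -
  let ?f = "\<lambda>t::real. max (2 * t - 1) 0"
  have "homotopic_paths X p ((\<lambda>_. a) +++ p)"
  proof (rule homotopic_paths_reparametrize[where f = ?f])
    show "continuous_on {0..1} ?f" by (intro continuous_intros)
  qed (use assms in \<open>auto simp: joinpaths_def pathstart_def max_def\<close>)
  then show ?thesis by (rule homotopic_paths_sym)
qed

lemma homotopic_paths_reverse_right:
  fixes p :: "real \<Rightarrow> 'a::topological_space"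
  assumes "path p" "path_image p \<subseteq> X" "a = pathstart p"
  shows "homotopic_paths X (p +++ reversepath p) (\<lambda>_. a)"
proof -
  let ?g = "\<lambda>y::real \<times> real. min (2 * snd y) (2 - 2 * snd y)"
  let ?h = "\<lambda>y. p ((1 - fst y) * ?g y)"
  have p: "continuous_on {0..1} p" using assms by (simp add: path_def)
  have g: "?g y \<in> {0..1}" if "snd y \<in> {0..1}" for y :: "real \<times> real"
    using that by auto
  have gy: "(1 - fst y) * ?g y \<in> {0..1}" if "y \<in> {0..1} \<times> {0..1}" for y :: "real \<times> real"
    using that g[of y] by (auto intro!: mult_le_one mult_nonneg_nonneg)
  have cont: "continuous_on ({0..1} \<times> {0..1}) ?h"
    by (rule continuous_on_compose2[OF p]) (use gy in \<open>auto intro!: continuous_intros\<close>)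
  have im: "?h y \<in> X" if "y \<in> {0..1} \<times> {0..1}" for y
    using gy[OF that] assms(2) by (auto simp: path_image_def)
  have 0: "?h (0, t) = (p +++ reversepath p) t" if "t \<in> {0..1}" for t
    using that by (auto simp: joinpaths_def reversepath_def min_def algebra_simps)
  have 1: "?h (1, t) = a" for t
    using assms(3) by (simp add: pathstart_def)
  have ends: "?h (s, 0) = a" "?h (s, 1) = a" for s
    using assms(3) by (simp_all add: pathstart_def)
  show ?thesis
    unfolding homotopic_paths
    by (rule exI[of _ ?h])
      (use cont im 0 1 ends assms(3) in
        \<open>auto simp: pathstart_def pathfinish_def joinpaths_def reversepath_def\<close>)
qed

lemma homotopic_paths_reverse_left:
  fixes p :: "real \<Rightarrow> 'a::topological_space"
  assumes "path p" "path_image p \<subseteq> X" "b = pathfinish p"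
  shows "homotopic_paths X (reversepath p +++ p) (\<lambda>_. b)"
  using homotopic_paths_reverse_right[of "reversepath p" X b] assms by simp

lemma path_class_eqI: "homotopic_paths X p q \<Longrightarrow> path_class X p = path_class X q"
  unfolding path_class_def
  by (blast intro: homotopic_paths_sym homotopic_paths_trans)

lemma loops_join: "p \<in> loops X a \<Longrightarrow> q \<in> loops X a \<Longrightarrow> p +++ q \<in> loops X a"
  by (auto simp: loops_def path_image_join)

lemma loops_reversepath: "p \<in> loops X a \<Longrightarrow> reversepath p \<in> loops X a"
  by (auto simp: loops_def)

lemma loops_const: "a \<in> X \<Longrightarrow> (\<lambda>_. a) \<in> loops X a"
  by (auto simp: loops_def path_def path_image_def pathstart_def pathfinish_def)

lemma loops_homotopic_refl: "p \<in> loops X a \<Longrightarrow> homotopic_paths X p p"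
  by (simp add: loops_def)

lemma fundamental_group_mult:
  assumes "p \<in> loops X a" "q \<in> loops X a"
  shows "path_class X p \<otimes>\<^bsub>fundamental_group X a\<^esub> path_class X q = path_class X (p +++ q)"
proof -
  have ref: "homotopic_paths X p p" "homotopic_paths X q q"
    by (rule loops_homotopic_refl, fact)+
  have eq: "path_class X (p' +++ q') = path_class X (p +++ q)"
    if "p' \<in> path_class X p" "q' \<in> path_class X q" for p' q'
  proof -
    have "homotopic_paths X (p +++ q) (p' +++ q')"
      by (rule homotopic_paths_join) (use that assms in \<open>auto simp: path_class_def loops_def\<close>)
    then show ?thesis by (simp add: path_class_eqI)
  qed
  have mem: "p \<in> path_class X p" "q \<in> path_class X q"
    using ref by (simp_all only: path_class_def mem_Collect_eq)
  have "(\<Union>p'\<in>path_class X p. \<Union>q'\<in>path_class X q. path_class X (p' +++ q')) =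
      (\<Union>p'\<in>path_class X p. \<Union>q'\<in>path_class X q. path_class X (p +++ q))"
    by (intro SUP_cong refl eq)
  also have "\<dots> = path_class X (p +++ q)" using mem by blast
  finally show ?thesis by (simp add: fundamental_group_def)
qed

lemma group_fundamental_group:
  assumes "a \<in> X"
  shows "group (fundamental_group X a)"
proof (rule groupI)
  let ?G = "fundamental_group X a"
  have carr: "carrier ?G = path_class X ` loops X a" and one: "\<one>\<^bsub>?G\<^esub> = path_class X (\<lambda>_. a)"
    by (simp_all add: fundamental_group_def)
  show "\<one>\<^bsub>?G\<^esub> \<in> carrier ?G"
    using loops_const[OF assms] by (simp add: carr one)
  show "A \<otimes>\<^bsub>?G\<^esub> B \<in> carrier ?G" if "A \<in> carrier ?G" "B \<in> carrier ?G" for A B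
    using that by (auto simp: carr fundamental_group_mult intro!: imageI loops_join)
  show "A \<otimes>\<^bsub>?G\<^esub> B \<otimes>\<^bsub>?G\<^esub> C = A \<otimes>\<^bsub>?G\<^esub> (B \<otimes>\<^bsub>?G\<^esub> C)"
    if "A \<in> carrier ?G" "B \<in> carrier ?G" "C \<in> carrier ?G" for A B C
  proof -
    obtain p q r where pqr: "A = path_class X p" "B = path_class X q" "C = path_class X r"
      and l: "p \<in> loops X a" "q \<in> loops X a" "r \<in> loops X a"
      using \<open>A \<in> carrier ?G\<close> \<open>B \<in> carrier ?G\<close> \<open>C \<in> carrier ?G\<close> by (auto simp: carr)
    have "homotopic_paths X (p +++ (q +++ r)) ((p +++ q) +++ r)"
      by (rule homotopic_paths_assoc) (use l in \<open>auto simp: loops_def\<close>)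
    then show ?thesis
      using l by (simp add: pqr fundamental_group_mult loops_join path_class_eqI)
  qed
  show "\<one>\<^bsub>?G\<^esub> \<otimes>\<^bsub>?G\<^esub> A = A" if A: "A \<in> carrier ?G" for A
  proof -
    obtain p where p: "A = path_class X p" "p \<in> loops X a" using A by (auto simp: carr)
    have "homotopic_paths X ((\<lambda>_. a) +++ p) p"
      by (rule homotopic_paths_const_left) (use p in \<open>auto simp: loops_def\<close>)
    then show ?thesis
      using p loops_const[OF assms] by (simp add: one fundamental_group_mult path_class_eqI)
  qed
  show "\<exists>B\<in>carrier ?G. B \<otimes>\<^bsub>?G\<^esub> A = \<one>\<^bsub>?G\<^esub>" if A: "A \<in> carrier ?G" for A
  proof -
    obtain p where p: "A = path_class X p" "p \<in> loops X a" using A by (auto simp: carr)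
    have "homotopic_paths X (reversepath p +++ p) (\<lambda>_. a)"
      by (rule homotopic_paths_reverse_left) (use p in \<open>auto simp: loops_def\<close>)
    then show ?thesis
      using p loops_reversepath[OF p(2)]
      by (intro bexI[of _ "path_class X (reversepath p)"])
        (auto simp: carr one fundamental_group_mult path_class_eqI)
  qed
qed

lemma transport_path_class:
  assumes s: "path s" "path_image s \<subseteq> X" and p: "p \<in> loops Y (pathfinish s)" and "Y \<subseteq> X"
  shows "transport X s (path_class Y p) = path_class X (s +++ (p +++ reversepath s))"
proof -
  have eq: "path_class X (s +++ (q +++ reversepath s)) = path_class X (s +++ (p +++ reversepath s))"
    if "q \<in> path_class Y p" for q
  proof -
    have h: "homotopic_paths X p q"
      using that \<open>Y \<subseteq> X\<close> homotopic_paths_subset by (auto simp: path_class_def)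
    have "homotopic_paths X (s +++ (p +++ reversepath s)) (s +++ (q +++ reversepath s))"
      by (intro homotopic_paths_join h) (use s p in \<open>auto simp: loops_def\<close>)
    then show ?thesis by (simp add: path_class_eqI)
  qed
  have mem: "p \<in> path_class Y p"
    using loops_homotopic_refl[OF p] by (simp only: path_class_def mem_Collect_eq)
  have "transport X s (path_class Y p) =
      (\<Union>q\<in>path_class Y p. path_class X (s +++ (p +++ reversepath s)))"
    unfolding transport_def by (intro SUP_cong refl eq)
  also have "\<dots> = path_class X (s +++ (p +++ reversepath s))" using mem by blast
  finally show ?thesis .
qed

lemma homotopic_paths_conj_join:
  fixes s :: "real \<Rightarrow> 'a::topological_space"
  assumes s: "path s" "path_image s \<subseteq> X"
    and p: "p \<in> loops X (pathfinish s)" and q: "q \<in> loops X (pathfinish s)"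
  shows "homotopic_paths X ((s +++ (p +++ reversepath s)) +++ (s +++ (q +++ reversepath s)))
           (s +++ ((p +++ q) +++ reversepath s))"
proof -
  let ?r = "reversepath s"
  let ?b = "pathfinish s"
  have l: "path p" "path_image p \<subseteq> X" "pathstart p = ?b" "pathfinish p = ?b"
    "path q" "path_image q \<subseteq> X" "pathstart q = ?b" "pathfinish q = ?b"
    using p q by (auto simp: loops_def)
  note [simp] = s l
  note [trans] = homotopic_paths_trans
  have im [simp]: "path_image (f +++ g) \<subseteq> X"
    if "path_image f \<subseteq> X" "path_image g \<subseteq> X" for f g :: "real \<Rightarrow> 'a"
    using that by (rule subset_path_image_join)
  have "homotopic_paths X ((s +++ (p +++ ?r)) +++ (s +++ (q +++ ?r)))
          (s +++ ((p +++ ?r) +++ (s +++ (q +++ ?r))))"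
    by (rule homotopic_paths_sym, rule homotopic_paths_assoc) simp_all
  also have "homotopic_paths X \<dots> (s +++ (p +++ (?r +++ (s +++ (q +++ ?r)))))"
    by (rule homotopic_paths_join, simp, rule homotopic_paths_sym, rule homotopic_paths_assoc)
      simp_all
  also have "homotopic_paths X \<dots> (s +++ (p +++ ((?r +++ s) +++ (q +++ ?r))))"
    by (rule homotopic_paths_join, simp, rule homotopic_paths_join, simp,
        rule homotopic_paths_assoc) simp_all
  also have "homotopic_paths X \<dots> (s +++ (p +++ ((\<lambda>_. ?b) +++ (q +++ ?r))))"
    by (rule homotopic_paths_join, simp, rule homotopic_paths_join, simp,
        rule homotopic_paths_join, rule homotopic_paths_reverse_left) simp_all
  also have "homotopic_paths X \<dots> (s +++ (p +++ (q +++ ?r)))"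
    by (rule homotopic_paths_join, simp, rule homotopic_paths_join, simp,
        rule homotopic_paths_const_left) (simp_all, simp_all add: pathstart_def)
  also have "homotopic_paths X \<dots> (s +++ ((p +++ q) +++ ?r))"
    by (rule homotopic_paths_join, simp, rule homotopic_paths_assoc) simp_all
  finally show ?thesis .
qed

lemma transport_hom:
  assumes s: "path s" "path_image s \<subseteq> X" and "Y \<subseteq> X"
  shows "transport X s \<in>
    hom (fundamental_group Y (pathfinish s)) (fundamental_group X (pathstart s))"
proof (rule homI)
  let ?b = "pathfinish s"
  let ?H = "fundamental_group Y ?b" and ?G = "fundamental_group X (pathstart s)"
  have conj: "s +++ (p +++ reversepath s) \<in> loops X (pathstart s)" if p: "p \<in> loops Y ?b" for p
  proof -
    have "path_image (s +++ (p +++ reversepath s)) \<subseteq> X"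
      by (intro subset_path_image_join) (use p s \<open>Y \<subseteq> X\<close> in \<open>auto simp: loops_def\<close>)
    then show ?thesis using p s by (simp add: loops_def)
  qed
  have carr: "carrier (fundamental_group Z a) = path_class Z ` loops Z a" for Z :: "'a set" and a
    by (simp add: fundamental_group_def)
  show "transport X s A \<in> carrier ?G" if "A \<in> carrier ?H" for A
    using that conj by (auto simp: carr transport_path_class[OF s _ \<open>Y \<subseteq> X\<close>])
  show "transport X s (A \<otimes>\<^bsub>?H\<^esub> B) = transport X s A \<otimes>\<^bsub>?G\<^esub> transport X s B"
    if AB: "A \<in> carrier ?H" "B \<in> carrier ?H" for A B
  proof -
    obtain p q where pq: "A = path_class Y p" "B = path_class Y q" "p \<in> loops Y ?b" "q \<in> loops Y ?b"
      using AB by (auto simp: carr)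
    moreover from pq have "p \<in> loops X ?b" "q \<in> loops X ?b"
      using \<open>Y \<subseteq> X\<close> by (auto simp: loops_def)
    ultimately show ?thesis
      using path_class_eqI[OF homotopic_paths_conj_join[OF s]]
      by (simp add: fundamental_group_mult conj loops_join transport_path_class[OF s _ \<open>Y \<subseteq> X\<close>])
  qed
qed

lemma inverse_sequence_progroup:
  assumes U: "neighborhood_system X U" and \<gamma>: "ray_for_end X U e \<gamma>"
  shows "inverse_sequence (progroup_group U \<gamma>) (progroup_bond U \<gamma>)"
proof -
  have sub: "\<gamma> ` {real i..} \<subseteq> U i" and "continuous_on {0..} \<gamma>" for i
    using \<gamma> by (auto simp: ray_for_end_def singular_ray_def)
  have "path (ray_segment \<gamma> i)" for i
    unfolding path_def ray_segment_def
    by (rule continuous_on_compose2[OF \<open>continuous_on {0..} \<gamma>\<close>]) (auto intro!: continuous_intros)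
  moreover have "path_image (ray_segment \<gamma> i) \<subseteq> U i" for i
    using sub[of i] by (auto simp: path_image_def ray_segment_def)
  moreover have "pathstart (ray_segment \<gamma> i) = \<gamma> (real i)"
    "pathfinish (ray_segment \<gamma> i) = \<gamma> (real (Suc i))" for i
    by (simp_all add: pathstart_def pathfinish_def ray_segment_def add.commute)
  moreover have "U (Suc i) \<subseteq> U i" for i
    using U by (simp add: neighborhood_system_def)
  ultimately have "progroup_bond U \<gamma> i \<in> hom (progroup_group U \<gamma> (Suc i)) (progroup_group U \<gamma> i)" for i
    using transport_hom[of "ray_segment \<gamma> i" "U i" "U (Suc i)"]
    by (simp add: progroup_bond_def progroup_group_def)
  moreover have "group (progroup_group U \<gamma> i)" for i
    using sub[of i] by (auto simp: progroup_group_def intro!: group_fundamental_group)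
  ultimately show ?thesis by (simp add: inverse_sequence_def)
qed


section \<open>Existence of neighborhood systems of infinity\<close>

lemma neighborhood_system_exists:
  fixes X :: "'a::topological_space set"
  assumes lc: "locally_compact_space (top_of_set X)" and sc: "second_countable (top_of_set X)"
  shows "\<exists>U. neighborhood_system X U"
proof -
  have "\<forall>x\<in>X. \<exists>w. openin (top_of_set X) (fst w) \<and> compact (snd w) \<and>
      snd w \<subseteq> X \<and> x \<in> fst w \<and> fst w \<subseteq> snd w"
  proof
    fix x assume "x \<in> X"
    then have "x \<in> topspace (top_of_set X)" by simp
    then obtain u k where "openin (top_of_set X) u" "compactin (top_of_set X) k" "x \<in> u" "u \<subseteq> k"
      using lc unfolding locally_compact_space_def by blast
    moreover have "compact k" "k \<subseteq> X"
      using \<open>compactin (top_of_set X) k\<close> by (simp_all add: compactin_subtopology)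
    ultimately show "\<exists>w. openin (top_of_set X) (fst w) \<and> compact (snd w) \<and>
        snd w \<subseteq> X \<and> x \<in> fst w \<and> fst w \<subseteq> snd w"
      by (intro exI[of _ "(u, k)"]) simp
  qed
  from bchoice[OF this] obtain w where w: "\<forall>x\<in>X. openin (top_of_set X) (fst (w x)) \<and> compact (snd (w x)) \<and>
      snd (w x) \<subseteq> X \<and> x \<in> fst (w x) \<and> fst (w x) \<subseteq> snd (w x)"
    by (rule exE)
  define u where "u x = fst (w x)" for x
  define k where "k x = snd (w x)" for x
  have uk: "openin (top_of_set X) (u x) \<and> compact (k x) \<and> k x \<subseteq> X \<and> x \<in> u x \<and> u x \<subseteq> k x"
    if "x \<in> X" for x
    using w that by (simp add: u_def k_def)
  have "Lindelof_space (top_of_set X)"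
    using sc by (rule second_countable_imp_Lindelof_space)
  moreover have "\<Union>(u ` X) = X"
  proof (intro equalityI subsetI)
    show "y \<in> X" if y: "y \<in> \<Union>(u ` X)" for y
    proof -
      obtain x where "x \<in> X" "y \<in> u x" using y by (rule UN_E)
      then show ?thesis using uk[of x] by blast
    qed
    show "x \<in> \<Union>(u ` X)" if "x \<in> X" for x
      using uk[OF that] that by (intro UN_I[of x]) simp_all
  qed
  moreover have "openin (top_of_set X) T" if "T \<in> u ` X" for T
    using that uk by (elim imageE) simp
  ultimately obtain \<V> where \<V>: "countable \<V>" "\<V> \<subseteq> u ` X" "\<Union>\<V> = X"
    using Lindelof_spaceD[of "top_of_set X" "u ` X"] by auto
  then obtain D where D: "countable D" "D \<subseteq> X" "\<V> = u ` D"
    by (metis countable_subset_image)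
  have step: "\<exists>K'. compact K' \<and> K' \<subseteq> X \<and> k' \<subseteq> K' \<and>
      (\<exists>V. openin (top_of_set X) V \<and> K \<subseteq> V \<and> V \<subseteq> K')"
    if K: "compact K" "K \<subseteq> X" and k': "compact k'" "k' \<subseteq> X" for K k'
  proof -
    have "\<exists>F\<subseteq>u ` X. finite F \<and> K \<subseteq> \<Union>F"
    proof -
      have "compactin (top_of_set X) K" using K by (simp add: compactin_subtopology)
      from compactinD[OF this, of "u ` X"] show ?thesis
        using K(2) uk \<open>\<Union>(u ` X) = X\<close> by auto
    qed
    then obtain F where F: "finite F" "F \<subseteq> X" "K \<subseteq> \<Union>(u ` F)"
      by (metis finite_subset_image)
    show ?thesis
    proof (intro exI conjI)
      show "compact (k' \<union> \<Union>(k ` F))"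
        using F uk k' by (intro compact_Un compact_Union) auto
      show "k' \<union> \<Union>(k ` F) \<subseteq> X" using k' F uk by blast
      show "k' \<subseteq> k' \<union> \<Union>(k ` F)" by blast
      show "openin (top_of_set X) (\<Union>(u ` F))" using F uk by (intro openin_Union) auto
      show "K \<subseteq> \<Union>(u ` F)" by fact
      show "\<Union>(u ` F) \<subseteq> k' \<union> \<Union>(k ` F)" using F uk by blast
    qed
  qed
  define d where "d n = (if D = {} then {} else k (from_nat_into D n))" for n
  have d: "compact (d n)" "d n \<subseteq> X" for n
  proof -
    have "compact (d n) \<and> d n \<subseteq> X"
    proof (cases "D = {}")
      case False
      then have "from_nat_into D n \<in> X" using from_nat_into[of D n] D(2) by blast
      then show ?thesis using False uk[of "from_nat_into D n"] by (simp add: d_def)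
    qed (simp add: d_def)
    then show "compact (d n)" "d n \<subseteq> X" by simp_all
  qed
  have cover: "\<exists>n. x \<in> d n" if x: "x \<in> X" for x
  proof -
    obtain y where y: "y \<in> D" "x \<in> u y" using \<V>(3) D(3) x by blast
    then obtain n where n: "from_nat_into D n = y" using from_nat_into_surj[OF D(1)] by blast
    have "y \<in> X" using y(1) D(2) by blast
    then have "x \<in> k y" using y(2) uk[of y] by blast
    moreover have "d n = k y" using y(1) n by (auto simp: d_def)
    ultimately show ?thesis by blast
  qed
  have "\<exists>f. \<forall>n. (compact (f n) \<and> f n \<subseteq> X) \<and> d n \<subseteq> f (Suc n) \<and>
      (\<exists>V. openin (top_of_set X) V \<and> f n \<subseteq> V \<and> V \<subseteq> f (Suc n))"
  proof (rule dependent_nat_choice)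
    show "\<exists>K. compact K \<and> K \<subseteq> X" by (rule exI[of _ "{}"]) simp
    show "\<exists>K'. (compact K' \<and> K' \<subseteq> X) \<and> d n \<subseteq> K' \<and>
        (\<exists>V. openin (top_of_set X) V \<and> K \<subseteq> V \<and> V \<subseteq> K')"
      if "compact K \<and> K \<subseteq> X" for K n
      using step[OF conjunct1[OF that] conjunct2[OF that] d[of n]] by (simp add: conj_assoc)
  qed
  then obtain K where K_all: "\<forall>n. (compact (K n) \<and> K n \<subseteq> X) \<and> d n \<subseteq> K (Suc n) \<and>
      (\<exists>V. openin (top_of_set X) V \<and> K n \<subseteq> V \<and> V \<subseteq> K (Suc n))"
    by (rule exE)
  note K = K_all[rule_format]
  have "neighborhood_system X (\<lambda>n. X - K n)"
    unfolding neighborhood_system_def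
  proof (intro conjI allI)
    show "neighborhood_of_infinity X (X - K i)" for i
      using K[of i] by (auto simp: neighborhood_of_infinity_def)
    show "X - K (Suc i) \<subseteq> X - K i" for i
      using K[of i] by blast
    show "X \<inter> closure (X - K (Suc i)) \<subseteq> X - K i" for i
    proof -
      obtain V where V: "openin (top_of_set X) V" "K i \<subseteq> V" "V \<subseteq> K (Suc i)" using K[of i] by blast
      obtain T where T: "open T" "V = X \<inter> T" using V(1) by (auto simp: openin_open)
      have "closure (X - K (Suc i)) \<subseteq> - T"
        by (rule closure_minimal) (use V T in auto)
      then show ?thesis using V T by blast
    qed
    show "(\<Inter>i. X - K i) = {}"
    proof (intro equals0I)
      fix x assume x: "x \<in> (\<Inter>i. X - K i)"
      then have "x \<in> X" by blast
      then obtain n where "x \<in> d n" using cover by blast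
      then have "x \<in> K (Suc n)" using K[of n] by blast
      then show False using x by blast
    qed
  qed
  then show ?thesis by blast
qed

lemma locally_compact_complex_manifold:
  fixes M :: "'a::topological_space set" and \<A> :: "('a set \<times> ('a \<Rightarrow> complex ^ 'n)) set"
  assumes "complex_manifold M \<A>"
  shows "locally_compact_space (top_of_set M)"
  unfolding locally_compact_space_def
proof
  fix x assume "x \<in> topspace (top_of_set M)"
  moreover have "complex_atlas M \<A>" using assms by (simp add: complex_manifold_def)
  then have charts: "\<forall>(W, \<phi>)\<in>\<A>. chart M W \<phi>" and "\<Union>(fst ` \<A>) = M"
    by (auto simp: complex_atlas_def)
  ultimately have "x \<in> \<Union>(fst ` \<A>)" by simp
  then obtain W and \<phi> :: "'a \<Rightarrow> complex ^ 'n" where "(W, \<phi>) \<in> \<A>" "x \<in> W" by auto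
  then have W: "x \<in> W" "chart M W \<phi>" using charts by auto
  let ?\<psi> = "inv_into W \<phi>"
  have o: "openin (top_of_set M) W" "open (\<phi> ` W)" and h: "homeomorphism W (\<phi> ` W) \<phi> ?\<psi>"
    using W by (auto simp: chart_def)
  obtain r where r: "r > 0" "cball (\<phi> x) r \<subseteq> \<phi> ` W"
    using o(2) W(1) open_contains_cball by blast
  have cont: "continuous_on (\<phi> ` W) ?\<psi>" and eq: "?\<psi> ` \<phi> ` W = W" and inv: "\<And>y. y \<in> W \<Longrightarrow> ?\<psi> (\<phi> y) = y"
    using h by (auto simp: homeomorphism_def)
  have "openin (top_of_set W) (?\<psi> ` ball (\<phi> x) r)"
  proof (rule homeomorphism_imp_open_map[OF homeomorphism_symD[OF h]])
    show "openin (top_of_set (\<phi> ` W)) (ball (\<phi> x) r)"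
      using r o(2) ball_subset_cball by (metis open_ball openin_open_eq order_trans)
  qed
  then have "openin (top_of_set M) (?\<psi> ` ball (\<phi> x) r)"
    using o(1) openin_trans by blast
  moreover have "compactin (top_of_set M) (?\<psi> ` cball (\<phi> x) r)"
  proof -
    have "compact (?\<psi> ` cball (\<phi> x) r)"
      using r cont by (intro compact_continuous_image continuous_on_subset[OF cont]) auto
    moreover have "?\<psi> ` cball (\<phi> x) r \<subseteq> M"
      using r eq openin_imp_subset[OF o(1)] by blast
    ultimately show ?thesis by (simp add: compactin_subtopology)
  qed
  moreover have "x \<in> ?\<psi> ` ball (\<phi> x) r"
    using inv[OF W(1)] r(1) by (intro image_eqI[of _ _ "\<phi> x"]) auto
  moreover have "?\<psi> ` ball (\<phi> x) r \<subseteq> ?\<psi> ` cball (\<phi> x) r"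
    using ball_subset_cball by blast
  ultimately show "\<exists>U K. openin (top_of_set M) U \<and> compactin (top_of_set M) K \<and> x \<in> U \<and> U \<subseteq> K"
    by blast
qed

lemma component_neighborhood_system_exists:
  fixes M :: "'a::topological_space set" and \<A> :: "('a set \<times> ('a \<Rightarrow> complex ^ 'n)) set"
  assumes M: "complex_manifold M \<A>" and C: "C \<in> components M"
  shows "\<exists>U. neighborhood_system C U"
proof (rule neighborhood_system_exists)
  have sub: "top_of_set C = subtopology (top_of_set M) C"
    using in_components_subset[OF C] by (simp add: subtopology_subtopology inf.absorb2)
  show "locally_compact_space (top_of_set C)"
    unfolding sub using locally_compact_complex_manifold[OF M] closedin_component[OF C]
    by (rule locally_compact_space_closed_subset)
  show "second_countable (top_of_set C)"
    unfolding sub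
    by (rule second_countable_subtopology) (use M in \<open>simp add: complex_manifold_def\<close>)
qed

end

theory Submission
  imports Defs "HOL-Complex_Analysis.Cauchy_Integral_Formula"
begin

text \<open>
Let \<open>f = \<bar>g\<^sub>1\<bar>\<^sup>2 + \<dots> + \<bar>g\<^sub>k\<bar>\<^sup>2\<close> with holomorphic \<open>g\<^sub>j\<close> among which there are local coordinates near \<open>p\<close>.
The second derivative of \<open>f\<close> at \<open>p\<close> in the direction \<open>v\<close> is \<open>2 \<Sum> \<bar>D\<^sub>v g\<^sub>j\<bar>\<^sup>2 + 2 Re q(v)\<close>, where the first
summand is positive and \<open>q\<close> is a complex quadratic form. In dimension at least 2 there is an isotropic
vector \<open>v\<close> of \<open>q\<close>. As \<open>q\<close> vanishes on the whole complex line of \<open>v\<close>, the function \<open>f\<close> is strictly convex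
near \<open>p\<close> along all real lines whose direction lies in this complex line. If the derivative of \<open>f\<close> at \<open>p\<close>
vanishes on that line, then \<open>f\<close> is larger than \<open>f p\<close> on a small circle around \<open>p\<close> in it, and every \<open>x\<close> near
\<open>p\<close> can climb to the corresponding circle around \<open>x\<close> along one of two opposite directions; as circles
are connected, any two points of \<open>{f > a}\<close> near \<open>p\<close> can be joined in \<open>{f > a}\<close>, for all levels \<open>a\<close> up to
slightly above \<open>f p\<close>. If the derivative does not vanish, one direction of ascent serves all points near
\<open>p\<close> (\<open>superlevel_locally_connected\<close>). This takes the place of the bound on the indices of critical points
in Morse theory.

Connectedness of superlevel sets near every point is a statement about points, but it controls paths.
Cut a path that runs slightly below a level into short pieces, join the cutting points to higher points
nearby, and replace each piece by a path between the higher points above the level. Old and new piece lie in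
a common simply connected set, so they are homotopic. Climbing from level to level, every path in
\<open>{F > c}\<close> with ends in \<open>{F > c'}\<close> becomes homotopic, in \<open>{F > c\<^sub>0}\<close> with \<open>c\<^sub>0 < c\<close>, to a path in \<open>{F > c'}\<close>
(\<open>push_paths_upwards\<close>).

Holomorphic convexity supplies the functions (\<open>stein_exhaustion\<close>): for a compact set \<open>K\<close> there is a compact
set \<open>K'\<close> such that, for each compact \<open>L\<close>, some such \<open>F\<close> is smaller on \<open>K\<close> than outside \<open>K'\<close> and has a
compact sublevel set containing \<open>L\<close>. Pushing paths up the levels of \<open>F\<close> shows two things
(\<open>stein_push\<close>): any two points outside \<open>K'\<close> can be joined outside \<open>K\<close>, so there is one end; and a loop
outside \<open>K'\<close> can be deformed, outside \<open>K\<close>, to a loop outside \<open>L\<close>, however large \<open>L\<close> is. The composite bonding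
maps of the progroup are conjugations by parts of the ray (\<open>bond_comp_path_class\<close>), so the second statement
says that the images of the groups stabilize (\<open>mittag_leffler_ray\<close>).
\<close>

section \<open>Directional derivatives of holomorphic functions of several variables\<close>

lemma norm_complex_scalar_mult: "norm (c *s v) = cmod c * norm (v :: complex ^ 'n)"
  by (simp add: norm_vec_def norm_mult L2_set_right_distrib)

lemma bounded_linear_scalar_mult_left: "bounded_linear (\<lambda>c. c *s (v :: complex ^ 'n))"
  by (rule bounded_linear_intro[where K = "norm v"])
    (simp_all add: vec_eq_iff algebra_simps norm_complex_scalar_mult)

lemmas continuous_on_scalar_mult [continuous_intros] =
  bounded_linear.continuous_on[OF bounded_linear_scalar_mult_left]

text \<open>
Defined through a single complex variable, so that Cauchy's integral formula applies directly.
\<close>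

definition dir_deriv :: "(complex ^ 'n \<Rightarrow> complex) \<Rightarrow> complex ^ 'n \<Rightarrow> complex ^ 'n \<Rightarrow> complex" where
  "dir_deriv g v z = deriv (\<lambda>\<zeta>. g (z + \<zeta> *s v)) 0"

lemma has_field_derivative_along_line:
  fixes z v :: "complex ^ 'n"
  assumes g: "(g has_derivative D) (at (z + \<zeta>0 *s v))" and D: "\<And>c v. D (c *s v) = c * D v"
  shows "((\<lambda>\<zeta>. g (z + \<zeta> *s v)) has_field_derivative D v) (at \<zeta>0)"
proof -
  have "((\<lambda>\<zeta>. z + \<zeta> *s v) has_derivative (\<lambda>\<zeta>. \<zeta> *s v)) (at \<zeta>0)"
    using bounded_linear_imp_has_derivative[OF bounded_linear_scalar_mult_left[of v], of "at \<zeta>0"]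
    by (intro has_derivative_eq_rhs[OF has_derivative_add[OF has_derivative_const]]) auto
  from diff_chain_at[OF this g] have "((\<lambda>\<zeta>. g (z + \<zeta> *s v)) has_derivative (\<lambda>\<zeta>. D (\<zeta> *s v))) (at \<zeta>0)"
    by (simp add: o_def)
  then show ?thesis
    by (rule has_derivative_imp_has_field_derivative) (simp add: D)
qed

lemma dir_deriv_eq:
  assumes "(g has_derivative D) (at z)" "\<And>c v. D (c *s v) = c * D v"
  shows "dir_deriv g v z = D v"
  unfolding dir_deriv_def
  by (rule DERIV_imp_deriv, rule has_field_derivative_along_line) (use assms in auto)

lemma holo_on_has_derivative:
  assumes "holo_on g V" "z \<in> V"
  shows "(g has_derivative (\<lambda>v. dir_deriv g v z)) (at z)"
    and "dir_deriv g (c *s v) z = c * dir_deriv g v z"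
    and "dir_deriv g (v + w) z = dir_deriv g v z + dir_deriv g w z"
proof -
  obtain D where D: "(g has_derivative D) (at z)" "\<And>c v. D (c *s v) = c * D v"
    using assms unfolding holo_on_def by blast
  note eq = dir_deriv_eq[OF D]
  interpret bounded_linear D by (rule has_derivative_bounded_linear[OF D(1)])
  show "(g has_derivative (\<lambda>v. dir_deriv g v z)) (at z)"
    "dir_deriv g (c *s v) z = c * dir_deriv g v z"
    "dir_deriv g (v + w) z = dir_deriv g v z + dir_deriv g w z"
    using D by (simp_all add: eq add)
qed

lemma holo_on_line_derivative:
  assumes "holo_on g V" "z + \<zeta> *s v \<in> V"
  shows "((\<lambda>\<zeta>. g (z + \<zeta> *s v)) has_field_derivative dir_deriv g v (z + \<zeta> *s v)) (at \<zeta>)"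
  using has_field_derivative_along_line[OF holo_on_has_derivative(1)[OF assms]]
    holo_on_has_derivative(2)[OF assms] by simp

lemma holo_on_imp_continuous_on:
  assumes "holo_on g V" shows "continuous_on V g"
  using holo_on_has_derivative(1)[OF assms]
  by (intro continuous_at_imp_continuous_on ballI) (rule has_derivative_continuous)

text \<open>
Cauchy's formula on the circle of radius \<open>\<rho>\<close> in the complex line through \<open>z\<close>. As an integral over
\<open>[0, 1]\<close> it is subject to the rules on continuity and differentiability of parameter integrals in \<open>z\<close>.
\<close>

lemma dir_deriv_Cauchy:
  assumes g: "holo_on g V" and \<rho>: "\<rho> > 0" and V: "\<And>\<zeta>. cmod \<zeta> \<le> \<rho> \<Longrightarrow> z + \<zeta> *s v \<in> V"
  shows "dir_deriv g v z =
    integral {0..1} (\<lambda>t. g (z + (\<rho> * exp (2 * of_real pi * \<i> * of_real t)) *s v)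
                          / (\<rho> * exp (2 * of_real pi * \<i> * of_real t)))"
proof -
  let ?h = "\<lambda>\<zeta>. g (z + \<zeta> *s v)"
  have der: "(?h has_field_derivative dir_deriv g v (z + \<zeta> *s v)) (at \<zeta>)" if "\<zeta> \<in> cball 0 \<rho>" for \<zeta>
    by (rule holo_on_line_derivative[OF g]) (use V that in auto)
  have cont: "continuous_on (cball 0 \<rho>) ?h"
    using der by (intro continuous_at_imp_continuous_on ballI) (blast intro: DERIV_isCont)
  have hol: "?h holomorphic_on ball 0 \<rho>"
    using der unfolding holomorphic_on_def field_differentiable_def
    by (meson ball_subset_cball has_field_derivative_at_within subsetD)
  have c: "((\<lambda>u. ?h u / (u - 0) ^ Suc 1) has_contour_integral (2 * pi * \<i>) / (fact 1) * (deriv ^^ 1) ?h 0)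
         (circlepath 0 \<rho>)"
    by (rule Cauchy_has_contour_integral_higher_derivative_circlepath[OF cont hol]) (use \<rho> in auto)
  have "((\<lambda>t. ?h (circlepath 0 \<rho> t) / circlepath 0 \<rho> t ^ 2 *
      (2 * pi * \<i> * \<rho> * exp (2 * of_real pi * \<i> * t))) has_integral 2 * pi * \<i> * dir_deriv g v z) {0..1}"
    using c unfolding has_contour_integral_def dir_deriv_def
    by (subst has_integral_cong[where g = "\<lambda>t. ?h (circlepath 0 \<rho> t) / (circlepath 0 \<rho> t - 0) ^ Suc 1
        * vector_derivative (circlepath 0 \<rho>) (at t within {0..1})"])
      (simp_all add: vector_derivative_circlepath01 power2_eq_square)
  then have "((\<lambda>t. 2 * pi * \<i> * (g (z + (\<rho> * exp (2 * of_real pi * \<i> * of_real t)) *s v)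
                          / (\<rho> * exp (2 * of_real pi * \<i> * of_real t))))
       has_integral 2 * pi * \<i> * dir_deriv g v z) {0..1}"
    using \<rho> by (auto simp: circlepath_def power2_eq_square part_circlepath_def linepath_def field_simps)
  from has_integral_mult_right[OF this, of "1 / (2 * pi * \<i>)"]
  have "((\<lambda>t. g (z + (\<rho> * exp (2 * of_real pi * \<i> * of_real t)) *s v)
                          / (\<rho> * exp (2 * of_real pi * \<i> * of_real t)))
       has_integral dir_deriv g v z) {0..1}"
    by simp
  then show ?thesis by (simp add: integral_unique)
qed

text \<open>
Makes the domain of integration in Cauchy's formula the same for all base points near \<open>z0\<close>.
\<close>

lemma line_tube:
  fixes z0 v :: "complex ^ 'n"
  assumes "open V" "z0 \<in> V"
  obtains r \<rho> where "r > 0" "\<rho> > 0" "\<And>z \<zeta>. z \<in> ball z0 r \<Longrightarrow> cmod \<zeta> \<le> \<rho> \<Longrightarrow> z + \<zeta> *s v \<in> V"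
proof -
  obtain e where e: "e > 0" "ball z0 e \<subseteq> V" using assms open_contains_ball by blast
  show ?thesis
  proof
    show "e / 2 > 0" "e / 2 / (norm v + 1) > 0" using e by (simp_all add: add_nonneg_pos)
    fix z \<zeta> assume z: "z \<in> ball z0 (e / 2)" and "cmod \<zeta> \<le> e / 2 / (norm v + 1)"
    then have "cmod \<zeta> * (norm v + 1) \<le> e / 2"
      by (subst (asm) pos_le_divide_eq) (simp_all add: add_nonneg_pos)
    moreover have "norm (\<zeta> *s v) \<le> cmod \<zeta> * (norm v + 1)"
      by (simp add: norm_complex_scalar_mult distrib_left)
    ultimately have "norm (\<zeta> *s v) \<le> e / 2" by linarith
    moreover have "dist z0 (z + \<zeta> *s v) \<le> dist z0 z + norm (\<zeta> *s v)"
      by (metis dist_norm add_diff_cancel_left' dist_commute dist_triangle)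
    ultimately show "z + \<zeta> *s v \<in> V" using z e by (intro subsetD[OF e(2)]) auto
  qed
qed

definition circle_pt :: "real \<Rightarrow> real \<Rightarrow> complex" where
  "circle_pt \<rho> t = \<rho> * exp (2 * of_real pi * \<i> * of_real t)"

lemma norm_circle_pt: "cmod (circle_pt \<rho> t) = \<bar>\<rho>\<bar>"
  by (simp add: circle_pt_def norm_mult)

lemma circle_pt_nonzero: "\<rho> > 0 \<Longrightarrow> circle_pt \<rho> t \<noteq> 0"
  by (simp add: circle_pt_def)

lemma continuous_on_circle_pt [continuous_intros]:
  "continuous_on S h \<Longrightarrow> continuous_on S (\<lambda>x. circle_pt \<rho> (h x))"
  unfolding circle_pt_def by (intro continuous_intros)

lemma continuous_on_dir_deriv:
  assumes g: "holo_on g V" and V: "open V"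
  shows "continuous_on V (dir_deriv g v)"
  unfolding continuous_on_eq_continuous_at[OF V]
proof
  fix z0 assume "z0 \<in> V"
  then obtain r \<rho> where r: "r > 0" "\<rho> > 0"
    and tube: "\<And>z \<zeta>. z \<in> ball z0 r \<Longrightarrow> cmod \<zeta> \<le> \<rho> \<Longrightarrow> z + \<zeta> *s v \<in> V"
    using line_tube[OF V] by metis
  have "continuous_on (ball z0 r) (\<lambda>z. integral (cbox 0 1)
      (\<lambda>t. g (z + circle_pt \<rho> t *s v) / circle_pt \<rho> t))"
  proof (rule integral_continuous_on_param)
    show "continuous_on (ball z0 r \<times> cbox 0 1)
       (\<lambda>(x, t). g (x + circle_pt \<rho> t *s v) / circle_pt \<rho> t)"
      unfolding split_beta
      by (intro continuous_intros continuous_on_compose2[OF holo_on_imp_continuous_on[OF g]])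
        (use tube r in \<open>auto simp: norm_circle_pt circle_pt_nonzero\<close>)
  qed
  moreover have "dir_deriv g v z = integral (cbox 0 1)
      (\<lambda>t. g (z + circle_pt \<rho> t *s v) / circle_pt \<rho> t)" if "z \<in> ball z0 r" for z
    unfolding circle_pt_def box_real
    by (rule dir_deriv_Cauchy[OF g r(2) tube[OF that]])
  ultimately have "continuous_on (ball z0 r) (dir_deriv g v)"
    by (subst continuous_on_cong[OF refl]) auto
  then show "isCont (dir_deriv g v) z0"
    using r by (simp add: continuous_on_eq_continuous_at)
qed

text \<open>
Holomorphy is plain complex differentiability, so differentiability of higher order has to come from Cauchy's
formula. Differentiation under the integral sign applies because the derivative of \<open>g\<close> is continuous, its
values on a basis being directional derivatives.
\<close>

lemma holo_on_dir_deriv: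
  assumes g: "holo_on g V" and V: "open V"
  shows "holo_on (dir_deriv g v) V"
  unfolding holo_on_def
proof
  fix z0 assume z0: "z0 \<in> V"
  then obtain r \<rho> where r: "r > 0" "\<rho> > 0"
    and tube: "\<And>z \<zeta>. z \<in> ball z0 r \<Longrightarrow> cmod \<zeta> \<le> \<rho> \<Longrightarrow> z + \<zeta> *s v \<in> V"
    using line_tube[OF V] by metis
  let ?c = "circle_pt \<rho>"
  have tube': "z + ?c t *s v \<in> V" if "z \<in> ball z0 r" for z t
    using tube[OF that] r by (simp add: norm_circle_pt)
  define fx where "fx z t = Blinfun (\<lambda>w. dir_deriv g w (z + ?c t *s v) / ?c t)" for z t
  have der: "((\<lambda>z. g (z + ?c t *s v) / ?c t) has_derivative (\<lambda>w. dir_deriv g w (z + ?c t *s v) / ?c t)) (at z)"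
    if "z \<in> ball z0 r" for z t
  proof -
    have "((\<lambda>z. z + ?c t *s v) has_derivative (\<lambda>w. w)) (at z)"
      by (auto intro!: derivative_eq_intros)
    from diff_chain_at[OF this holo_on_has_derivative(1)[OF g tube'[OF that]]]
    have "((\<lambda>z. g (z + ?c t *s v)) has_derivative (\<lambda>w. dir_deriv g w (z + ?c t *s v))) (at z)"
      by (simp add: o_def)
    then show ?thesis by (rule bounded_linear.has_derivative[OF bounded_linear_divide])
  qed
  have fx: "blinfun_apply (fx z t) = (\<lambda>w. dir_deriv g w (z + ?c t *s v) / ?c t)" if "z \<in> ball z0 r" for z t
    unfolding fx_def
    by (rule bounded_linear_Blinfun_apply, rule has_derivative_bounded_linear, rule der, fact)
  have cont: "continuous_on (ball z0 r \<times> cbox 0 1) (\<lambda>(x, t). fx x t)"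
  proof (rule continuous_on_blinfun_componentwise)
    fix i :: "complex ^ 'a"
    have "continuous_on (ball z0 r \<times> cbox 0 1) (\<lambda>x. dir_deriv g i (fst x + ?c (snd x) *s v) / ?c (snd x))"
      by (intro continuous_intros continuous_on_compose2[OF continuous_on_dir_deriv[OF g V]])
        (use tube' r in \<open>auto simp: circle_pt_nonzero\<close>)
    then show "continuous_on (ball z0 r \<times> cbox 0 1) (\<lambda>x. blinfun_apply (case x of (x, t) \<Rightarrow> fx x t) i)"
      by (rule continuous_on_cong[THEN iffD1, rotated -1]) (auto simp: fx)
  qed
  have int: "(\<lambda>t. g (z + ?c t *s v) / ?c t) integrable_on cbox 0 1" if "z \<in> ball z0 r" for z
    by (intro integrable_continuous continuous_intros
        continuous_on_compose2[OF holo_on_imp_continuous_on[OF g]])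
      (use tube'[OF that] r in \<open>auto simp: circle_pt_nonzero\<close>)
  have eq: "dir_deriv g v z = integral (cbox 0 1) (\<lambda>t. g (z + ?c t *s v) / ?c t)" if "z \<in> ball z0 r" for z
    unfolding circle_pt_def box_real
    by (rule dir_deriv_Cauchy[OF g r(2) tube[OF that]])
  have z0r: "z0 \<in> ball z0 r" using r by simp
  have "((\<lambda>z. integral (cbox 0 1) (\<lambda>t. g (z + ?c t *s v) / ?c t)) has_derivative
       integral (cbox 0 1) (fx z0)) (at z0 within ball z0 r)"
    by (rule leibniz_rule[OF _ int cont z0r convex_ball])
      (auto simp: fx intro!: has_derivative_at_withinI der)
  then have "(dir_deriv g v has_derivative integral (cbox 0 1) (fx z0)) (at z0 within ball z0 r)"
    by (rule has_derivative_transform[OF z0r, rotated]) (rule eq)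
  then have "(dir_deriv g v has_derivative integral (cbox 0 1) (fx z0)) (at z0)"
    using at_within_open[OF z0r open_ball] by simp
  moreover have "integral (cbox 0 1) (fx z0) (a *s w) = a * integral (cbox 0 1) (fx z0) w" for a w
  proof -
    have "continuous_on (cbox 0 1) (\<lambda>t. case (z0, t) of (x, t) \<Rightarrow> fx x t)"
      by (rule continuous_on_compose2[OF cont]) (use r in \<open>auto intro!: continuous_intros\<close>)
    then have "fx z0 integrable_on cbox 0 1"
      by (intro integrable_continuous) simp
    then show ?thesis
      using holo_on_has_derivative(2)[OF g tube'[OF z0r]]
      by (simp add: blinfun_apply_integral fx[OF z0r] flip: times_divide_eq_right)
  qed
  ultimately show "\<exists>D. (dir_deriv g v has_derivative D) (at z0) \<and> (\<forall>c v. D (c *s v) = c * D v)"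
    by blast
qed

lemma holo_on_subset: "holo_on g V \<Longrightarrow> W \<subseteq> V \<Longrightarrow> holo_on g W"
  unfolding holo_on_def by blast

section \<open>Superlevel sets of sums of squares of holomorphic functions\<close>

lemma dir_deriv_cong:
  assumes "open V" "z \<in> V" "\<And>w. w \<in> V \<Longrightarrow> g w = h w"
  shows "dir_deriv g v z = dir_deriv h v z"
proof -
  have "open ((\<lambda>\<zeta>. z + \<zeta> *s v) -` V)"
    by (rule open_vimage[OF assms(1)]) (auto intro!: continuous_intros)
  then have "eventually (\<lambda>\<zeta>. \<zeta> \<in> (\<lambda>\<zeta>. z + \<zeta> *s v) -` V) (nhds 0)"
    by (rule eventually_nhds_in_open) (use assms(2) in simp)
  then show ?thesis unfolding dir_deriv_def
    by (intro deriv_cong_ev refl) (auto elim!: eventually_mono simp: assms(3))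
qed

text \<open>
The second derivatives at a point thus give a complex bilinear form, to which the next lemma applies.
\<close>

lemma second_dir_deriv_bilinear:
  assumes g: "holo_on g V" and V: "open V" "p \<in> V"
  shows "dir_deriv (dir_deriv g (a *s v + b *s w)) u p =
           a * dir_deriv (dir_deriv g v) u p + b * dir_deriv (dir_deriv g w) u p"
    and "dir_deriv (dir_deriv g u) (a *s v + b *s w) p =
           a * dir_deriv (dir_deriv g u) v p + b * dir_deriv (dir_deriv g u) w p"
proof -
  note D = holo_on_has_derivative(1)[OF holo_on_dir_deriv[OF g V(1)] V(2)]
  note lin = holo_on_has_derivative(2,3)[OF holo_on_dir_deriv[OF g V(1)] V(2)]
  have "((\<lambda>z. a * dir_deriv g v z + b * dir_deriv g w z) has_derivative
      (\<lambda>u. a * dir_deriv (dir_deriv g v) u p + b * dir_deriv (dir_deriv g w) u p)) (at p)"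
    by (intro has_derivative_add has_derivative_mult_right D)
  then have "dir_deriv (\<lambda>z. a * dir_deriv g v z + b * dir_deriv g w z) u p =
      a * dir_deriv (dir_deriv g v) u p + b * dir_deriv (dir_deriv g w) u p"
    by (rule dir_deriv_eq) (simp add: lin algebra_simps)
  moreover have "dir_deriv (dir_deriv g (a *s v + b *s w)) u p =
      dir_deriv (\<lambda>z. a * dir_deriv g v z + b * dir_deriv g w z) u p"
    by (rule dir_deriv_cong[OF V]) (simp add: holo_on_has_derivative[OF g])
  ultimately show "dir_deriv (dir_deriv g (a *s v + b *s w)) u p =
           a * dir_deriv (dir_deriv g v) u p + b * dir_deriv (dir_deriv g w) u p" by simp
  show "dir_deriv (dir_deriv g u) (a *s v + b *s w) p =
           a * dir_deriv (dir_deriv g u) v p + b * dir_deriv (dir_deriv g u) w p"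
    by (simp add: lin)
qed

text \<open>
On a plane spanned by two coordinate vectors the quadratic form is a polynomial of degree at most 2 in the
ratio of the coordinates, which has a complex root unless the second vector is itself isotropic. This is
where the main theorem uses that the dimension is at least 2.
\<close>

lemma isotropic_vector_exists:
  fixes Q :: "complex ^ 'n \<Rightarrow> complex ^ 'n \<Rightarrow> complex"
  assumes lin: "\<And>a b u v w. Q (a *s v + b *s w) u = a * Q v u + b * Q w u"
      "\<And>a b u v w. Q u (a *s v + b *s w) = a * Q u v + b * Q u w"
    and n: "CARD('n) \<ge> 2"
  obtains v where "v \<noteq> 0" "Q v v = 0"
proof -
  obtain i k :: 'n where ik: "i \<noteq> k"
    using n by (metis UNIV_I card_le_Suc0_iff_eq finite not_less_eq_eq numeral_2_eq_2)
  define e1 e2 :: "complex ^ 'n" where "e1 = axis i 1" and "e2 = axis k 1"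
  have e: "(a *s e1 + b *s e2) $ i = a" "(a *s e1 + b *s e2) $ k = b" for a b
    using ik by (simp_all add: e1_def e2_def axis_def)
  define A B C where "A = Q e1 e1" and "B = Q e1 e2 + Q e2 e1" and "C = Q e2 e2"
  have q: "Q (a *s e1 + b *s e2) (a *s e1 + b *s e2) = A * a^2 + B * a * b + C * b^2" for a b
    by (simp add: lin A_def B_def C_def power2_eq_square algebra_simps)
  show ?thesis
  proof (cases "C = 0")
    case True
    show ?thesis
      by (rule that[of "0 *s e1 + 1 *s e2"]) (use e[of 0 1] q[of 0 1] True in auto)
  next
    case False
    define b where "b = (csqrt (B^2 - 4 * A * C) - B) / (2 * C)"
    have sq: "csqrt (B^2 - 4 * A * C) = 2 * C * b + B" using False by (simp add: b_def)
    have "(2 * C * b + B)^2 = B^2 - 4 * A * C" by (metis sq power2_csqrt)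
    then have "4 * C * (A + B * b + C * b^2) = 0" by (simp add: power2_eq_square algebra_simps)
    then have "A + B * b + C * b^2 = 0" using False by simp
    moreover have "1 *s e1 + b *s e2 \<noteq> 0"
      using e(1)[of 1 b] by (metis zero_index zero_neq_one)
    ultimately show ?thesis
      using q[of 1 b] by (intro that[of "1 *s e1 + b *s e2"]) simp_all
  qed
qed

lemma DERIV_cmod_power2:
  fixes h :: "real \<Rightarrow> complex"
  assumes "(h has_vector_derivative h') (at t)"
  shows "((\<lambda>t. (cmod (h t))\<^sup>2) has_real_derivative 2 * Re (cnj (h t) * h')) (at t)"
proof -
  have "((\<lambda>t. Re (h t)) has_real_derivative Re h') (at t)" "((\<lambda>t. Im (h t)) has_real_derivative Im h') (at t)"
    unfolding has_real_derivative_iff_has_vector_derivative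
    by (rule bounded_linear.has_vector_derivative[OF bounded_linear_Re assms]
        bounded_linear.has_vector_derivative[OF bounded_linear_Im assms])+
  from DERIV_add[OF DERIV_power[OF this(1), of 2] DERIV_power[OF this(2), of 2]]
  show ?thesis unfolding cmod_power2 by (simp add: algebra_simps)
qed

lemma scaled_diff_le: "- (k * d) \<le> b \<Longrightarrow> 2 * (k * (c - d)) \<le> 2 * (k * c + b)" for k :: real
  by (simp add: algebra_simps)

locale sum_of_squares =
  fixes J :: "'j set" and G :: "'j \<Rightarrow> complex ^ 'n \<Rightarrow> complex" and V :: "(complex ^ 'n) set"
  assumes fin: "finite J" and V: "open V" and holo: "\<And>j. j \<in> J \<Longrightarrow> holo_on (G j) V"
begin

definition f where "f z = (\<Sum>j\<in>J. (cmod (G j z))\<^sup>2)"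

text \<open>
The first and second derivative of \<open>f\<close> along the real line in the direction \<open>u\<close>, see \<open>DERIV_f\<close> and \<open>DERIV_slope\<close>.
\<close>

definition slope where
  "slope u z = (\<Sum>j\<in>J. 2 * Re (cnj (G j z) * dir_deriv (G j) u z))"

definition curv where
  "curv u z = (\<Sum>j\<in>J. 2 * ((cmod (dir_deriv (G j) u z))\<^sup>2 +
     Re (cnj (G j z) * dir_deriv (dir_deriv (G j) u) u z)))"

lemma holo2: "j \<in> J \<Longrightarrow> holo_on (dir_deriv (G j) u) V"
  by (rule holo_on_dir_deriv[OF holo V])

lemma vector_derivative_line:
  assumes "holo_on g V" "z + of_real t *s u \<in> V"
  shows "((\<lambda>t. g (z + of_real t *s u)) has_vector_derivative dir_deriv g u (z + of_real t *s u)) (at t)"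
  using field_vector_diff_chain_at[OF has_vector_derivative_of_real[OF DERIV_ident] holo_on_line_derivative[OF assms]]
  by (simp add: o_def)

lemma DERIV_f:
  assumes "z + of_real t *s u \<in> V"
  shows "((\<lambda>t. f (z + of_real t *s u)) has_real_derivative slope u (z + of_real t *s u)) (at t)"
  unfolding f_def slope_def
  by (intro DERIV_sum DERIV_cmod_power2 vector_derivative_line[OF holo assms])

lemma DERIV_slope:
  assumes "z + of_real t *s u \<in> V"
  shows "((\<lambda>t. slope u (z + of_real t *s u)) has_real_derivative curv u (z + of_real t *s u)) (at t)"
  unfolding slope_def curv_def
proof (intro DERIV_sum)
  fix j assume j: "j \<in> J"
  let ?z = "z + of_real t *s u"
  note d = vector_derivative_line[OF holo[OF j] assms] vector_derivative_line[OF holo2[OF j] assms]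
  have "((\<lambda>t. 2 * Re (cnj (G j (z + of_real t *s u)) * dir_deriv (G j) u (z + of_real t *s u))) has_vector_derivative
    2 * Re (cnj (G j ?z) * dir_deriv (dir_deriv (G j) u) u ?z + cnj (dir_deriv (G j) u ?z) * dir_deriv (G j) u ?z)) (at t)"
    by (intro has_vector_derivative_mult_right
      bounded_linear.has_vector_derivative[OF bounded_linear_Re] has_vector_derivative_mult
      bounded_linear.has_vector_derivative[OF bounded_linear_cnj] d)
  moreover have "2 * Re (a + cnj w * w) = 2 * ((cmod w)\<^sup>2 + Re a)" for a w
    unfolding cmod_power2 by (simp add: power2_eq_square)
  ultimately show "((\<lambda>t. 2 * Re (cnj (G j (z + of_real t *s u)) * dir_deriv (G j) u (z + of_real t *s u)))
     has_real_derivative 2 * ((cmod (dir_deriv (G j) u ?z))\<^sup>2 +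
     Re (cnj (G j ?z) * dir_deriv (dir_deriv (G j) u) u ?z))) (at t)"
    unfolding has_real_derivative_iff_has_vector_derivative by (simp only:)
qed

lemma increasing_along_line:
  assumes V: "\<And>t. t \<in> {0..1} \<Longrightarrow> x + of_real t *s u \<in> V"
    and curv: "\<And>t. t \<in> {0..1} \<Longrightarrow> curv u (x + of_real t *s u) > 0"
    and slope: "slope u x \<ge> 0" and t: "0 < t" "t \<le> 1"
  shows "f (x + of_real t *s u) > f x"
proof -
  let ?S = "\<lambda>t. slope u (x + of_real t *s u)" and ?F = "\<lambda>t. f (x + of_real t *s u)"
  have pos: "?S s > 0" if "0 < s" "s \<le> 1" for s
  proof -
    have "?S 0 < ?S s"
    proof (rule DERIV_pos_imp_increasing[OF that(1)])
      fix t assume "0 \<le> t" "t \<le> s"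
      then have t: "t \<in> {0..1}" using that by simp
      show "\<exists>y. (?S has_real_derivative y) (at t) \<and> 0 < y"
        by (intro exI[of _ "curv u (x + of_real t *s u)"] conjI DERIV_slope V curv t)
    qed
    then show ?thesis using slope by simp
  qed
  have "?F 0 < ?F t"
  proof (rule DERIV_pos_imp_increasing_open[OF t(1)])
    show "continuous_on {0..t} ?F"
      using t by (intro continuous_at_imp_continuous_on ballI DERIV_isCont[OF DERIV_f] V) simp
    fix s assume "0 < s" "s < t"
    then show "\<exists>y. (?F has_real_derivative y) (at s) \<and> 0 < y"
      using t by (intro exI[of _ "?S s"] conjI DERIV_f V pos) simp_all
  qed
  then show ?thesis by simp
qed

lemma slope_scale:
  assumes "z \<in> V"
  shows "slope (of_real c *s u) z = c * slope u z"
  unfolding slope_def sum_distrib_left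
proof (rule sum.cong[OF refl])
  fix j assume "j \<in> J"
  then have dd: "dir_deriv (G j) (of_real c *s u) z = of_real c * dir_deriv (G j) u z"
    using assms by (rule holo_on_has_derivative(2)[OF holo])
  have "Re (cnj a * (of_real c * b)) = c * Re (cnj a * b)" for a b
    by (simp add: algebra_simps)
  then show "2 * Re (cnj (G j z) * dir_deriv (G j) (of_real c *s u) z) =
      c * (2 * Re (cnj (G j z) * dir_deriv (G j) u z))"
    unfolding dd by simp
qed

lemma continuous_on_slope: "continuous_on V (slope u)"
  unfolding slope_def
  by (intro continuous_intros holo_on_imp_continuous_on holo holo2)

lemma continuous_on_f: "continuous_on V f"
  unfolding f_def by (intro continuous_intros holo_on_imp_continuous_on holo)

text \<open>
Half of a lower bound for \<open>curv (\<zeta> *s v)\<close> with \<open>\<bar>\<zeta>\<bar> = 1\<close>, valid for all these \<open>\<zeta>\<close> at once: the first sum is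
unchanged when \<open>v\<close> is multiplied by \<open>\<zeta>\<close>, and the second one is multiplied by \<open>\<zeta>\<^sup>2\<close>.
\<close>

definition margin where
  "margin v z = (\<Sum>j\<in>J. (cmod (dir_deriv (G j) v z))\<^sup>2)
     - cmod (\<Sum>j\<in>J. cnj (G j z) * dir_deriv (dir_deriv (G j) v) v z)"

lemma continuous_on_margin: "continuous_on V (margin v)"
  unfolding margin_def
  by (intro continuous_intros holo_on_imp_continuous_on[OF holo] holo_on_imp_continuous_on[OF holo2]
     holo_on_imp_continuous_on[OF holo_on_dir_deriv[OF holo2 V]])

lemma curv_pos:
  assumes z: "z \<in> V" and m: "margin v z > 0" and c: "\<zeta> \<noteq> 0"
  shows "curv (\<zeta> *s v) z > 0"
proof -
  have dd: "dir_deriv (dir_deriv (G j) (\<zeta> *s v)) (\<zeta> *s v) z = \<zeta>\<^sup>2 * dir_deriv (dir_deriv (G j) v) v z"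
    if "j \<in> J" for j
    using second_dir_deriv_bilinear(1)[OF holo[OF that] V z, of \<zeta> v 0 0 "\<zeta> *s v"]
      second_dir_deriv_bilinear(2)[OF holo[OF that] V z, of v \<zeta> v 0 0]
    by (simp add: power2_eq_square)
  have "curv (\<zeta> *s v) z = (\<Sum>j\<in>J. 2 * (cmod \<zeta>)\<^sup>2 * (cmod (dir_deriv (G j) v z))\<^sup>2 +
      2 * Re (\<zeta>\<^sup>2 * (cnj (G j z) * dir_deriv (dir_deriv (G j) v) v z)))"
    unfolding curv_def
  proof (rule sum.cong[OF refl])
    fix j assume j: "j \<in> J"
    have "dir_deriv (G j) (\<zeta> *s v) z = \<zeta> * dir_deriv (G j) v z"
      by (rule holo_on_has_derivative(2)[OF holo[OF j] z])
    then show "2 * ((cmod (dir_deriv (G j) (\<zeta> *s v) z))\<^sup>2 +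
        Re (cnj (G j z) * dir_deriv (dir_deriv (G j) (\<zeta> *s v)) (\<zeta> *s v) z)) =
      2 * (cmod \<zeta>)\<^sup>2 * (cmod (dir_deriv (G j) v z))\<^sup>2 +
      2 * Re (\<zeta>\<^sup>2 * (cnj (G j z) * dir_deriv (dir_deriv (G j) v) v z))"
      by (simp only: dd[OF j] norm_mult power_mult_distrib distrib_left mult.assoc
          mult.left_commute[of "cnj (G j z)" "\<zeta>\<^sup>2"])
  qed
  also have "\<dots> = 2 * ((cmod \<zeta>)\<^sup>2 * (\<Sum>j\<in>J. (cmod (dir_deriv (G j) v z))\<^sup>2) +
      Re (\<zeta>\<^sup>2 * (\<Sum>j\<in>J. cnj (G j z) * dir_deriv (dir_deriv (G j) v) v z)))"
    by (simp only: sum.distrib distrib_left sum_distrib_left mult.assoc Re_sum)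
  finally have eq: "curv (\<zeta> *s v) z = 2 * ((cmod \<zeta>)\<^sup>2 * (\<Sum>j\<in>J. (cmod (dir_deriv (G j) v z))\<^sup>2) +
      Re (\<zeta>\<^sup>2 * X))" if "X = (\<Sum>j\<in>J. cnj (G j z) * dir_deriv (dir_deriv (G j) v) v z)" for X
    using that by simp
  have "Re (\<zeta>\<^sup>2 * X) \<ge> - ((cmod \<zeta>)\<^sup>2 * cmod X)" for X
    using abs_Re_le_cmod[of "\<zeta>\<^sup>2 * X"] unfolding norm_mult norm_power by linarith
  from this[of "\<Sum>j\<in>J. cnj (G j z) * dir_deriv (dir_deriv (G j) v) v z"]
  have "curv (\<zeta> *s v) z \<ge> 2 * ((cmod \<zeta>)\<^sup>2 * margin v z)"
    unfolding margin_def eq[OF refl] by (rule scaled_diff_le)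
  moreover have "(cmod \<zeta>)\<^sup>2 * margin v z > 0" using m c by simp
  ultimately show ?thesis by linarith
qed

text \<open>
For an isotropic vector \<open>v\<close> of the quadratic form at \<open>p\<close>, the second sum in \<open>margin v p\<close> vanishes and the first
is positive, since some \<open>G j\<close> has a nonzero derivative along \<open>v\<close>. So \<open>margin v\<close> is positive near \<open>p\<close>, and
there \<open>f\<close> is strictly convex along all real lines in the complex direction \<open>v\<close>.
\<close>

lemma ascending_disc:
  assumes p: "p \<in> V" and n: "CARD('n) \<ge> 2"
    and imm: "\<And>v. v \<noteq> 0 \<Longrightarrow> \<exists>j\<in>J. dir_deriv (G j) v p \<noteq> 0"
  obtains v R where "R > 0" "ball p R \<subseteq> V"
    "\<And>x \<zeta>. \<lbrakk>\<zeta> \<noteq> 0; x \<in> ball p R; x + \<zeta> *s v \<in> ball p R; slope (\<zeta> *s v) x \<ge> 0\<rbrakk>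
       \<Longrightarrow> \<forall>t\<in>{0<..1}. f (x + of_real t *s (\<zeta> *s v)) > f x"
proof -
  define P where "P u w = (\<Sum>j\<in>J. cnj (G j p) * dir_deriv (dir_deriv (G j) u) w p)" for u w
  have lin: "P (a *s v + b *s w) u = a * P v u + b * P w u"
    "P u (a *s v + b *s w) = a * P u v + b * P u w" for a b u v w
    unfolding P_def sum_distrib_left sum.distrib[symmetric]
    by (auto intro!: sum.cong simp: second_dir_deriv_bilinear[OF holo V p] algebra_simps)
  obtain v where v: "v \<noteq> 0" "P v v = 0"
    by (rule isotropic_vector_exists[of P]) (use lin n in auto)
  obtain j where "j \<in> J" "dir_deriv (G j) v p \<noteq> 0" using imm v(1) by blast
  then have "(\<Sum>j\<in>J. (cmod (dir_deriv (G j) v p))\<^sup>2) > 0"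
    using fin by (intro sum_pos2[where i = j]) auto
  then have "margin v p > 0" using v(2) by (simp add: margin_def P_def)
  moreover have "open (V \<inter> margin v -` {0<..})"
    by (rule continuous_open_preimage[OF continuous_on_margin V]) simp
  ultimately obtain R where R: "R > 0" "ball p R \<subseteq> V \<inter> margin v -` {0<..}"
    using p open_contains_ball by blast
  show ?thesis
  proof (rule that[OF R(1), of v], use R in blast)
    fix x \<zeta> assume x: "\<zeta> \<noteq> 0" "x \<in> ball p R" "x + \<zeta> *s v \<in> ball p R" "slope (\<zeta> *s v) x \<ge> 0"
    have B: "x + of_real t *s (\<zeta> *s v) \<in> ball p R" if "t \<in> {0..1}" for t
    proof -
      have "x + of_real t *s (\<zeta> *s v) = (1 - t) *\<^sub>R x + t *\<^sub>R (x + \<zeta> *s v)"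
        by (simp add: vec_eq_iff algebra_simps scaleR_conv_of_real[where 'a = complex])
      also have "\<dots> \<in> ball p R"
        using convexD[OF convex_ball x(2,3), of "1 - t" t] that by simp
      finally show ?thesis .
    qed
    have M: "x + of_real t *s (\<zeta> *s v) \<in> V" "margin v (x + of_real t *s (\<zeta> *s v)) > 0"
      if "t \<in> {0..1}" for t
      using subsetD[OF R(2) B[OF that]] by simp_all
    show "\<forall>t\<in>{0<..1}. f (x + of_real t *s (\<zeta> *s v)) > f x"
    proof
      fix t :: real assume "t \<in> {0<..1}"
      then show "f (x + of_real t *s (\<zeta> *s v)) > f x"
        using x(4) by (intro increasing_along_line curv_pos M x(1)) auto
    qed
  qed
qed

lemma path_component_segment:
  fixes a u :: "complex ^ 'm"
  assumes "\<And>t. t \<in> {0..1} \<Longrightarrow> a + of_real t *s u \<in> S"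
  shows "path_component S a (a + u)"
proof -
  let ?S = "(\<lambda>t. a + complex_of_real t *s u) ` {0..1}"
  have "path_connected ?S"
    by (intro path_connected_continuous_image continuous_intros) (simp add: convex_imp_path_connected)
  moreover have "a \<in> ?S" "a + u \<in> ?S"
    by (force intro: image_eqI[of _ _ 0] image_eqI[of _ _ 1])+
  ultimately have "path_component ?S a (a + u)" unfolding path_connected_component by blast
  then show ?thesis by (rule path_component_of_subset[rotated]) (use assms in auto)
qed

text \<open>
Every \<open>x\<close> near \<open>p\<close> can climb to \<open>x + \<zeta> *s v\<close> for some \<open>\<zeta>\<close> in a path connected set \<open>\<Gamma>\<close>, and on all of \<open>x + \<Gamma> v\<close>
the value of \<open>f\<close> exceeds \<open>f p + \<epsilon>\<close>. So two points of \<open>B\<close> are joined by climbing from each of them,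
moving along \<open>\<Gamma>\<close>, and translating the base point. That one \<open>B\<close> serves all levels up to \<open>f p + \<epsilon>\<close>, and not only
the level of \<open>p\<close>, allows one to cross a whole band of levels in \<open>push_across_level\<close>.
\<close>

lemma superlevel_locally_connected:
  assumes p: "p \<in> V" and n: "CARD('n) \<ge> 2"
    and imm: "\<And>v. v \<noteq> 0 \<Longrightarrow> \<exists>j\<in>J. dir_deriv (G j) v p \<noteq> 0"
  obtains B \<epsilon> where "open B" "p \<in> B" "B \<subseteq> V" "\<epsilon> > 0"
    "\<forall>a x y. a \<le> f p + \<epsilon> \<and> x \<in> B \<and> y \<in> B \<and> f x > a \<and> f y > a \<longrightarrow>
       path_component {z \<in> V. f z > a} x y"
    "\<exists>x\<in>V. f x > f p"
proof -
  obtain v R where R: "R > 0" "ball p R \<subseteq> V" and up: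
    "\<And>x \<zeta>. \<lbrakk>\<zeta> \<noteq> 0; x \<in> ball p R; x + \<zeta> *s v \<in> ball p R; slope (\<zeta> *s v) x \<ge> 0\<rbrakk>
       \<Longrightarrow> \<forall>t\<in>{0<..1}. f (x + of_real t *s (\<zeta> *s v)) > f x"
    using ascending_disc[OF p n imm] by metis
  \<comment> \<open>Keeps \<open>x + \<zeta> *s v\<close> within \<open>R / 2\<close> of \<open>p\<close> for \<open>x\<close> within \<open>R / 4\<close> and \<open>\<bar>\<zeta>\<bar> \<le> r\<close>.\<close>
  define r where "r = R / 4 / (norm v + 1)"
  have r: "r > 0" "r * norm v < R / 4"
  proof -
    have nv: "norm v + 1 > 0" by (simp add: add_nonneg_pos)
    then show "r > 0" using R by (simp add: r_def)
    then have "r * norm v < r * (norm v + 1)" by simp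
    also have "\<dots> = R / 4" using nv by (simp add: r_def del: divide_divide_eq_left)
    finally show "r * norm v < R / 4" .
  qed
  have near: "x + \<zeta> *s v \<in> ball p (R / 2)" if "x \<in> ball p (R / 4)" "cmod \<zeta> \<le> r" for x \<zeta>
  proof -
    have "norm (\<zeta> *s v) \<le> r * norm v"
      using that by (simp add: norm_complex_scalar_mult mult_right_mono)
    moreover have "dist p (x + \<zeta> *s v) \<le> dist p x + norm (\<zeta> *s v)"
      by (metis dist_norm add_diff_cancel_left' dist_commute dist_triangle)
    ultimately show ?thesis using that r by auto
  qed
  have slope_at_p: "slope (of_real c *s u) p = c * slope u p" for c u
    by (rule slope_scale[OF p])
  \<comment> \<open>If \<open>f\<close> is critical at \<open>p\<close> along the complex line of \<open>v\<close>, take the circle; one of \<open>r\<close> and \<open>- r\<close> is a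
    direction of ascent at any given \<open>x\<close>. Otherwise one direction of ascent at \<open>p\<close> serves all nearby points.\<close>
  obtain \<Gamma> \<delta>0 where \<Gamma>: "compact \<Gamma>" "path_connected \<Gamma>" "\<Gamma> \<noteq> {}" "\<And>\<zeta>. \<zeta> \<in> \<Gamma> \<Longrightarrow> cmod \<zeta> = r"
    and slope_p: "\<And>\<zeta>. \<zeta> \<in> \<Gamma> \<Longrightarrow> slope (\<zeta> *s v) p \<ge> 0"
    and \<delta>0: "\<delta>0 > 0" "\<And>x. x \<in> ball p \<delta>0 \<Longrightarrow> x \<in> V \<Longrightarrow> \<exists>\<zeta>\<in>\<Gamma>. slope (\<zeta> *s v) x \<ge> 0"
  proof (cases "\<forall>\<zeta>. slope (\<zeta> *s v) p = 0")
    case True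
    show ?thesis
    proof (rule that[of "sphere 0 r" 1])
      show "path_connected (sphere (0::complex) r)" by (intro path_connected_sphere) simp
      show "\<exists>\<zeta>\<in>sphere 0 r. slope (\<zeta> *s v) x \<ge> 0" if "x \<in> V" for x
      proof (cases "slope (of_real r *s v) x \<ge> 0")
        case False
        have "slope (of_real (- 1) *s (of_real r *s v)) x = - 1 * slope (of_real r *s v) x"
          by (rule slope_scale[OF that])
        then have "slope (of_real (- r) *s v) x \<ge> 0"
          using False by (simp add: vector_smult_assoc)
        then show ?thesis using r by (intro bexI[of _ "of_real (- r)"]) auto
      qed (use r in \<open>intro bexI[of _ "of_real r"], auto\<close>)
    qed (use True r in auto)
  next
    case False
    then obtain \<zeta>1 where \<zeta>1: "slope (\<zeta>1 *s v) p \<noteq> 0" by blast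
    then have "\<zeta>1 \<noteq> 0" using slope_at_p[of 0] by auto
    define \<zeta>0 where "\<zeta>0 = of_real (sgn (slope (\<zeta>1 *s v) p) * r / cmod \<zeta>1) * \<zeta>1"
    have "slope (\<zeta>0 *s v) p = sgn (slope (\<zeta>1 *s v) p) * r / cmod \<zeta>1 * slope (\<zeta>1 *s v) p"
      unfolding \<zeta>0_def vector_smult_assoc[symmetric] by (rule slope_at_p)
    also have "\<dots> = r / cmod \<zeta>1 * \<bar>slope (\<zeta>1 *s v) p\<bar>" by (simp add: sgn_if)
    also have "\<dots> > 0" using \<zeta>1 r \<open>\<zeta>1 \<noteq> 0\<close> by simp
    finally have pos: "slope (\<zeta>0 *s v) p > 0" .
    have "open (V \<inter> slope (\<zeta>0 *s v) -` {0<..})"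
      by (rule continuous_open_preimage[OF continuous_on_slope V]) simp
    then obtain \<delta>0 where \<delta>0: "\<delta>0 > 0" "ball p \<delta>0 \<subseteq> V \<inter> slope (\<zeta>0 *s v) -` {0<..}"
      using p pos open_contains_ball by blast
    have "cmod \<zeta>0 = r"
      using \<zeta>1 r \<open>\<zeta>1 \<noteq> 0\<close> by (simp add: \<zeta>0_def norm_mult norm_divide abs_sgn_eq abs_mult)
    then show ?thesis
      using pos \<delta>0 by (intro that[of "{\<zeta>0}" \<delta>0]) force+
  qed
  have nz: "\<zeta> \<noteq> 0" if "\<zeta> \<in> \<Gamma>" for \<zeta> using \<Gamma>(4)[OF that] r by auto
  have pR: "p \<in> ball p (R / 4)" "ball p (R / 2) \<subseteq> ball p R" using R by auto
  have high: "f (p + \<zeta> *s v) > f p" if "\<zeta> \<in> \<Gamma>" for \<zeta>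
    using up[OF nz[OF that] _ _ slope_p[OF that]] near[OF pR(1)] \<Gamma>(4)[OF that] pR R
    by (force dest: bspec[where x = 1])
  have "continuous_on \<Gamma> (\<lambda>\<zeta>. f (p + \<zeta> *s v))"
    by (intro continuous_on_compose2[OF continuous_on_f] continuous_intros)
      (use near[OF pR(1)] \<Gamma>(4) pR R in force)
  then obtain \<zeta>m where \<zeta>m: "\<zeta>m \<in> \<Gamma>" "\<And>\<zeta>. \<zeta> \<in> \<Gamma> \<Longrightarrow> f (p + \<zeta>m *s v) \<le> f (p + \<zeta> *s v)"
    using continuous_attains_inf[OF \<Gamma>(1,3)] by blast
  define \<epsilon> where "\<epsilon> = (f (p + \<zeta>m *s v) - f p) / 2"
  have \<epsilon>: "\<epsilon> > 0" using high[OF \<zeta>m(1)] by (simp add: \<epsilon>_def)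
  have "uniformly_continuous_on (cball p (R / 2)) f"
    using R by (intro compact_uniformly_continuous continuous_on_subset[OF continuous_on_f]) auto
  then obtain \<delta>1 where \<delta>1: "\<delta>1 > 0" "\<And>x y. \<lbrakk>x \<in> cball p (R / 2); y \<in> cball p (R / 2); dist y x < \<delta>1\<rbrakk>
      \<Longrightarrow> dist (f y) (f x) < \<epsilon>"
    unfolding uniformly_continuous_on_def using \<epsilon> by metis
  define B where "B = ball p (min (R / 4) (min \<delta>0 \<delta>1))"
  have BR: "B \<subseteq> ball p (R / 4)" "B \<subseteq> ball p R" and BV: "B \<subseteq> V" using R by (auto simp: B_def)
  have ring: "f (x + \<zeta> *s v) > f p + \<epsilon>" if "x \<in> B" "\<zeta> \<in> \<Gamma>" for x \<zeta>
  proof -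
    have "dist (f (x + \<zeta> *s v)) (f (p + \<zeta> *s v)) < \<epsilon>"
    proof (rule \<delta>1(2))
      show "p + \<zeta> *s v \<in> cball p (R / 2)" "x + \<zeta> *s v \<in> cball p (R / 2)"
        using near[of p \<zeta>] near[of x \<zeta>] that \<Gamma>(4)[OF that(2)] BR pR by force+
      show "dist (x + \<zeta> *s v) (p + \<zeta> *s v) < \<delta>1"
        using that by (simp add: B_def dist_commute)
    qed
    moreover have "f (p + \<zeta> *s v) \<ge> f p + 2 * \<epsilon>" using \<zeta>m(2)[OF that(2)] by (simp add: \<epsilon>_def field_simps)
    ultimately show ?thesis by (simp add: dist_real_def abs_if split: if_splits)
  qed
  have ringV: "x + \<zeta> *s v \<in> ball p R" "x + \<zeta> *s v \<in> V" if "x \<in> B" "\<zeta> \<in> \<Gamma>" for x \<zeta>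
  proof -
    show "x + \<zeta> *s v \<in> ball p R"
      using near[of x \<zeta>] that \<Gamma>(4)[OF that(2)] BR(1) pR(2) by blast
    then show "x + \<zeta> *s v \<in> V" using R(2) by blast
  qed
  show ?thesis
  proof (rule that[of B \<epsilon>])
    show "open B" "p \<in> B" "B \<subseteq> V" "\<epsilon> > 0"
      using R \<delta>0 \<delta>1 \<epsilon> BV by (simp_all add: B_def)
    obtain \<zeta> where "\<zeta> \<in> \<Gamma>" using \<Gamma> by blast
    then show "\<exists>x\<in>V. f x > f p" using ringV(2)[of p] high \<open>p \<in> B\<close> by blast
    show "\<forall>a x y. a \<le> f p + \<epsilon> \<and> x \<in> B \<and> y \<in> B \<and> f x > a \<and> f y > a \<longrightarrow>
       path_component {z \<in> V. f z > a} x y"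
    proof (intro allI impI, elim conjE)
      fix a x y assume a: "a \<le> f p + \<epsilon>" and x: "x \<in> B" "f x > a" and y: "y \<in> B" "f y > a"
      let ?T = "{z \<in> V. f z > a}"
      have ascend: "\<exists>\<zeta>\<in>\<Gamma>. path_component ?T x (x + \<zeta> *s v)" if x: "x \<in> B" "f x > a" for x
      proof -
        obtain \<zeta> where \<zeta>: "\<zeta> \<in> \<Gamma>" "slope (\<zeta> *s v) x \<ge> 0"
          using \<delta>0(2)[of x] x(1) subsetD[OF BV x(1)] by (auto simp: B_def)
        have "x + of_real t *s (\<zeta> *s v) \<in> ?T" if t: "t \<in> {0..1}" for t
        proof (cases "t = 0")
          case False
          have "cmod (of_real t * \<zeta>) \<le> r"
            using t \<Gamma>(4)[OF \<zeta>(1)] r by (simp add: norm_mult mult_left_le_one_le)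
          then have "x + (of_real t * \<zeta>) *s v \<in> ball p (R / 2)"
            using near[OF subsetD[OF BR(1) x(1)]] by blast
          then have "x + of_real t *s (\<zeta> *s v) \<in> V"
            using pR(2) R(2) by (auto simp: vector_smult_assoc)
          moreover have "f (x + of_real t *s (\<zeta> *s v)) > f x"
            using up[OF nz[OF \<zeta>(1)] subsetD[OF BR(2) x(1)] ringV(1)[OF x(1) \<zeta>(1)] \<zeta>(2)] t False by simp
          ultimately show ?thesis using x by auto
        qed (use x BV in auto)
        then show ?thesis using \<zeta>(1) path_component_segment by blast
      qed
      obtain \<zeta> where \<zeta>: "\<zeta> \<in> \<Gamma>" "path_component ?T x (x + \<zeta> *s v)" using ascend[OF x] by blast
      obtain \<zeta>' where \<zeta>': "\<zeta>' \<in> \<Gamma>" "path_component ?T y (y + \<zeta>' *s v)" using ascend[OF y] by blast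
      have "path_component ?T (x + \<zeta> *s v) (x + \<zeta>' *s v)"
      proof -
        let ?S = "(\<lambda>\<zeta>. x + \<zeta> *s v) ` \<Gamma>"
        have "path_connected ?S" by (intro path_connected_continuous_image continuous_intros \<Gamma>(2))
        then have "path_component ?S (x + \<zeta> *s v) (x + \<zeta>' *s v)"
          using \<zeta> \<zeta>' by (simp add: path_connected_component)
        moreover have "?S \<subseteq> ?T" using ringV(2)[OF x(1)] ring[OF x(1)] a by force
        ultimately show ?thesis by (rule path_component_of_subset[rotated])
      qed
      moreover have "path_component ?T (x + \<zeta>' *s v) (y + \<zeta>' *s v)"
      proof -
        let ?S = "(\<lambda>z. z + \<zeta>' *s v) ` B"
        have "path_connected ?S"
          by (intro path_connected_continuous_image continuous_intros)
            (simp add: B_def convex_imp_path_connected)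
        then have "path_component ?S (x + \<zeta>' *s v) (y + \<zeta>' *s v)"
          using x y by (simp add: path_connected_component)
        moreover have "?S \<subseteq> ?T" using ringV(2)[OF _ \<zeta>'(1)] ring[OF _ \<zeta>'(1)] a by force
        ultimately show ?thesis by (rule path_component_of_subset[rotated])
      qed
      ultimately show "path_component ?T x y"
        using \<zeta>(2) \<zeta>'(2) by (meson path_component_sym path_component_trans)
    qed
  qed
qed

end

section \<open>Pushing paths up the levels of a function\<close>

text \<open>
Cover \<open>Z\<close> by finitely many open \<open>U p\<close> inside closed \<open>C p \<subseteq> B p\<close>. The set \<open>N z\<close> lies in \<open>U p\<close> whenever \<open>z\<close> does,
lies in \<open>B p\<close> if \<open>z \<in> C p\<close>, and avoids \<open>C p\<close> otherwise. So if \<open>u \<in> U p\<close>, then every \<open>N v\<close> that meets \<open>N u\<close>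
meets \<open>C p\<close>, which forces \<open>v \<in> C p\<close> and \<open>N v \<subseteq> B p\<close>.
\<close>

lemma star_refinement:
  assumes reg: "regular_space T" and Z: "compactin T Z"
    and B: "\<And>p. p \<in> Z \<Longrightarrow> openin T (B p) \<and> p \<in> B p"
  obtains P N where "finite P" "P \<subseteq> Z" "\<And>z. z \<in> Z \<Longrightarrow> openin T (N z) \<and> z \<in> N z"
    "\<And>u. u \<in> Z \<Longrightarrow> \<exists>p\<in>P. \<forall>v\<in>Z. N u \<inter> N v \<noteq> {} \<longrightarrow> N v \<subseteq> B p"
proof -
  have "\<forall>p\<in>Z. \<exists>UC. openin T (fst UC) \<and> closedin T (snd UC) \<and> p \<in> fst UC \<and> fst UC \<subseteq> snd UC \<and> snd UC \<subseteq> B p"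
  proof
    fix p assume "p \<in> Z"
    then obtain U C where "openin T U" "closedin T C" "p \<in> U" "U \<subseteq> C" "C \<subseteq> B p"
      using reg B[of p] unfolding neighbourhood_base_of_closedin[symmetric] neighbourhood_base_of
      by metis
    then show "\<exists>UC. openin T (fst UC) \<and> closedin T (snd UC) \<and> p \<in> fst UC \<and> fst UC \<subseteq> snd UC \<and> snd UC \<subseteq> B p"
      by (intro exI[of _ "(U, C)"]) simp
  qed
  from bchoice[OF this] obtain UC where UC: "\<forall>p\<in>Z. openin T (fst (UC p)) \<and> closedin T (snd (UC p)) \<and>
      p \<in> fst (UC p) \<and> fst (UC p) \<subseteq> snd (UC p) \<and> snd (UC p) \<subseteq> B p"
    by blast
  define U C where "U p = fst (UC p)" and "C p = snd (UC p)" for p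
  have U: "openin T (U p)" "p \<in> U p" "U p \<subseteq> C p" "C p \<subseteq> B p" "closedin T (C p)" if "p \<in> Z" for p
    using UC that by (auto simp: U_def C_def)
  obtain \<F> where "finite \<F>" "\<F> \<subseteq> U ` Z" "Z \<subseteq> \<Union>\<F>"
    using compactinD[OF Z, of "U ` Z"] U by blast
  then obtain P where P: "finite P" "P \<subseteq> Z" "Z \<subseteq> \<Union>(U ` P)"
    by (metis finite_subset_image)
  define N where "N z = (\<Inter>p\<in>P. (if z \<in> U p then U p else topspace T) \<inter>
      (if z \<in> C p then B p else topspace T - C p)) \<inter> topspace T" for z
  have "openin T (N z) \<and> z \<in> N z" if z: "z \<in> Z" for z
  proof
    show "openin T (N z)" unfolding N_def
    proof (intro openin_INT P(1))
      fix p assume "p \<in> P"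
      then show "openin T ((if z \<in> U p then U p else topspace T) \<inter> (if z \<in> C p then B p else topspace T - C p))"
        using P(2) U(1,5)[of p] B[of p] by (intro openin_Int) (auto intro: openin_diff)
    qed
    have "z \<in> topspace T" using z Z compactin_subset_topspace by blast
    then show "z \<in> N z" using P(2) U by (fastforce simp: N_def)
  qed
  moreover have "\<exists>p\<in>P. \<forall>v\<in>Z. N u \<inter> N v \<noteq> {} \<longrightarrow> N v \<subseteq> B p" if u: "u \<in> Z" for u
  proof -
    obtain p where p: "p \<in> P" "u \<in> U p" using P(3) u by blast
    have "N v \<subseteq> B p" if v: "w \<in> N u" "w \<in> N v" for v w
    proof -
      have "w \<in> U p" using v(1) p by (auto simp: N_def split: if_splits)
      then have "w \<in> C p" using U(3)[of p] p P(2) by blast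
      then have "v \<in> C p" using v(2) p by (auto simp: N_def split: if_splits)
      then show ?thesis using p(1) by (auto simp: N_def split: if_splits)
    qed
    then show ?thesis using p(1) by blast
  qed
  ultimately show ?thesis using P(1,2) by (intro that)
qed

text \<open>
The part of simple connectedness that makes paths with common ends homotopic.
\<close>

definition path_simple :: "'a::topological_space set \<Rightarrow> bool" where
  "path_simple N \<longleftrightarrow> (\<forall>g h. path g \<and> path h \<and> path_image g \<subseteq> N \<and> path_image h \<subseteq> N \<and>
     pathstart g = pathstart h \<and> pathfinish g = pathfinish h \<longrightarrow> homotopic_paths N g h)"

text \<open>
What pushing paths across the level of \<open>p\<close> requires of \<open>F\<close> near \<open>p\<close>: no local maximum, and connected superlevel
sets for all levels up to slightly above \<open>F p\<close>. The connecting paths may leave \<open>B\<close>, but stay in a set in which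
they are determined up to homotopy by their ends.
\<close>

definition ascending_at :: "'a::topological_space set \<Rightarrow> ('a \<Rightarrow> real) \<Rightarrow> 'a \<Rightarrow> bool" where
  "ascending_at X F p \<longleftrightarrow> (\<forall>N. openin (top_of_set X) N \<and> p \<in> N \<longrightarrow>
     (\<exists>x\<in>N. F x > F p) \<and>
     (\<exists>B N' \<epsilon>. openin (top_of_set X) B \<and> p \<in> B \<and> B \<subseteq> N' \<and> N' \<subseteq> N \<and> path_simple N' \<and> \<epsilon> > 0 \<and>
        (\<forall>a x y. a \<le> F p + \<epsilon> \<and> x \<in> B \<and> y \<in> B \<and> F x > a \<and> F y > a \<longrightarrow>
           path_component {z \<in> N'. F z > a} x y)))"

abbreviation (input) superlevel :: "'a set \<Rightarrow> ('a \<Rightarrow> real) \<Rightarrow> real \<Rightarrow> 'a set" where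
  "superlevel X F a \<equiv> {x \<in> X. F x > a}"

lemma path_const: "path (\<lambda>_. a)" "path_image (\<lambda>_. a) = {a}" "pathstart (\<lambda>_. a) = a" "pathfinish (\<lambda>_. a) = a"
  by (auto simp: path_def path_image_def pathstart_def pathfinish_def)

lemma interval_subdivision:
  fixes \<sigma> :: "real \<Rightarrow> 'a::topological_space"
  assumes \<sigma>: "path \<sigma>" "path_image \<sigma> \<subseteq> X" and cov: "path_image \<sigma> \<subseteq> \<Union>\<C>"
    and op: "\<And>C. C \<in> \<C> \<Longrightarrow> openin (top_of_set X) C"
  obtains n :: nat where "n > 0" "\<And>i. i < n \<Longrightarrow> \<exists>C\<in>\<C>. \<sigma> ` {real i / n..real (Suc i) / n} \<subseteq> C"
proof -
  have cont: "continuous_on {0..1} \<sigma>" using \<sigma> by (simp add: path_def)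
  have "\<exists>T. open T \<and> {0..1} \<inter> \<sigma> -` C = {0..1} \<inter> T" if C: "C \<in> \<C>" for C
  proof -
    obtain S where S: "open S" "C = X \<inter> S" using op[OF C] by (auto simp: openin_open)
    have "{0..1} \<inter> \<sigma> -` C = {0..1} \<inter> \<sigma> -` S" using S \<sigma>(2) by (auto simp: path_image_def)
    moreover have "openin (top_of_set {0..1}) ({0..1} \<inter> \<sigma> -` S)"
      by (rule continuous_openin_preimage_gen[OF cont S(1)])
    ultimately show ?thesis by (auto simp: openin_open)
  qed
  then obtain T where T: "\<And>C. C \<in> \<C> \<Longrightarrow> open (T C) \<and> {0..1} \<inter> \<sigma> -` C = {0..1} \<inter> T C" by metis
  have "{0..1} \<subseteq> \<Union>(T ` \<C>)"
  proof
    fix t :: real assume t: "t \<in> {0..1}"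
    then have "\<sigma> t \<in> path_image \<sigma>" by (simp add: path_image_def)
    then obtain C where "C \<in> \<C>" "\<sigma> t \<in> C" using cov by blast
    then show "t \<in> \<Union>(T ` \<C>)" using T[of C] t by blast
  qed
  moreover from this have "T ` \<C> \<noteq> {}" by auto
  ultimately obtain \<delta> where \<delta>: "\<delta> > 0" "\<And>S. S \<subseteq> {0..1} \<Longrightarrow> diameter S < \<delta> \<Longrightarrow> \<exists>C\<in>T ` \<C>. S \<subseteq> C"
    by (rule_tac Lebesgue_number_lemma[of "{0..1::real}" "T ` \<C>"]) (use T in auto)
  obtain n :: nat where n: "n > 0" "1 / n < \<delta>"
    using \<delta>(1) by (metis nat_approx_posE of_nat_0_less_iff zero_less_Suc)
  show ?thesis
  proof (rule that[OF n(1)])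
    fix i assume i: "i < n"
    let ?S = "{real i / n..real (Suc i) / n}"
    have S: "?S \<subseteq> {0..1}" using i n by (auto simp: field_simps)
    have "real i / n \<le> real (Suc i) / n" by (simp add: divide_right_mono)
    then have "diameter ?S = real (Suc i) / n - real i / n"
      using diameter_cbox[of "real i / n" "real (Suc i) / n"] by (simp add: dist_real_def)
    also have "\<dots> < \<delta>" using n by (simp add: add_divide_distrib)
    finally obtain C where C: "C \<in> \<C>" "?S \<subseteq> T C" using \<delta>(2)[OF S] by blast
    then have "\<sigma> ` ?S \<subseteq> C" using T[OF C(1)] S by blast
    then show "\<exists>C\<in>\<C>. \<sigma> ` ?S \<subseteq> C" using C(1) by blast
  qed
qed

lemma homotopic_paths_join_const_left:
  "path p \<Longrightarrow> path_image p \<subseteq> X \<Longrightarrow> homotopic_paths X ((\<lambda>_. pathstart p) +++ p) p"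
  by (rule homotopic_paths_const_left) simp_all

lemma homotopic_paths_join_const_right:
  "path p \<Longrightarrow> path_image p \<subseteq> X \<Longrightarrow> homotopic_paths X (p +++ (\<lambda>_. pathfinish p)) p"
  by (rule homotopic_paths_const_right) simp_all

definition path_between :: "real \<Rightarrow> real \<Rightarrow> (real \<Rightarrow> 'a) \<Rightarrow> real \<Rightarrow> 'a" where
  "path_between u v \<sigma> = (\<lambda>t. \<sigma> (u + (v - u) * t))"

lemma path_between_endpoints [simp]:
  "pathstart (path_between u v \<sigma>) = \<sigma> u" "pathfinish (path_between u v \<sigma>) = \<sigma> v"
  by (simp_all add: path_between_def pathstart_def pathfinish_def)

lemma path_between_range:
  assumes "u \<le> v" "t \<in> {0..1::real}"
  shows "u + (v - u) * t \<in> {u..v}"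
proof -
  have "(v - u) * t \<le> (v - u) * 1" using assms by (intro mult_left_mono) auto
  then show ?thesis using assms by auto
qed

lemma path_image_path_between: "u \<le> v \<Longrightarrow> path_image (path_between u v \<sigma>) \<subseteq> \<sigma> ` {u..v}"
  using path_between_range by (force simp: path_image_def path_between_def)

lemma path_path_between:
  assumes "continuous_on {u..v} \<sigma>" "u \<le> v"
  shows "path (path_between u v \<sigma>)"
  unfolding path_def path_between_def
  by (rule continuous_on_compose2[OF assms(1)])
    (use path_between_range[OF assms(2)] in \<open>auto intro!: continuous_intros\<close>)

lemma homotopic_path_between_join:
  assumes \<sigma>: "continuous_on {u..w} \<sigma>" "\<sigma> ` {u..w} \<subseteq> X" and uvw: "u \<le> v" "v \<le> w"
  shows "homotopic_paths X (path_between u v \<sigma> +++ path_between v w \<sigma>) (path_between u w \<sigma>)"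
proof (cases "u = w")
  case True
  then have "path_between u v \<sigma> +++ path_between v w \<sigma> = path_between u w \<sigma>"
    using uvw by (auto simp: path_between_def joinpaths_def)
  moreover have "path (path_between u w \<sigma>)" "path_image (path_between u w \<sigma>) \<subseteq> X"
    using path_path_between[OF \<sigma>(1)] path_image_path_between[of u w \<sigma>] \<sigma>(2) uvw by auto
  ultimately show ?thesis by simp
next
  case False
  then have d: "w - u > 0" using uvw by simp
  let ?f = "\<lambda>t. ((v - u) * min (2 * t) 1 + (w - v) * max (2 * t - 1) 0) / (w - u)"
  have "homotopic_paths X (path_between u w \<sigma>) (path_between u v \<sigma> +++ path_between v w \<sigma>)"
  proof (rule homotopic_paths_reparametrize[where f = ?f])
    show "path (path_between u w \<sigma>)" "path_image (path_between u w \<sigma>) \<subseteq> X"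
      using path_path_between[OF \<sigma>(1)] path_image_path_between[of u w \<sigma>] \<sigma>(2) uvw by auto
    show "continuous_on {0..1} ?f" using d by (intro continuous_intros) auto
    show "?f \<in> {0..1} \<rightarrow> {0..1}"
    proof
      fix t :: real assume t: "t \<in> {0..1}"
      have "0 \<le> (v - u) * min (2 * t) 1" "0 \<le> (w - v) * max (2 * t - 1) 0"
        using uvw t by auto
      moreover have "(v - u) * min (2 * t) 1 \<le> (v - u) * 1" "(w - v) * max (2 * t - 1) 0 \<le> (w - v) * 1"
        using uvw t by (intro mult_left_mono; auto)+
      ultimately show "?f t \<in> {0..1}" using d by (simp add: field_simps)
    qed
    show "?f 0 = 0" "?f 1 = 1" using d by simp_all
    show "(path_between u v \<sigma> +++ path_between v w \<sigma>) t = path_between u w \<sigma> (?f t)" for t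
    proof -
      have "(w - u) * ?f t = (v - u) * min (2 * t) 1 + (w - v) * max (2 * t - 1) 0"
        using d by simp
      then have "path_between u w \<sigma> (?f t) = \<sigma> (u + ((v - u) * min (2 * t) 1 + (w - v) * max (2 * t - 1) 0))"
        by (simp only: path_between_def)
      then show ?thesis by (simp add: path_between_def joinpaths_def min_def max_def)
    qed
  qed
  then show ?thesis by (rule homotopic_paths_sym)
qed

text \<open>
The path \<open>\<kappa> x\<close> leads from \<open>V\<close> to the point \<open>x\<close> of \<open>\<sigma>\<close>. If each piece of \<open>\<sigma>\<close> can be moved into \<open>V\<close> after it
has been extended by these paths at both ends, then so can \<open>\<sigma>\<close>, because at every cutting point the two
extensions cancel. At the ends of \<open>\<sigma>\<close> the extensions are constant.
\<close>

lemma homotopic_subdivision: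
  fixes \<sigma> :: "real \<Rightarrow> 'a::topological_space"
  assumes \<sigma>: "path \<sigma>" "path_image \<sigma> \<subseteq> W" and n: "n > (0::nat)" and "V \<subseteq> W"
    and \<kappa>: "\<And>x. x \<in> path_image \<sigma> \<Longrightarrow> path (\<kappa> x) \<and> path_image (\<kappa> x) \<subseteq> W \<and> pathstart (\<kappa> x) \<in> V \<and> pathfinish (\<kappa> x) = x"
    and ends: "\<kappa> (pathstart \<sigma>) = (\<lambda>_. pathstart \<sigma>)" "\<kappa> (pathfinish \<sigma>) = (\<lambda>_. pathfinish \<sigma>)"
    and piece: "\<And>i. i < n \<Longrightarrow> \<exists>l. path l \<and> path_image l \<subseteq> V \<and>
      homotopic_paths W (\<kappa> (\<sigma> (real i / n)) +++ path_between (real i / n) (real (Suc i) / n) \<sigma>)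
                        (l +++ \<kappa> (\<sigma> (real (Suc i) / n)))
      \<and> pathstart l = pathstart (\<kappa> (\<sigma> (real i / n))) \<and> pathfinish l = pathstart (\<kappa> (\<sigma> (real (Suc i) / n)))"
  obtains \<tau> where "path \<tau>" "path_image \<tau> \<subseteq> V" "homotopic_paths W \<sigma> \<tau>"
proof -
  note [trans] = homotopic_paths_trans
  let ?k = "\<lambda>i. \<kappa> (\<sigma> (real i / n))" and ?s = "\<lambda>i. path_between 0 (real i / n) \<sigma>"
  have mem: "real i / n \<in> {0..1}" if "i \<le> n" for i using that n by auto
  have k: "path (?k i)" "path_image (?k i) \<subseteq> W" "pathstart (?k i) \<in> V" "pathfinish (?k i) = \<sigma> (real i / n)"
    if "i \<le> n" for i
    using \<kappa>[of "\<sigma> (real i / n)"] mem[OF that] by (auto simp: path_image_def)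
  have cont: "continuous_on {0..1} \<sigma>" using \<sigma>(1) by (simp add: path_def)
  have start: "pathstart \<sigma> \<in> V" using \<kappa>[of "pathstart \<sigma>"] ends(1) by (auto simp: path_const)
  have "\<exists>\<tau>. path \<tau> \<and> path_image \<tau> \<subseteq> V \<and> pathstart \<tau> = pathstart \<sigma> \<and> pathfinish \<tau> = pathstart (?k i) \<and>
     homotopic_paths W (\<tau> +++ ?k i) (?s i)" if "i \<le> n" for i
    using that
  proof (induction i)
    case 0
    let ?c = "\<lambda>_::real. pathstart \<sigma>"
    have k0: "?k 0 = ?c" using ends(1) by (simp add: pathstart_def)
    have s0: "?s 0 = ?c" by (simp add: path_between_def pathstart_def)
    have "homotopic_paths W ((\<lambda>_. pathstart ?c) +++ ?c) ?c"
      by (rule homotopic_paths_join_const_left) (use start \<open>V \<subseteq> W\<close> in \<open>auto simp: path_const\<close>)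
    then have "homotopic_paths W (?c +++ ?k 0) (?s 0)"
      by (simp only: k0 s0 path_const)
    then show ?case
      using start arg_cong[OF k0, of pathstart] by (intro exI[of _ ?c]) (simp add: path_const)
  next
    case (Suc i)
    then obtain \<tau> where \<tau>: "path \<tau>" "path_image \<tau> \<subseteq> V" "pathstart \<tau> = pathstart \<sigma>" "pathfinish \<tau> = pathstart (?k i)"
      "homotopic_paths W (\<tau> +++ ?k i) (?s i)" by auto
    let ?r = "path_between (real i / n) (real (Suc i) / n) \<sigma>"
    obtain l where l: "path l" "path_image l \<subseteq> V"
      "homotopic_paths W (?k i +++ ?r) (l +++ ?k (Suc i))"
      "pathstart l = pathstart (?k i)" "pathfinish l = pathstart (?k (Suc i))"
      using piece[of i] Suc.prems by auto
    have le: "real i / n \<le> real (Suc i) / n" by (simp add: divide_right_mono)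
    have i: "i \<le> n" "Suc i \<le> n" using Suc.prems by auto
    have I: "{real i / n..real (Suc i) / n} \<subseteq> {0..1}" using mem[OF i(1)] mem[OF i(2)] by auto
    have r: "path ?r" "pathstart ?r = \<sigma> (real i / n)" "pathfinish ?r = \<sigma> (real (Suc i) / n)"
      using path_path_between[OF continuous_on_subset[OF cont I] le] by simp_all
    have "\<sigma> ` {real i / n..real (Suc i) / n} \<subseteq> W" using \<sigma>(2) unfolding path_image_def by (intro order_trans[OF image_mono[OF I]])
    then have rW: "path_image ?r \<subseteq> W" using path_image_path_between[OF le, of \<sigma>] by (rule order_trans[rotated])
    have sub: "path_image \<tau> \<subseteq> W" "path_image l \<subseteq> W" using \<tau>(2) l(2) \<open>V \<subseteq> W\<close> by auto
    have "homotopic_paths W ((\<tau> +++ l) +++ ?k (Suc i)) (\<tau> +++ (l +++ ?k (Suc i)))"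
      by (rule homotopic_paths_sym, rule homotopic_paths_assoc) (use \<tau> l k[OF i(2)] sub in auto)
    also have "homotopic_paths W \<dots> (\<tau> +++ (?k i +++ ?r))"
      by (rule homotopic_paths_join[OF _ homotopic_paths_sym[OF l(3)]]) (use \<tau> l sub in auto)
    also have "homotopic_paths W \<dots> ((\<tau> +++ ?k i) +++ ?r)"
      by (rule homotopic_paths_assoc) (use \<tau> k[OF i(1)] r rW sub in auto)
    also have "homotopic_paths W \<dots> (?s i +++ ?r)"
      by (rule homotopic_paths_join[OF \<tau>(5)]) (use k[OF i(1)] r rW in auto)
    also have "homotopic_paths W \<dots> (?s (Suc i))"
      by (rule homotopic_path_between_join)
        (use \<sigma>(2) mem[OF i(1)] mem[OF i(2)] le in
          \<open>auto intro: continuous_on_subset[OF cont] simp: path_image_def\<close>)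
    finally have "homotopic_paths W ((\<tau> +++ l) +++ ?k (Suc i)) (?s (Suc i))" .
    moreover have "path (\<tau> +++ l)" "path_image (\<tau> +++ l) \<subseteq> V" "pathstart (\<tau> +++ l) = pathstart \<sigma>"
      "pathfinish (\<tau> +++ l) = pathstart (?k (Suc i))"
      using \<tau> l by (auto simp: path_image_join)
    ultimately show ?case by blast
  qed
  from this[of n] obtain \<tau> where \<tau>: "path \<tau>" "path_image \<tau> \<subseteq> V" "pathfinish \<tau> = pathstart (?k n)"
     "homotopic_paths W (\<tau> +++ ?k n) (?s n)" by auto
  have kn: "?k n = (\<lambda>_. pathfinish \<sigma>)" using ends(2) n by (simp add: pathfinish_def)
  have sn: "?s n = \<sigma>" using n by (simp add: path_between_def)
  have "homotopic_paths W (\<tau> +++ (\<lambda>_. pathfinish \<tau>)) \<tau>"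
    by (rule homotopic_paths_join_const_right) (use \<tau> \<open>V \<subseteq> W\<close> in auto)
  then have "homotopic_paths W \<sigma> \<tau>"
    using \<tau>(3,4) unfolding kn sn path_const by (metis homotopic_paths_sym homotopic_paths_trans)
  then show ?thesis using \<tau> that by blast
qed

lemma openin_superlevel:
  assumes "continuous_on X F"
  shows "openin (top_of_set X) (superlevel X F a)"
proof -
  have "superlevel X F a = X \<inter> F -` {a<..}" by auto
  then show ?thesis using continuous_openin_preimage_gen[OF assms, of "{a<..}"] by simp
qed

lemma finite_positive_lower_bound:
  fixes g :: "'b \<Rightarrow> real"
  assumes "finite A" "\<And>a. a \<in> A \<Longrightarrow> g a > 0"
  obtains \<epsilon> where "\<epsilon> > 0" "\<And>a. a \<in> A \<Longrightarrow> \<epsilon> \<le> g a"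
  by (rule that[of "Min (insert 1 (g ` A))"]) (use assms in auto)

text \<open>
Cover the compact level set \<open>Z\<close> by sets \<open>B p\<close> from \<open>ascending_at\<close> and take a star refinement by path
connected sets \<open>Q z\<close>, each with a point \<open>y z\<close> above the level. By compactness finitely many \<open>Q z\<close> cover a
band of levels around \<open>s\<close>. Cut \<open>\<sigma>\<close> so finely that each piece lies in some \<open>Q u\<close> or above the band, and join
each cutting point in the band to some \<open>y z\<close> within \<open>Q z\<close>. All of this takes place in the star of \<open>Q u\<close>,
which lies in one \<open>B p\<close>; there the ends can be joined above the band, and the set \<open>N p\<close> makes the new
piece homotopic to the old one. The ends of \<open>\<sigma>\<close> are compared with \<open>min (s + \<epsilon>) c'\<close> since only
the sublevel set of \<open>c'\<close> is known to be compact.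
\<close>

lemma push_across_level:
  fixes X :: "'a::topological_space set" and F :: "'a \<Rightarrow> real"
  assumes reg: "regular_space (top_of_set X)" and lpc: "locally path_connected X"
    and F: "continuous_on X F" and cpt: "compact {x \<in> X. F x \<le> c'}"
    and s: "c0 < s" "s \<le> c'" and asc: "\<And>p. p \<in> X \<Longrightarrow> F p = s \<Longrightarrow> ascending_at X F p"
  obtains \<epsilon> where "\<epsilon> > 0"
    "\<And>\<sigma>. \<lbrakk>path \<sigma>; path_image \<sigma> \<subseteq> superlevel X F (s - \<epsilon>);
        F (pathstart \<sigma>) > min (s + \<epsilon>) c'; F (pathfinish \<sigma>) > min (s + \<epsilon>) c'\<rbrakk> \<Longrightarrow>
      \<exists>\<tau>. path \<tau> \<and> path_image \<tau> \<subseteq> superlevel X F (min (s + \<epsilon>) c') \<and>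
          homotopic_paths (superlevel X F c0) \<sigma> \<tau>"
proof -
  let ?W = "superlevel X F c0"
  let ?T = "top_of_set X"
  define Z where "Z = {x \<in> X. F x = s}"
  have comp: "compactin ?T {x \<in> X. F x \<le> c'}"
    using cpt by (simp add: compactin_subtopology)
  have "closedin ?T Z" unfolding Z_def
    using continuous_closedin_preimage_constant[OF F, of s] by (simp add: vimage_def Int_def conj_commute)
  then have Z: "compactin ?T Z"
    using comp by (rule closed_compactin[rotated -1]) (use s in \<open>auto simp: Z_def\<close>)
  have ZX: "p \<in> X" "F p = s" if "p \<in> Z" for p using that by (auto simp: Z_def)
  define good where "good p B N e \<longleftrightarrow> openin ?T B \<and> p \<in> B \<and> B \<subseteq> N \<and> N \<subseteq> ?W \<and> path_simple N \<and> e > 0 \<and>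
        (\<forall>a x y. a \<le> F p + e \<and> x \<in> B \<and> y \<in> B \<and> F x > a \<and> F y > a \<longrightarrow>
           path_component {z \<in> N. F z > a} x y)" for p B N and e :: real
  have "\<forall>p\<in>Z. \<exists>B N e. good p B N e"
  proof
    fix p assume "p \<in> Z"
    then have "openin ?T ?W" "p \<in> ?W" "ascending_at X F p"
      using ZX s openin_superlevel[OF F] asc by auto
    then show "\<exists>B N e. good p B N e"
      unfolding ascending_at_def good_def by blast
  qed
  then obtain B N e where "\<forall>p\<in>Z. good p (B p) (N p) (e p)" by metis
  then have BN: "\<forall>p\<in>Z. openin ?T (B p) \<and> p \<in> B p \<and> B p \<subseteq> N p \<and> N p \<subseteq> ?W \<and>
      path_simple (N p) \<and> e p > 0 \<and>
        (\<forall>a x y. a \<le> F p + e p \<and> x \<in> B p \<and> y \<in> B p \<and> F x > a \<and> F y > a \<longrightarrow>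
           path_component {z \<in> N p. F z > a} x y)"
    unfolding good_def .
  obtain P S where P: "finite P" "P \<subseteq> Z" and S: "\<And>z. z \<in> Z \<Longrightarrow> openin ?T (S z) \<and> z \<in> S z"
    and star: "\<And>u. u \<in> Z \<Longrightarrow> \<exists>p\<in>P. \<forall>v\<in>Z. S u \<inter> S v \<noteq> {} \<longrightarrow> S v \<subseteq> B p"
    by (rule star_refinement[OF reg Z, of B]) (use BN in auto)
  define nice where "nice z O' y \<longleftrightarrow> openin ?T O' \<and> path_connected O' \<and> z \<in> O' \<and> O' \<subseteq> S z \<and> y \<in> O' \<and> F y > s"
    for z O' y
  have "\<forall>z\<in>Z. \<exists>O' y. nice z O' y"
  proof
    fix z assume z: "z \<in> Z"
    then obtain O' where O': "openin ?T O'" "path_connected O'" "z \<in> O'" "O' \<subseteq> S z"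
      using lpc[unfolded locally_path_connected, rule_format, of "S z" z] S[OF z] by blast
    moreover have "\<exists>y\<in>O'. F y > s"
      using asc[OF ZX[OF z]] O' ZX(2)[OF z] unfolding ascending_at_def by blast
    ultimately show "\<exists>O' y. nice z O' y" unfolding nice_def by blast
  qed
  then obtain Q y where "\<forall>z\<in>Z. nice z (Q z) (y z)" by metis
  then have Q: "openin ?T (Q z)" "path_connected (Q z)" "z \<in> Q z" "Q z \<subseteq> S z" "y z \<in> Q z" "F (y z) > s"
    if "z \<in> Z" for z
    using that unfolding nice_def by blast+
  obtain \<F> where "finite \<F>" "\<F> \<subseteq> Q ` Z" "Z \<subseteq> \<Union>\<F>"
    using compactinD[OF Z, of "Q ` Z"] Q(1,3) by blast
  then obtain Z0 where Z0: "finite Z0" "Z0 \<subseteq> Z" "Z \<subseteq> \<Union>(Q ` Z0)"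
    by (metis finite_subset_image)
  define R where "R = {x \<in> X. F x \<le> c'} - \<Union>(Q ` Z0)"
  have "openin ?T (\<Union>(Q ` Z0))" using Q(1) Z0(2) by (intro openin_Union) auto
  then have "closedin ?T (X - \<Union>(Q ` Z0))" by (simp add: closedin_def double_diff openin_imp_subset)
  then have "compactin ?T ({x \<in> X. F x \<le> c'} \<inter> (X - \<Union>(Q ` Z0)))"
    using comp by (simp add: compact_Int_closedin)
  moreover have "{x \<in> X. F x \<le> c'} \<inter> (X - \<Union>(Q ` Z0)) = R" by (auto simp: R_def)
  ultimately have R: "compact R" "R \<subseteq> X" by (simp_all add: compactin_subtopology)
  have Rs: "F x \<noteq> s" if "x \<in> R" for x using that Z0(3) by (auto simp: R_def Z_def)
  \<comment> \<open>Levels closer to \<open>s\<close> than \<open>m\<close> lie in the union of the sets \<open>Q z\<close>, apart from points above \<open>c'\<close>.\<close>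
  obtain m where m: "m > 0" "\<And>x. x \<in> R \<Longrightarrow> m \<le> \<bar>F x - s\<bar>"
  proof (cases "R = {}")
    case False
    have "continuous_on R (\<lambda>x. \<bar>F x - s\<bar>)"
      by (intro continuous_intros continuous_on_subset[OF F] R(2))
    then obtain x where "x \<in> R" "\<And>x'. x' \<in> R \<Longrightarrow> \<bar>F x - s\<bar> \<le> \<bar>F x' - s\<bar>"
      using continuous_attains_inf[OF R(1) False] by blast
    then show ?thesis using Rs[of x] by (intro that[of "\<bar>F x - s\<bar>"]) auto
  qed (use that[of 1] in auto)
  have eP: "e p > 0" if "p \<in> P" for p using BN P(2) that by blast
  obtain \<epsilon>1 where \<epsilon>1: "\<epsilon>1 > 0" "\<And>p. p \<in> P \<Longrightarrow> \<epsilon>1 \<le> e p"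
    using finite_positive_lower_bound[OF P(1), of e, OF eP] by blast
  have yS: "F (y z) - s > 0" if "z \<in> Z0" for z using Q(6) Z0(2) that by (simp add: subset_iff)
  obtain \<epsilon>2 where \<epsilon>2: "\<epsilon>2 > 0" "\<And>z. z \<in> Z0 \<Longrightarrow> \<epsilon>2 \<le> F (y z) - s"
    using finite_positive_lower_bound[OF Z0(1), of "\<lambda>z. F (y z) - s", OF yS] by blast
  define \<epsilon> where "\<epsilon> = min (min \<epsilon>1 \<epsilon>2) (min m (s - c0)) / 2"
  have \<epsilon>: "\<epsilon> > 0" "\<epsilon> < \<epsilon>1" "\<epsilon> < \<epsilon>2" "\<epsilon> < m" "\<epsilon> < s - c0"
    using \<epsilon>1(1) \<epsilon>2(1) m(1) s(1) by (auto simp: \<epsilon>_def min_def)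
  define b where "b = min (s + \<epsilon>) c'"
  have b: "b \<le> s + \<epsilon>" "b \<le> c'" "b > c0" using s \<epsilon> by (auto simp: b_def)
  have band: "x \<in> \<Union>(Q ` Z0)" if "x \<in> X" "F x > s - \<epsilon>" "F x \<le> b" for x
  proof (rule ccontr)
    assume "x \<notin> \<Union>(Q ` Z0)"
    then have "m \<le> \<bar>F x - s\<bar>" using m(2)[of x] that b by (auto simp: R_def)
    then show False using that b \<epsilon> by auto
  qed
  have yb: "F (y z) > b" if "z \<in> Z0" for z using \<epsilon>2(2)[OF that] \<epsilon> b by simp
  show ?thesis
  proof (rule that[OF \<epsilon>(1)], fold b_def)
    fix \<sigma> assume \<sigma>: "path \<sigma>" "path_image \<sigma> \<subseteq> superlevel X F (s - \<epsilon>)"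
      and ends: "F (pathstart \<sigma>) > b" "F (pathfinish \<sigma>) > b"
    let ?V = "superlevel X F b"
    have VW: "?V \<subseteq> ?W" using b by auto
    have \<sigma>W: "path_image \<sigma> \<subseteq> ?W" using \<sigma>(2) \<epsilon>(5) by force
    define \<kappa> where "\<kappa> x = (if F x > b then (\<lambda>_. x) else (SOME k. \<exists>z\<in>Z0. x \<in> Q z \<and> path k \<and> path_image k \<subseteq> Q z \<and>
        pathstart k = y z \<and> pathfinish k = x))" for x
    have \<kappa>1: "\<kappa> x = (\<lambda>_. x)" if "F x > b" for x using that by (simp add: \<kappa>_def)
    have \<kappa>2: "\<exists>z\<in>Z0. x \<in> Q z \<and> path (\<kappa> x) \<and> path_image (\<kappa> x) \<subseteq> Q z \<and> pathstart (\<kappa> x) = y z \<and> pathfinish (\<kappa> x) = x"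
      if x: "x \<in> path_image \<sigma>" "\<not> F x > b" for x
    proof -
      have "x \<in> \<Union>(Q ` Z0)" using x \<sigma>(2) by (intro band) auto
      then obtain z where z: "z \<in> Z0" "x \<in> Q z" by blast
      then have "path_connected (Q z)" "y z \<in> Q z" using Q(2,5) Z0(2) by blast+
      then obtain k where "path k" "path_image k \<subseteq> Q z" "pathstart k = y z" "pathfinish k = x"
        using z(2) unfolding path_connected_def by blast
      then have "\<exists>k. \<exists>z\<in>Z0. x \<in> Q z \<and> path k \<and> path_image k \<subseteq> Q z \<and> pathstart k = y z \<and> pathfinish k = x"
        using z by blast
      from someI_ex[OF this] show ?thesis using x(2) by (simp add: \<kappa>_def)
    qed
    have QW: "Q z \<subseteq> X" if "z \<in> Z" for z using openin_imp_subset[OF Q(1)[OF that]] .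
    have Bstar: "\<exists>p\<in>P. Q u \<subseteq> B p \<and> (\<forall>x\<in>path_image \<sigma> \<inter> Q u. path_image (\<kappa> x) \<subseteq> B p)" if u: "u \<in> Z" for u
    proof -
      obtain p where p: "p \<in> P" "\<And>v. v \<in> Z \<Longrightarrow> S u \<inter> S v \<noteq> {} \<Longrightarrow> S v \<subseteq> B p" using star[OF u] by blast
      have uu: "Q u \<subseteq> S u" "u \<in> S u" using Q(3,4)[OF u] by auto
      have Qu: "Q u \<subseteq> B p" using p(2)[OF u] uu by blast
      have "path_image (\<kappa> x) \<subseteq> B p" if x: "x \<in> path_image \<sigma>" "x \<in> Q u" for x
      proof (cases "F x > b")
        case True
        then show ?thesis using \<kappa>1[OF True] x(2) Qu by (auto simp: path_const)
      next
        case False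
        then obtain z where z: "z \<in> Z0" "x \<in> Q z" "path_image (\<kappa> x) \<subseteq> Q z" using \<kappa>2 x(1) by blast
        then have "Q z \<subseteq> S z" "z \<in> Z" using Q(4) Z0(2) by blast+
        then have "S z \<subseteq> B p" using p(2)[of z] z(2) x(2) uu by blast
        then show ?thesis using z(3) \<open>Q z \<subseteq> S z\<close> by blast
      qed
      then show ?thesis using p(1) Qu by blast
    qed
    have \<kappa>: "path (\<kappa> x) \<and> path_image (\<kappa> x) \<subseteq> ?W \<and> pathstart (\<kappa> x) \<in> ?V \<and> pathfinish (\<kappa> x) = x"
      if x: "x \<in> path_image \<sigma>" for x
    proof (cases "F x > b")
      case True
      then show ?thesis using x \<sigma>W unfolding \<kappa>1[OF True] path_const by (auto intro: path_const)
    next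
      case False
      then obtain z where z: "z \<in> Z0" "x \<in> Q z" "path (\<kappa> x)" "path_image (\<kappa> x) \<subseteq> Q z"
        "pathstart (\<kappa> x) = y z" "pathfinish (\<kappa> x) = x" using \<kappa>2 x by blast
      then have zZ: "z \<in> Z" using Z0(2) by blast
      obtain p where "p \<in> P" "Q z \<subseteq> B p" using Bstar[OF zZ] by blast
      then have "Q z \<subseteq> ?W" using BN P(2) by blast
      then show ?thesis using z yb[OF z(1)] Q(5)[OF zZ] QW[OF zZ] by auto
    qed
    obtain n :: nat where n: "n > 0" "\<And>i. i < n \<Longrightarrow> \<exists>C\<in>insert ?V (Q ` Z0). \<sigma> ` {real i / n..real (Suc i) / n} \<subseteq> C"
    proof (rule interval_subdivision[OF \<sigma>(1), of X "insert ?V (Q ` Z0)"])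
      show "path_image \<sigma> \<subseteq> X" using \<sigma>(2) by blast
      show "path_image \<sigma> \<subseteq> \<Union>(insert ?V (Q ` Z0))" using \<sigma>(2) band by force
      show "openin ?T C" if "C \<in> insert ?V (Q ` Z0)" for C
        using that Q(1) Z0(2) openin_superlevel[OF F] by auto
    qed blast
    obtain \<tau> where "path \<tau>" "path_image \<tau> \<subseteq> ?V" "homotopic_paths ?W \<sigma> \<tau>"
    proof (rule homotopic_subdivision[OF \<sigma>(1) \<sigma>W n(1) VW \<kappa>])
      show "\<kappa> (pathstart \<sigma>) = (\<lambda>_. pathstart \<sigma>)" "\<kappa> (pathfinish \<sigma>) = (\<lambda>_. pathfinish \<sigma>)"
        using ends by (simp_all add: \<kappa>1)
      fix i assume i: "i < n"
      let ?w = "\<sigma> (real i / n)" and ?w' = "\<sigma> (real (Suc i) / n)"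
      let ?r = "path_between (real i / n) (real (Suc i) / n) \<sigma>"
      have le: "real i / n \<le> real (Suc i) / n" by (simp add: divide_right_mono)
      have I: "{real i / n..real (Suc i) / n} \<subseteq> {0..1}" using i n by (auto simp: field_simps)
      have mem: "?w \<in> path_image \<sigma>" "?w' \<in> path_image \<sigma>"
        using I le by (auto simp: path_image_def)
      have r: "path ?r"
        using path_path_between[OF continuous_on_subset[OF _ I] le] \<sigma>(1) by (simp add: path_def)
      obtain C where C: "C \<in> insert ?V (Q ` Z0)" "\<sigma> ` {real i / n..real (Suc i) / n} \<subseteq> C"
        using n(2)[OF i] by blast
      have rC: "path_image ?r \<subseteq> C" using path_image_path_between[OF le, of \<sigma>] C(2) by blast
      have wC: "?w \<in> C" "?w' \<in> C" using C(2) le by auto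
      show "\<exists>l. path l \<and> path_image l \<subseteq> ?V \<and> homotopic_paths ?W (\<kappa> ?w +++ ?r) (l +++ \<kappa> ?w')
        \<and> pathstart l = pathstart (\<kappa> ?w) \<and> pathfinish l = pathstart (\<kappa> ?w')"
      proof (cases "C = ?V")
        case True
        then have kc: "\<kappa> ?w = (\<lambda>_. pathstart ?r)" "\<kappa> ?w' = (\<lambda>_. pathfinish ?r)"
          using wC by (simp_all add: \<kappa>1)
        have rW: "path_image ?r \<subseteq> ?W" using rC True VW by blast
        have "homotopic_paths ?W (\<kappa> ?w +++ ?r) (?r +++ \<kappa> ?w')"
          unfolding kc
          by (rule homotopic_paths_trans[OF homotopic_paths_join_const_left[OF r rW]
              homotopic_paths_sym[OF homotopic_paths_join_const_right[OF r rW]]])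
        then show ?thesis
          using r rC True arg_cong[OF kc(1), of pathstart] arg_cong[OF kc(2), of pathstart]
          by (intro exI[of _ ?r]) (simp add: path_const)
      next
        case False
        then obtain u where u: "u \<in> Z0" "C = Q u" using C(1) by auto
        then obtain p where p: "p \<in> P" "Q u \<subseteq> B p" "\<And>x. x \<in> path_image \<sigma> \<Longrightarrow> x \<in> Q u \<Longrightarrow> path_image (\<kappa> x) \<subseteq> B p"
          using Bstar[of u] Z0(2) by blast
        have pZ: "p \<in> Z" using p(1) P(2) by blast
        have kB: "path_image (\<kappa> ?w) \<subseteq> B p" "path_image (\<kappa> ?w') \<subseteq> B p"
          using p(3) mem wC u by auto
        have "pathstart (\<kappa> ?w) \<in> B p" "pathstart (\<kappa> ?w') \<in> B p"
          using kB pathstart_in_path_image by blast+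
        moreover have "F (pathstart (\<kappa> ?w)) > b" "F (pathstart (\<kappa> ?w')) > b"
          using \<kappa> mem by auto
        moreover have "b \<le> F p + e p" using b \<epsilon> \<epsilon>1(2)[OF p(1)] ZX(2)[OF pZ] by simp
        ultimately have "path_component {z \<in> N p. F z > b} (pathstart (\<kappa> ?w)) (pathstart (\<kappa> ?w'))"
          using BN pZ by blast
        then obtain l where l: "path l" "path_image l \<subseteq> {z \<in> N p. F z > b}"
          "pathstart l = pathstart (\<kappa> ?w)" "pathfinish l = pathstart (\<kappa> ?w')"
          unfolding path_component_def by blast
        have NW: "N p \<subseteq> ?W" "B p \<subseteq> N p" "path_simple (N p)" using BN pZ by auto
        have "path_image (\<kappa> ?w +++ ?r) \<subseteq> N p"
          by (rule subset_path_image_join) (use kB NW rC u p in auto)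
        moreover have "path_image (l +++ \<kappa> ?w') \<subseteq> N p"
          by (rule subset_path_image_join) (use kB NW l in auto)
        ultimately have "homotopic_paths (N p) (\<kappa> ?w +++ ?r) (l +++ \<kappa> ?w')"
          using NW(3) \<kappa>[OF mem(1)] \<kappa>[OF mem(2)] l r unfolding path_simple_def by simp
        then have "homotopic_paths ?W (\<kappa> ?w +++ ?r) (l +++ \<kappa> ?w')"
          using NW(1) by (rule homotopic_paths_subset)
        moreover have "path_image l \<subseteq> ?V" using l(2) NW(1) by auto
        ultimately show ?thesis using l by blast
      qed
    qed
    then show "\<exists>\<tau>. path \<tau> \<and> path_image \<tau> \<subseteq> ?V \<and> homotopic_paths ?W \<sigma> \<tau>" by blast
  qed
qed

text \<open>
The supremum \<open>s\<close> of the levels to which \<open>\<sigma>\<close> can be pushed is attained, and if it were smaller than \<open>c'\<close>, it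
could be exceeded: both follow from crossing a band of levels around \<open>s\<close>. The gap between \<open>c0\<close> and \<open>c\<close> leaves
room for the homotopy when \<open>s = c\<close>.
\<close>

theorem push_paths_upwards:
  fixes X :: "'a::topological_space set" and F :: "'a \<Rightarrow> real"
  assumes reg: "regular_space (top_of_set X)" and lpc: "locally path_connected X"
    and F: "continuous_on X F" and cpt: "compact {x \<in> X. F x \<le> c'}"
    and c: "c0 < c" "c \<le> c'"
    and asc: "\<And>p. p \<in> X \<Longrightarrow> F p \<le> c' \<Longrightarrow> ascending_at X F p"
    and \<sigma>: "path \<sigma>" "path_image \<sigma> \<subseteq> superlevel X F c" "F (pathstart \<sigma>) > c'" "F (pathfinish \<sigma>) > c'"
  obtains \<tau> where "path \<tau>" "path_image \<tau> \<subseteq> superlevel X F c'" "homotopic_paths (superlevel X F c0) \<sigma> \<tau>"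
proof -
  define S where "S = {b \<in> {c..c'}. \<exists>\<tau>. path \<tau> \<and> path_image \<tau> \<subseteq> superlevel X F b \<and>
      homotopic_paths (superlevel X F c0) \<sigma> \<tau>}"
  have "path_image \<sigma> \<subseteq> superlevel X F c0" using \<sigma>(2) c by auto
  then have "c \<in> S" using \<sigma> c by (auto simp: S_def intro!: exI[of _ \<sigma>])
  have bdd: "bdd_above S" by (rule bdd_aboveI[of _ c']) (simp add: S_def)
  define s where "s = Sup S"
  have s: "c \<le> s" "s \<le> c'"
    using \<open>c \<in> S\<close> bdd by (auto simp: s_def S_def intro: cSup_upper cSup_least)
  obtain \<epsilon> where \<epsilon>: "\<epsilon> > 0" and push:
    "\<And>\<sigma>. \<lbrakk>path \<sigma>; path_image \<sigma> \<subseteq> superlevel X F (s - \<epsilon>);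
        F (pathstart \<sigma>) > min (s + \<epsilon>) c'; F (pathfinish \<sigma>) > min (s + \<epsilon>) c'\<rbrakk> \<Longrightarrow>
      \<exists>\<tau>. path \<tau> \<and> path_image \<tau> \<subseteq> superlevel X F (min (s + \<epsilon>) c') \<and>
          homotopic_paths (superlevel X F c0) \<sigma> \<tau>"
  proof (rule push_across_level[OF reg lpc F cpt])
    show "c0 < s" using s c by simp
    show "s \<le> c'" by fact
    show "ascending_at X F p" if "p \<in> X" "F p = s" for p using asc that s by simp
  qed blast
  obtain b where "b \<in> S" "s - \<epsilon> < b"
    using less_cSup_iff[OF _ bdd, of "s - \<epsilon>"] \<open>c \<in> S\<close> \<epsilon> by (auto simp: s_def)
  then obtain \<tau> where \<tau>: "path \<tau>" "path_image \<tau> \<subseteq> superlevel X F b" "homotopic_paths (superlevel X F c0) \<sigma> \<tau>"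
    by (auto simp: S_def)
  have "path_image \<tau> \<subseteq> superlevel X F (s - \<epsilon>)" using \<tau>(2) \<open>s - \<epsilon> < b\<close> by force
  moreover have "pathstart \<tau> = pathstart \<sigma>" "pathfinish \<tau> = pathfinish \<sigma>"
    using homotopic_paths_imp_pathstart[OF \<tau>(3)] homotopic_paths_imp_pathfinish[OF \<tau>(3)] by auto
  ultimately obtain \<tau>' where \<tau>': "path \<tau>'" "path_image \<tau>' \<subseteq> superlevel X F (min (s + \<epsilon>) c')"
      "homotopic_paths (superlevel X F c0) \<tau> \<tau>'"
    using push[OF \<tau>(1)] \<sigma>(3,4) by (metis min_less_iff_disj)
  have hom: "homotopic_paths (superlevel X F c0) \<sigma> \<tau>'" using \<tau>(3) \<tau>'(3) by (rule homotopic_paths_trans)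
  then have "min (s + \<epsilon>) c' \<in> S" using \<tau>' s \<epsilon> c by (auto simp: S_def)
  then have "min (s + \<epsilon>) c' \<le> s" unfolding s_def by (rule cSup_upper) (rule bdd)
  then have "min (s + \<epsilon>) c' = c'" using \<epsilon> by auto
  then show ?thesis using that[OF \<tau>'(1) _ hom] \<tau>'(2) by simp
qed

section \<open>Holomorphic functions on manifolds\<close>

lemma holo_on_const: "holo_on (\<lambda>_. c) V"
  unfolding holo_on_def by (auto intro!: exI[of _ "\<lambda>_. 0"])

lemma holo_on_cmult:
  assumes "holo_on g V"
  shows "holo_on (\<lambda>z. c * g z) V"
  unfolding holo_on_def
proof
  fix z assume "z \<in> V"
  then obtain D where D: "(g has_derivative D) (at z)" "\<And>c v. D (c *s v) = c * D v"
    using assms unfolding holo_on_def by blast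
  have "((\<lambda>z. c * g z) has_derivative (\<lambda>v. c * D v)) (at z)"
    by (rule has_derivative_mult_right[OF D(1)])
  then show "\<exists>D. ((\<lambda>z. c * g z) has_derivative D) (at z) \<and> (\<forall>c v. D (c *s v) = c * D v)"
    by (intro exI[of _ "\<lambda>v. c * D v"]) (simp add: D(2))
qed

lemma holo_on_power:
  assumes "holo_on g V"
  shows "holo_on (\<lambda>z. g z ^ m) V"
  unfolding holo_on_def
proof
  fix z assume "z \<in> V"
  then obtain D where D: "(g has_derivative D) (at z)" "\<And>c v. D (c *s v) = c * D v"
    using assms unfolding holo_on_def by blast
  have "((\<lambda>z. g z ^ m) has_derivative (\<lambda>v. of_nat m * D v * g z ^ (m - 1))) (at z)"
    by (rule has_derivative_power[OF D(1)])
  then show "\<exists>D. ((\<lambda>z. g z ^ m) has_derivative D) (at z) \<and> (\<forall>c v. D (c *s v) = c * D v)"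
    by (intro exI[of _ "\<lambda>v. of_nat m * D v * g z ^ (m - 1)"]) (simp add: D(2))
qed

lemma holo_on_compose:
  fixes T :: "complex ^ 'n \<Rightarrow> complex ^ 'm"
  assumes T: "\<And>i. holo_on (\<lambda>z. T z $ i) V" and g: "holo_on g V'" and TV: "T ` V \<subseteq> V'"
  shows "holo_on (\<lambda>z. g (T z)) V"
  unfolding holo_on_def
proof
  fix z assume z: "z \<in> V"
  have "\<forall>i. \<exists>D. ((\<lambda>z. T z $ i) has_derivative D) (at z) \<and> (\<forall>c v. D (c *s v) = c * D v)"
    using T z unfolding holo_on_def by blast
  then obtain D where D: "\<And>i. ((\<lambda>z. T z $ i) has_derivative D i) (at z)" "\<And>i c v. D i (c *s v) = c * D i v"
    by metis
  have "(T has_derivative (\<lambda>v. \<chi> i. D i v)) (at z)"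
    unfolding has_derivative_componentwise_within[of T]
    by (auto simp: Basis_vec_def inner_axis intro!: has_derivative_inner_left D(1))
  moreover obtain E where E: "(g has_derivative E) (at (T z))" "\<And>c v. E (c *s v) = c * E v"
    using g TV z unfolding holo_on_def by blast
  ultimately have "((\<lambda>z. g (T z)) has_derivative (\<lambda>v. E (\<chi> i. D i v))) (at z)"
    using diff_chain_at[of T] by (simp add: o_def)
  moreover have "E (\<chi> i. D i (c *s v)) = c * E (\<chi> i. D i v)" for c v
  proof -
    have "(\<chi> i. D i (c *s v)) = c *s (\<chi> i. D i v)" by (simp add: vec_eq_iff D(2))
    then show ?thesis by (simp add: E(2))
  qed
  ultimately show "\<exists>D. ((\<lambda>z. g (T z)) has_derivative D) (at z) \<and> (\<forall>c v. D (c *s v) = c * D v)" by blast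
qed

lemma holo_on_local:
  assumes "\<And>z. z \<in> V \<Longrightarrow> \<exists>S h. open S \<and> z \<in> S \<and> holo_on h S \<and> (\<forall>w\<in>S. h w = g w)"
  shows "holo_on g V"
  unfolding holo_on_def
proof
  fix z assume "z \<in> V"
  from assms[OF this] obtain S h where S: "open S" "z \<in> S" "holo_on h S" "\<forall>w\<in>S. h w = g w"
    by (elim exE conjE)
  from bspec[OF S(3)[unfolded holo_on_def] S(2)]
  obtain D where D: "(h has_derivative D) (at z)" "\<forall>c v. D (c *s v) = c * D v"
    by (elim exE conjE)
  have "(g has_derivative D) (at z)"
    by (rule has_derivative_transform_within_open[OF D(1) S(1,2)]) (simp add: S(4))
  then show "\<exists>D. (g has_derivative D) (at z) \<and> (\<forall>c v. D (c *s v) = c * D v)"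
    using D(2) by (intro exI[of _ D] conjI)
qed

lemma holomorphic_functions_const: "(\<lambda>_. c) \<in> holomorphic_functions \<A>"
  by (auto simp: holomorphic_functions_def holo_on_const)

lemma holomorphic_functions_cmult:
  "g \<in> holomorphic_functions \<A> \<Longrightarrow> (\<lambda>x. c * g x) \<in> holomorphic_functions \<A>"
  by (auto simp: holomorphic_functions_def holo_on_cmult)

lemma holomorphic_functions_power:
  "g \<in> holomorphic_functions \<A> \<Longrightarrow> (\<lambda>x. g x ^ m) \<in> holomorphic_functions \<A>"
  by (auto simp: holomorphic_functions_def holo_on_power)

lemma chartD:
  assumes "chart M W \<phi>"
  shows "openin (top_of_set M) W" "open (\<phi> ` W)" "continuous_on W \<phi>" "continuous_on (\<phi> ` W) (inv_into W \<phi>)"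
    "\<And>x. x \<in> W \<Longrightarrow> inv_into W \<phi> (\<phi> x) = x" "\<And>z. z \<in> \<phi> ` W \<Longrightarrow> \<phi> (inv_into W \<phi> z) = z"
    "\<And>z. z \<in> \<phi> ` W \<Longrightarrow> inv_into W \<phi> z \<in> W"
proof -
  have h: "homeomorphism W (\<phi> ` W) \<phi> (inv_into W \<phi>)" using assms by (simp add: chart_def)
  show "openin (top_of_set M) W" "open (\<phi> ` W)" using assms by (simp_all add: chart_def)
  show "continuous_on W \<phi>" "continuous_on (\<phi> ` W) (inv_into W \<phi>)"
    using homeomorphism_cont1[OF h] homeomorphism_cont2[OF h] by simp_all
  show "inv_into W \<phi> (\<phi> x) = x" if "x \<in> W" for x by (rule homeomorphism_apply1[OF h that])
  show "\<phi> (inv_into W \<phi> z) = z" if "z \<in> \<phi> ` W" for z by (rule homeomorphism_apply2[OF h that])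
  show "inv_into W \<phi> z \<in> W" if "z \<in> \<phi> ` W" for z by (rule inv_into_into[OF that])
qed

lemma chart_open_image:
  assumes c: "chart M W \<phi>" and N: "openin (top_of_set M) N"
  shows "open (\<phi> ` (W \<inter> N))"
proof -
  have "openin (top_of_set W) (W \<inter> N)"
    using N chartD(1)[OF c] openin_imp_subset by (metis openin_Int openin_subset_trans inf_le1)
  then have "openin (top_of_set (\<phi> ` W)) (\<phi> ` (W \<inter> N))"
    using c unfolding chart_def by (blast intro: homeomorphism_imp_open_map)
  then show ?thesis using chartD(2)[OF c] openin_open_trans by blast
qed

lemma chart_open_preimage:
  assumes c: "chart M W \<phi>" and B: "open B" "B \<subseteq> \<phi> ` W"
  shows "openin (top_of_set M) (inv_into W \<phi> ` B)"
proof -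
  have "openin (top_of_set (\<phi> ` W)) B" using B by (simp add: openin_subset_trans open_subset)
  then have "openin (top_of_set W) (inv_into W \<phi> ` B)"
    using c unfolding chart_def by (blast intro: homeomorphism_imp_open_map homeomorphism_symD)
  then show ?thesis using chartD(1)[OF c] openin_trans by blast
qed

lemma complex_atlas_chart:
  assumes "complex_atlas M \<A>" "x \<in> M"
  obtains W \<phi> where "(W, \<phi>) \<in> \<A>" "x \<in> W" "chart M W \<phi>"
proof -
  have A: "\<And>W \<phi>. (W, \<phi>) \<in> \<A> \<Longrightarrow> chart M W \<phi>" "\<Union>(fst ` \<A>) = M"
    using assms(1) unfolding complex_atlas_def by blast+
  obtain c where "c \<in> \<A>" "x \<in> fst c" using A(2) assms(2) by blast
  then show ?thesis using that[of "fst c" "snd c"] A(1)[of "fst c" "snd c"] by simp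
qed

lemma continuous_on_holomorphic_function:
  fixes \<A> :: "('a::topological_space set \<times> ('a \<Rightarrow> complex ^ 'n)) set"
  assumes A: "complex_atlas M \<A>" and g: "g \<in> holomorphic_functions \<A>"
  shows "continuous_on M g"
proof -
  have "openin (top_of_set M) (M \<inter> g -` S)" if S: "open S" for S
  proof (subst openin_subopen, intro ballI)
    fix x assume x: "x \<in> M \<inter> g -` S"
    then obtain W and \<phi> :: "'a \<Rightarrow> complex ^ 'n" where W: "(W, \<phi>) \<in> \<A>" "x \<in> W" "chart M W \<phi>"
      using complex_atlas_chart[OF A] by blast
    have "holo_on (\<lambda>z. g (inv_into W \<phi> z)) (\<phi> ` W)"
      using g W(1) by (auto simp: holomorphic_functions_def)
    from continuous_on_compose[OF chartD(3)[OF W(3)] holo_on_imp_continuous_on[OF this]]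
    have "continuous_on W g"
      by (rule continuous_on_eq) (simp add: chartD(5)[OF W(3)])
    then have "openin (top_of_set W) (W \<inter> g -` S)" using S by (rule continuous_openin_preimage_gen)
    then have "openin (top_of_set M) (W \<inter> g -` S)" using chartD(1)[OF W(3)] openin_trans by blast
    moreover have "W \<subseteq> M" using chartD(1)[OF W(3)] openin_imp_subset by blast
    ultimately show "\<exists>T. openin (top_of_set M) T \<and> x \<in> T \<and> T \<subseteq> M \<inter> g -` S"
      using x W(2) by (intro exI[of _ "W \<inter> g -` S"]) auto
  qed
  then show ?thesis by (simp add: continuous_openin_preimage_eq)
qed

text \<open>
Near each point \<open>g\<close> is, in the coordinates \<open>\<psi>\<close>, the composition of a transition map with \<open>g\<close> in a chart of
the atlas, and both are holomorphic.
\<close>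

lemma holo_on_in_coordinates:
  fixes \<A> :: "('a::topological_space set \<times> ('a \<Rightarrow> complex ^ 'n)) set"
  assumes A: "complex_atlas M \<A>" and g: "g \<in> holomorphic_functions \<A>"
    and W: "holomorphic_coordinates M \<A> W \<psi>"
  shows "holo_on (\<lambda>z. g (inv_into W \<psi> z)) (\<psi> ` W)"
proof (rule holo_on_local)
  have c: "chart M W \<psi>" using W by (simp add: holomorphic_coordinates_def)
  fix z assume "z \<in> \<psi> ` W"
  then obtain y where y: "y \<in> W" "z = \<psi> y" by blast
  then have "y \<in> M" using chartD(1)[OF c] openin_imp_subset by blast
  then obtain W' and \<phi> :: "'a \<Rightarrow> complex ^ 'n" where W': "(W', \<phi>) \<in> \<A>" "y \<in> W'" "chart M W' \<phi>"
    using complex_atlas_chart[OF A] by blast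
  let ?S = "\<psi> ` (W \<inter> W')" and ?h = "\<lambda>z. g (inv_into W' \<phi> (\<phi> (inv_into W \<psi> z)))"
  have "holo_on ?h ?S"
  proof (rule holo_on_compose)
    show "holo_on (\<lambda>z. \<phi> (inv_into W \<psi> z) $ i) ?S" for i
      using W W'(1) unfolding holomorphic_coordinates_def transition_holo_def by fast
    show "holo_on (\<lambda>z. g (inv_into W' \<phi> z)) (\<phi> ` W')"
      using g W'(1) by (auto simp: holomorphic_functions_def)
    show "(\<lambda>z. \<phi> (inv_into W \<psi> z)) ` ?S \<subseteq> \<phi> ` W'" using chartD(5)[OF c] by auto
  qed
  moreover have "open ?S" by (rule chart_open_image[OF c chartD(1)[OF W'(3)]])
  moreover have "z \<in> ?S" using y W'(2) by blast
  moreover have "?h w = g (inv_into W \<psi> w)" if w: "w \<in> ?S" for w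
  proof -
    obtain x where x: "x \<in> W" "x \<in> W'" "w = \<psi> x" using w by blast
    then show ?thesis by (simp add: chartD(5)[OF c] chartD(5)[OF W'(3)])
  qed
  ultimately show "\<exists>S h. open S \<and> z \<in> S \<and> holo_on h S \<and> (\<forall>w\<in>S. h w = g (inv_into W \<psi> w))"
    by (intro exI[of _ ?S] exI[of _ ?h]) simp
qed

lemma chart_ball:
  fixes \<phi> :: "'a::topological_space \<Rightarrow> complex ^ 'n"
  assumes c: "chart M W \<phi>" and N: "openin (top_of_set M) N" and p: "p \<in> W" "p \<in> N"
  obtains V where "open V" "convex V" "\<phi> p \<in> V" "V \<subseteq> \<phi> ` W" "inv_into W \<phi> ` V \<subseteq> N"
proof -
  have "\<phi> p \<in> \<phi> ` (W \<inter> N)" using p by simp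
  then obtain R where R: "R > 0" "ball (\<phi> p) R \<subseteq> \<phi> ` (W \<inter> N)"
    by (rule openE[OF chart_open_image[OF c N]])
  show ?thesis
  proof (rule that)
    show "open (ball (\<phi> p) R)" "convex (ball (\<phi> p) R)" "\<phi> p \<in> ball (\<phi> p) R"
      by (simp_all add: R(1))
    show "inv_into W \<phi> ` ball (\<phi> p) R \<subseteq> N"
    proof
      fix y assume "y \<in> inv_into W \<phi> ` ball (\<phi> p) R"
      then obtain x where "x \<in> W" "x \<in> N" "y = inv_into W \<phi> (\<phi> x)" using R(2) by blast
      then show "y \<in> N" by (simp add: chartD(5)[OF c])
    qed
    show "ball (\<phi> p) R \<subseteq> \<phi> ` W" using R(2) by blast
  qed
qed

lemma locally_path_connected_manifold:
  fixes \<A> :: "('a::topological_space set \<times> ('a \<Rightarrow> complex ^ 'n)) set"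
  assumes A: "complex_atlas M \<A>"
  shows "locally path_connected M"
  unfolding locally_path_connected
proof (intro allI impI, elim conjE)
  fix N x assume N: "openin (top_of_set M) N" "x \<in> N"
  then have "x \<in> M" using openin_imp_subset by blast
  then obtain W and \<phi> :: "'a \<Rightarrow> complex ^ 'n" where W: "(W, \<phi>) \<in> \<A>" "x \<in> W" "chart M W \<phi>"
    using complex_atlas_chart[OF A] by blast
  obtain V where V: "open V" "convex V" "\<phi> x \<in> V" "V \<subseteq> \<phi> ` W" "inv_into W \<phi> ` V \<subseteq> N"
    using chart_ball[OF W(3) N(1) W(2) N(2)] by blast
  have "path_connected (inv_into W \<phi> ` V)"
    by (rule path_connected_continuous_image[OF continuous_on_subset[OF chartD(4)[OF W(3)] V(4)]
        convex_imp_path_connected[OF V(2)]])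
  moreover have "x \<in> inv_into W \<phi> ` V" using imageI[OF V(3), of "inv_into W \<phi>"] unfolding chartD(5)[OF W(3) W(2)] .
  ultimately show "\<exists>U. openin (top_of_set M) U \<and> path_connected U \<and> x \<in> U \<and> U \<subseteq> N"
    using chart_open_preimage[OF W(3) V(1,4)] V(5) by blast
qed

lemma path_simple_chart_image:
  assumes c: "chart M W \<phi>" and V: "convex V" "V \<subseteq> \<phi> ` W"
  shows "path_simple (inv_into W \<phi> ` V)"
  unfolding path_simple_def
proof (intro allI impI, elim conjE)
  let ?i = "inv_into W \<phi>" let ?N = "?i ` V"
  have NW: "?N \<subseteq> W"
  proof
    fix x assume "x \<in> ?N"
    then obtain z where "z \<in> V" "x = ?i z" by blast
    then show "x \<in> W" using chartD(7)[OF c subsetD[OF V(2)]] by simp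
  qed
  have \<phi>N: "\<phi> x \<in> V" "?i (\<phi> x) = x" if x: "x \<in> ?N" for x
  proof -
    obtain z where z: "z \<in> V" "x = ?i z" using x by blast
    then show "\<phi> x \<in> V" using chartD(6)[OF c subsetD[OF V(2)]] by simp
    show "?i (\<phi> x) = x" using chartD(5)[OF c subsetD[OF NW x]] .
  qed
  have roundtrip: "homotopic_paths ?N (?i \<circ> (\<phi> \<circ> g)) g" if "path g" "path_image g \<subseteq> ?N" for g
  proof (rule homotopic_paths_sym, rule homotopic_paths_eq[OF that])
    fix t :: real assume "t \<in> {0..1}"
    then have "g t \<in> ?N" using that(2) by (auto simp: path_image_def)
    then show "g t = (?i \<circ> (\<phi> \<circ> g)) t" by (simp add: \<phi>N)
  qed
  fix g h assume g: "path g" "path_image g \<subseteq> ?N" and h: "path h" "path_image h \<subseteq> ?N"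
    and e: "pathstart g = pathstart h" "pathfinish g = pathfinish h"
  have path: "path (\<phi> \<circ> g)" "path (\<phi> \<circ> h)"
    using g h NW by (auto intro!: path_continuous_image continuous_on_subset[OF chartD(3)[OF c]])
  have im: "(\<phi> \<circ> g) t \<in> V" "(\<phi> \<circ> h) t \<in> V" if "t \<in> {0..1}" for t
    using that g(2) h(2) \<phi>N(1) by (auto simp: path_image_def image_subset_iff)
  have "homotopic_paths V (\<phi> \<circ> g) (\<phi> \<circ> h)"
  proof (rule homotopic_paths_linear[OF path])
    show "closed_segment ((\<phi> \<circ> g) t) ((\<phi> \<circ> h) t) \<subseteq> V" if "t \<in> {0..1}" for t
      using im[OF that] V(1) by (rule closed_segment_subset)
  qed (use e in \<open>simp_all add: pathstart_compose pathfinish_compose\<close>)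
  then have "homotopic_paths ?N (?i \<circ> (\<phi> \<circ> g)) (?i \<circ> (\<phi> \<circ> h))"
    by (rule homotopic_paths_continuous_image)
      (use V(2) in \<open>auto intro: continuous_on_subset[OF chartD(4)[OF c]]\<close>)
  then show "homotopic_paths ?N g h"
    using roundtrip[OF g] roundtrip[OF h] by (meson homotopic_paths_sym homotopic_paths_trans)
qed

section \<open>Sums of squares are ascending\<close>

definition sum_sq :: "('a \<Rightarrow> complex) set \<Rightarrow> 'a \<Rightarrow> real" where
  "sum_sq J x = (\<Sum>g\<in>J. (cmod (g x))\<^sup>2)"

lemma path_component_image:
  assumes "path_component S x y" "continuous_on S h"
  shows "path_component (h ` S) (h x) (h y)"
proof -
  obtain g where g: "path g" "path_image g \<subseteq> S" "pathstart g = x" "pathfinish g = y"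
    using assms(1) unfolding path_component_def by blast
  have "path (h \<circ> g)" by (rule path_continuous_image[OF g(1) continuous_on_subset[OF assms(2) g(2)]])
  moreover have "path_image (h \<circ> g) \<subseteq> h ` S" using g(2) by (auto simp: path_image_def)
  ultimately show ?thesis
    unfolding path_component_def
    by (intro exI[of _ "h \<circ> g"]) (simp add: g pathstart_compose pathfinish_compose)
qed

text \<open>
In the coordinates \<open>\<psi>\<close> the functions of \<open>J\<close> include the coordinate functions of \<open>complex ^ 'n\<close>, so every
nonzero vector has a nonzero derivative along one of them. Convex sets in the coordinate domain provide the
sets on which paths are determined by their ends.
\<close>

lemma ascending_at_sum_sq:
  fixes \<A> :: "('a::topological_space set \<times> ('a \<Rightarrow> complex ^ 'n)) set"
  assumes A: "complex_atlas M \<A>" and n: "CARD('n) \<ge> 2"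
    and J: "finite J" "J \<subseteq> holomorphic_functions \<A>"
    and W: "holomorphic_coordinates M \<A> W \<psi>" "p \<in> W"
    and coord: "\<And>i. (\<lambda>y. \<psi> y $ i) \<in> J"
  shows "ascending_at M (sum_sq J) p"
  unfolding ascending_at_def
proof (intro allI impI, elim conjE, goal_cases)
  case N: (1 N)
  have c: "chart M W \<psi>" using W(1) by (simp add: holomorphic_coordinates_def)
  let ?i = "inv_into W \<psi>"
  obtain V where Vp: "open V" "convex V" "\<psi> p \<in> V" "V \<subseteq> \<psi> ` W" "?i ` V \<subseteq> N"
    using chart_ball[OF c N(1) W(2) N(2)] .
  interpret sum_of_squares J "\<lambda>g z. g (?i z)" V
    by unfold_locales
      (use J Vp in \<open>auto intro: holo_on_subset[OF holo_on_in_coordinates[OF A _ W(1)]]\<close>)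
  have f: "f z = sum_sq J (?i z)" for z by (simp add: f_def sum_sq_def)
  have ip: "?i (\<psi> p) = p" by (rule chartD(5)[OF c W(2)])
  have imm: "\<exists>g\<in>J. dir_deriv (\<lambda>z. g (?i z)) v (\<psi> p) \<noteq> 0" if v: "v \<noteq> 0" for v
  proof -
    obtain i where i: "v $ i \<noteq> 0" using v by (metis vec_eq_iff zero_index)
    have "dir_deriv (\<lambda>z. \<psi> (?i z) $ i) v (\<psi> p) = dir_deriv (\<lambda>z. z $ i) v (\<psi> p)"
      by (rule dir_deriv_cong[OF Vp(1,3)]) (simp add: chartD(6)[OF c subsetD[OF Vp(4)]])
    also have "\<dots> = v $ i"
      by (rule dir_deriv_eq) (simp_all add: bounded_linear_imp_has_derivative bounded_linear_vec_nth)
    finally show ?thesis using i by (intro bexI[OF _ coord[of i]]) simp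
  qed
  obtain B \<epsilon> where B: "open B" "\<psi> p \<in> B" "B \<subseteq> V" "\<epsilon> > 0"
    and conn: "\<forall>a x y. a \<le> f (\<psi> p) + \<epsilon> \<and> x \<in> B \<and> y \<in> B \<and> f x > a \<and> f y > a \<longrightarrow>
       path_component {z \<in> V. f z > a} x y"
    and ex: "\<exists>x\<in>V. f x > f (\<psi> p)"
    by (rule superlevel_locally_connected[OF Vp(3) n imm])
  have conti: "continuous_on V ?i" by (rule continuous_on_subset[OF chartD(4)[OF c] Vp(4)])
  show ?case
  proof (rule conjI[OF _ exI[of _ "?i ` B", OF exI[of _ "?i ` V", OF exI[of _ \<epsilon>]]]])
    show "\<exists>x\<in>N. sum_sq J p < sum_sq J x" using ex Vp(5) unfolding f ip by blast
  next
    have "openin (top_of_set M) (?i ` B)"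
      by (rule chart_open_preimage[OF c B(1)]) (use B(3) Vp(4) in blast)
    moreover have "p \<in> ?i ` B" using imageI[OF B(2), of ?i] unfolding ip .
    moreover have "?i ` B \<subseteq> ?i ` V" by (rule image_mono[OF B(3)])
    moreover have "path_simple (?i ` V)" by (rule path_simple_chart_image[OF c Vp(2,4)])
    moreover have "path_component {z \<in> ?i ` V. sum_sq J z > a} x y" if a: "a \<le> sum_sq J p + \<epsilon> \<and> x \<in> ?i ` B \<and> y \<in> ?i ` B \<and> sum_sq J x > a \<and> sum_sq J y > a" for a x y
    proof -
      from a obtain x' y' where xy: "x' \<in> B" "y' \<in> B" "x = ?i x'" "y = ?i y'" by blast
      have "path_component {z \<in> V. f z > a} x' y'"
        by (rule conn[rule_format]) (use a xy in \<open>simp add: f ip\<close>)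
      then have "path_component (?i ` {z \<in> V. f z > a}) (?i x') (?i y')"
        by (rule path_component_image) (rule continuous_on_subset[OF conti], blast)
      then show ?thesis
        unfolding xy(3,4) by (rule path_component_of_subset[rotated]) (auto simp: f)
    qed
    ultimately show "openin (top_of_set M) (?i ` B) \<and> p \<in> ?i ` B \<and> ?i ` B \<subseteq> ?i ` V \<and> ?i ` V \<subseteq> N \<and>
        path_simple (?i ` V) \<and> \<epsilon> > 0 \<and>
        (\<forall>a x y. a \<le> sum_sq J p + \<epsilon> \<and> x \<in> ?i ` B \<and> y \<in> ?i ` B \<and> sum_sq J x > a \<and> sum_sq J y > a \<longrightarrow>
           path_component {z \<in> ?i ` V. sum_sq J z > a} x y)"
      using Vp(5) B(4) by simp
  qed
qed

text \<open>
For passing from \<open>M\<close> to its component \<open>X\<close>, and from a sum of squares to a function that agrees with it where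
the sum is not too large.
\<close>

lemma ascending_at_local:
  assumes asc: "ascending_at M f p" and O': "openin (top_of_set M) S" "p \<in> S" "S \<subseteq> X" "X \<subseteq> M"
    and X: "openin (top_of_set M) X" and eq: "\<And>x. x \<in> S \<Longrightarrow> F x = f x"
  shows "ascending_at X F p"
  unfolding ascending_at_def
proof (intro allI impI, elim conjE, goal_cases)
  case N: (1 N)
  have "openin (top_of_set M) (N \<inter> S)" using openin_trans[OF N(1) X] O'(1) by (rule openin_Int)
  with asc[unfolded ascending_at_def, THEN spec, of "N \<inter> S"] N(2) O'(2)
  obtain q B N' \<epsilon> where q: "q \<in> N \<inter> S" "f q > f p"
    and B: "openin (top_of_set M) B" "p \<in> B" "B \<subseteq> N'" "N' \<subseteq> N \<inter> S" "path_simple N'" "\<epsilon> > 0"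
    and conn: "\<forall>a x y. a \<le> f p + \<epsilon> \<and> x \<in> B \<and> y \<in> B \<and> f x > a \<and> f y > a \<longrightarrow>
           path_component {z \<in> N'. f z > a} x y"
    by blast
  have ex: "\<exists>x\<in>N. F x > F p" using q eq[of q] eq[OF O'(2)] by (intro bexI[of _ q]) simp_all
  have eq': "F x = f x" if "x \<in> N'" for x using eq B(4) that by blast
  have "B \<subseteq> X" using B(3,4) O'(3) by blast
  then have "openin (top_of_set X) B" using B(1) O'(4) by (rule_tac openin_subset_trans)
  moreover have "path_component {z \<in> N'. F z > a} x y"
    if "a \<le> F p + \<epsilon>" "x \<in> B" "y \<in> B" "F x > a" "F y > a" for a x y
  proof -
    have "{z \<in> N'. F z > a} = {z \<in> N'. f z > a}" using eq' by auto
    then show ?thesis using conn that eq O'(2) eq'[OF subsetD[OF B(3)]] by simp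
  qed
  ultimately show ?case
    using ex B(2,3,5,6) B(4)
    by (intro conjI[OF ex exI[of _ B, OF exI[of _ N', OF exI[of _ \<epsilon>]]]]) simp
qed

section \<open>Peak functions off the holomorphic hull\<close>

lemma sum_sq_mono:
  assumes "finite J" "I \<subseteq> J"
  shows "sum_sq I x \<le> sum_sq J x"
  unfolding sum_sq_def by (rule sum_mono2) (use assms in auto)

lemma sum_sq_Un_le:
  assumes "finite I" "finite J"
  shows "sum_sq (I \<union> J) x \<le> sum_sq I x + sum_sq J x"
  unfolding sum_sq_def
  by (subst sum_Un) (use assms in \<open>auto intro!: sum_nonneg\<close>)

lemma sum_sq_nonneg: "sum_sq J x \<ge> 0"
  by (simp add: sum_sq_def sum_nonneg)

lemma continuous_on_sum_sq:
  fixes \<A> :: "('a::topological_space set \<times> ('a \<Rightarrow> complex ^ 'n)) set"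
  assumes "complex_atlas M \<A>" "J \<subseteq> holomorphic_functions \<A>"
  shows "continuous_on M (sum_sq J)"
proof -
  have "continuous_on M g" if "g \<in> J" for g
    using continuous_on_holomorphic_function[OF assms(1)] assms(2) that by blast
  then show ?thesis unfolding sum_sq_def by (intro continuous_intros)
qed

lemma sum_sq_small:
  assumes J: "finite J" "J \<noteq> {}" and \<theta>: "\<And>g. g \<in> J \<Longrightarrow> (cmod (g x))\<^sup>2 < \<eta> / card J"
  shows "sum_sq J x < \<eta>"
proof -
  have "sum_sq J x < (\<Sum>g\<in>J. \<eta> / card J)" unfolding sum_sq_def by (rule sum_strict_mono) (use J \<theta> in auto)
  then show ?thesis using J by simp
qed

text \<open>
A function whose absolute value at \<open>z\<close> exceeds its bound on \<open>K\<close>, divided by the mean of the two numbers (with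
the bound raised to 0 if it is negative). If the value at \<open>z\<close> is zero, then \<open>K\<close> must be empty, and a constant serves.
\<close>

lemma peak_function:
  fixes \<A> :: "('a::topological_space set \<times> ('a \<Rightarrow> complex ^ 'n)) set"
  assumes z: "z \<in> M" "z \<notin> holomorphic_hull M \<A> K"
  obtains g \<theta> where "g \<in> holomorphic_functions \<A>" "0 \<le> \<theta>" "\<theta> < 1" "\<And>x. x \<in> K \<Longrightarrow> cmod (g x) \<le> \<theta>"
    "cmod (g z) > 1"
proof -
  obtain h B where h: "h \<in> holomorphic_functions \<A>" "\<And>x. x \<in> K \<Longrightarrow> cmod (h x) \<le> B" "cmod (h z) > B"
    using z unfolding holomorphic_hull_def by force
  define B0 where "B0 = max B 0"
  show ?thesis
  proof (cases "cmod (h z) > 0")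
    case True
    then have B0: "0 \<le> B0" "B0 < cmod (h z)" using h(3) by (auto simp: B0_def)
    define b where "b = (B0 + cmod (h z)) / 2"
    have b: "b > 0" "B0 < b" "b < cmod (h z)" using B0 by (auto simp: b_def)
    show ?thesis
    proof (rule that[of "\<lambda>x. of_real (1 / b) * h x" "B0 / b"])
      show "(\<lambda>x. of_real (1 / b) * h x) \<in> holomorphic_functions \<A>"
        by (rule holomorphic_functions_cmult[OF h(1)])
      show "cmod (of_real (1 / b) * h x) \<le> B0 / b" if "x \<in> K" for x
        using h(2)[OF that] b by (simp add: norm_mult norm_divide divide_right_mono B0_def)
    qed (use b B0 in \<open>auto simp: norm_mult norm_divide\<close>)
  next
    case False
    then have "K = {}" using h(2,3) by (metis norm_ge_zero order_trans not_le equals0I)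
    then show ?thesis
      by (intro that[of "\<lambda>_. 2" 0] holomorphic_functions_const) auto
  qed
qed

text \<open>
High powers of a peak function are small on \<open>K\<close> and large near the peak. Finitely many peaks suffice for \<open>Q\<close>
by compactness, and then a common exponent can be chosen.
\<close>

lemma peak_family:
  fixes \<A> :: "('a::topological_space set \<times> ('a \<Rightarrow> complex ^ 'n)) set"
  assumes A: "complex_atlas M \<A>" and Q: "compact Q" "Q \<subseteq> M" "Q \<inter> holomorphic_hull M \<A> K = {}"
    and \<eta>: "(\<eta>::real) > 0"
  obtains J where "finite J" "J \<subseteq> holomorphic_functions \<A>"
    "\<And>x. x \<in> K \<Longrightarrow> sum_sq J x < \<eta>" "\<And>x. x \<in> Q \<Longrightarrow> sum_sq J x > b"
proof (cases "Q = {}")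
  case True
  then show ?thesis using \<eta> by (intro that[of "{}"]) (auto simp: sum_sq_def)
next
  case False
  define P where "P z g \<theta> \<longleftrightarrow> g \<in> holomorphic_functions \<A> \<and> 0 \<le> \<theta> \<and> \<theta> < 1 \<and> (\<forall>x\<in>K. cmod (g x) \<le> \<theta>) \<and> cmod (g z) > 1"
    for z g and \<theta> :: real
  have "\<forall>z\<in>Q. \<exists>g \<theta>. P z g \<theta>"
  proof
    fix z assume "z \<in> Q"
    then have "z \<in> M" "z \<notin> holomorphic_hull M \<A> K" using Q by auto
    then show "\<exists>g \<theta>. P z g \<theta>" using peak_function[of z M \<A> K] unfolding P_def by metis
  qed
  then obtain g \<theta> where P: "\<forall>z\<in>Q. P z (g z) (\<theta> z)" by metis
  have g: "g z \<in> holomorphic_functions \<A>" "0 \<le> \<theta> z" "\<theta> z < 1" "\<And>x. x \<in> K \<Longrightarrow> cmod (g z x) \<le> \<theta> z"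
    "cmod (g z z) > 1" if "z \<in> Q" for z
    using P that unfolding P_def by blast+
  define r where "r z = (1 + cmod (g z z)) / 2" for z
  have r: "r z > 1" "r z < cmod (g z z)" if "z \<in> Q" for z using g(5)[OF that] by (auto simp: r_def)
  define S where "S z = M \<inter> (\<lambda>x. cmod (g z x)) -` {r z<..}" for z
  have S: "openin (top_of_set M) (S z)" if "z \<in> Q" for z
    unfolding S_def
    by (intro continuous_openin_preimage_gen continuous_on_norm
        continuous_on_holomorphic_function[OF A g(1)[OF that]]) simp
  have zS: "z \<in> S z" if "z \<in> Q" for z using r(2)[OF that] Q(2) that by (auto simp: S_def)
  have "compactin (top_of_set M) Q" using Q by (simp add: compactin_subtopology)
  then obtain \<F> where "finite \<F>" "\<F> \<subseteq> S ` Q" "Q \<subseteq> \<Union>\<F>"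
    using compactinD[of "top_of_set M" Q "S ` Q"] S zS by blast
  then obtain Z where Z: "finite Z" "Z \<subseteq> Q" "Q \<subseteq> \<Union>(S ` Z)" by (metis finite_subset_image)
  have "Z \<noteq> {}" using Z(3) False by auto
  define \<eta>' where "\<eta>' = \<eta> / card Z"
  have \<eta>': "\<eta>' > 0" using \<eta> Z(1) \<open>Z \<noteq> {}\<close> by (simp add: \<eta>'_def card_gt_0_iff)
  have "\<forall>\<^sub>F m in sequentially. (\<theta> z)\<^sup>2 ^ m < \<eta>' \<and> (r z)\<^sup>2 ^ m > b" if "z \<in> Z" for z
  proof (rule eventually_conj)
    have z: "z \<in> Q" using that Z(2) by blast
    have "(\<theta> z)\<^sup>2 < 1" using g(2,3)[OF z] by (simp add: abs_square_less_1)
    then have "(\<lambda>m. (\<theta> z)\<^sup>2 ^ m) \<longlonglongrightarrow> 0" by (intro LIMSEQ_realpow_zero) auto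
    then show "\<forall>\<^sub>F m in sequentially. (\<theta> z)\<^sup>2 ^ m < \<eta>'" using \<eta>' by (rule order_tendstoD)
    have r1: "(r z)\<^sup>2 > 1" using r(1)[OF z] by (simp add: one_less_power)
    then obtain k where k: "b < (r z)\<^sup>2 ^ k" using real_arch_pow by blast
    show "\<forall>\<^sub>F m in sequentially. (r z)\<^sup>2 ^ m > b"
    proof (rule eventually_sequentiallyI)
      show "(r z)\<^sup>2 ^ m > b" if "k \<le> m" for m
        using k power_increasing[OF that, of "(r z)\<^sup>2"] r1 by linarith
    qed
  qed
  then have "\<forall>\<^sub>F m in sequentially. \<forall>z\<in>Z. (\<theta> z)\<^sup>2 ^ m < \<eta>' \<and> (r z)\<^sup>2 ^ m > b"
    using Z(1) by (simp add: eventually_ball_finite)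
  then obtain m where m: "\<And>z. z \<in> Z \<Longrightarrow> (\<theta> z)\<^sup>2 ^ m < \<eta>'" "\<And>z. z \<in> Z \<Longrightarrow> (r z)\<^sup>2 ^ m > b"
    by (auto simp: eventually_sequentially)
  define J where "J = (\<lambda>z x. g z x ^ m) ` Z"
  have J: "finite J" "J \<noteq> {}" "card J \<le> card Z" using Z(1) \<open>Z \<noteq> {}\<close> by (auto simp: J_def card_image_le)
  show ?thesis
  proof (rule that[of J])
    show "J \<subseteq> holomorphic_functions \<A>"
      using g(1) Z(2) by (auto simp: J_def intro!: holomorphic_functions_power)
    show "sum_sq J x < \<eta>" if x: "x \<in> K" for x
    proof (rule sum_sq_small[OF J(1,2)])
      fix h assume "h \<in> J"
      then obtain z where z: "z \<in> Z" "h = (\<lambda>x. g z x ^ m)" by (auto simp: J_def)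
      have "(cmod (h x))\<^sup>2 = ((cmod (g z x))\<^sup>2) ^ m"
        by (simp add: z norm_power power_mult[symmetric] mult.commute)
      also have "\<dots> \<le> ((\<theta> z)\<^sup>2) ^ m"
        using g(4)[OF _ x] z(1) Z(2) by (intro power_mono) auto
      also have "\<dots> < \<eta>'" by (rule m(1)[OF z(1)])
      also have "\<eta>' \<le> \<eta> / card J" unfolding \<eta>'_def
        using J \<eta> card_gt_0_iff[of J] card_gt_0_iff[of Z] Z(1) \<open>Z \<noteq> {}\<close>
        by (intro divide_left_mono mult_pos_pos) auto
      finally show "(cmod (h x))\<^sup>2 < \<eta> / card J" .
    qed
    show "sum_sq J x > b" if x: "x \<in> Q" for x
    proof -
      obtain z where z: "z \<in> Z" "x \<in> S z" using x Z(3) by blast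
      have "b < (r z)\<^sup>2 ^ m" by (rule m(2)[OF z(1)])
      also have "\<dots> \<le> ((cmod (g z x))\<^sup>2) ^ m"
        using z r(1)[of z] Z(2) by (intro power_mono) (auto simp: S_def)
      also have "\<dots> = (cmod (g z x ^ m))\<^sup>2" by (simp add: norm_power power_mult[symmetric] mult.commute)
      also have "\<dots> \<le> sum_sq J x" unfolding sum_sq_def
        by (rule member_le_sum[where f = "\<lambda>h. (cmod (h x))\<^sup>2" and i = "\<lambda>x. g z x ^ m"])
          (use z J in \<open>auto simp: J_def\<close>)
      finally show ?thesis .
    qed
  qed (rule J(1))
qed

section \<open>Exhausting a component of a Stein manifold\<close>

lemma neighborhood_system_decreasing:
  assumes "neighborhood_system C U" "i \<le> j"
  shows "U j \<subseteq> U i"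
proof (rule lift_Suc_antimono_le[OF _ assms(2)])
  show "U (Suc k) \<subseteq> U k" for k using assms(1) by (simp add: neighborhood_system_def)
qed

lemma neighborhood_system_complement:
  assumes U: "neighborhood_system C U"
  shows "compact (C - U i)" "U i \<subseteq> C" "\<exists>V. openin (top_of_set C) V \<and> C - U i \<subseteq> V \<and> V \<subseteq> C - U (Suc i)"
proof -
  have "neighborhood_of_infinity C (U i)" using U by (simp add: neighborhood_system_def)
  then obtain K where K: "K \<subseteq> C" "compact K" "U i = C - K" by (auto simp: neighborhood_of_infinity_def)
  then have "C - U i = K" by auto
  then show "compact (C - U i)" "U i \<subseteq> C" using K by auto
  have "openin (top_of_set C) (C \<inter> - closure (U (Suc i)))" by (intro openin_open_Int) auto
  moreover have "C \<inter> closure (U (Suc i)) \<subseteq> U i" using U by (simp add: neighborhood_system_def)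
  moreover have "U (Suc i) \<subseteq> closure (U (Suc i))" by (rule closure_subset)
  ultimately show "\<exists>V. openin (top_of_set C) V \<and> C - U i \<subseteq> V \<and> V \<subseteq> C - U (Suc i)"
    by (intro exI[of _ "C \<inter> - closure (U (Suc i))"]) auto
qed

lemma compact_subset_exhausted:
  assumes U: "neighborhood_system C U" and Q: "compact Q" "Q \<subseteq> C"
  obtains i where "Q \<subseteq> C - U i"
proof -
  obtain V where "\<forall>i. openin (top_of_set C) (V i) \<and> C - U i \<subseteq> V i \<and> V i \<subseteq> C - U (Suc i)"
    using choice[OF allI[OF neighborhood_system_complement(3)[OF U]]] by (rule exE)
  then have V: "openin (top_of_set C) (V i)" "C - U i \<subseteq> V i" "V i \<subseteq> C - U (Suc i)" for i
    by simp_all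
  have "(\<Inter>i. U i) = {}" using U by (simp add: neighborhood_system_def)
  have "Q \<subseteq> \<Union>(range V)"
  proof
    fix x assume x: "x \<in> Q"
    then obtain i where "x \<notin> U i" using \<open>(\<Inter>i. U i) = {}\<close> by blast
    then have "x \<in> V i" using V(2)[of i] x Q(2) by blast
    then show "x \<in> \<Union>(range V)" by blast
  qed
  moreover have "compactin (top_of_set C) Q" using Q by (simp add: compactin_subtopology)
  ultimately obtain \<F> where "finite \<F>" "\<F> \<subseteq> range V" "Q \<subseteq> \<Union>\<F>"
    using compactinD[of "top_of_set C" Q "range V"] V(1) by blast
  then obtain I where I: "finite I" "Q \<subseteq> \<Union>(V ` I)" by (metis finite_subset_image)
  obtain m where m: "\<forall>i\<in>I. i \<le> m" using finite_nat_set_iff_bounded_le[THEN iffD1, OF I(1)] by (rule exE)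
  have "Q \<subseteq> C - U (Suc m)"
  proof
    fix x assume "x \<in> Q"
    then obtain i where i: "i \<in> I" "x \<in> V i" using I(2) by blast
    have "U (Suc m) \<subseteq> U (Suc i)" using m i(1) by (intro neighborhood_system_decreasing[OF U]) simp
    then show "x \<in> C - U (Suc m)" using V(3)[of i] i(2) by blast
  qed
  then show ?thesis by (rule that)
qed

lemma compact_neighborhood:
  assumes U: "neighborhood_system C U" and Q: "compact Q" "Q \<subseteq> C"
  obtains V L where "openin (top_of_set C) V" "Q \<subseteq> V" "V \<subseteq> L" "compact L" "L \<subseteq> C"
proof -
  obtain i where i: "Q \<subseteq> C - U i" by (rule compact_subset_exhausted[OF U Q])
  obtain V where "openin (top_of_set C) V" "C - U i \<subseteq> V" "V \<subseteq> C - U (Suc i)"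
    using neighborhood_system_complement(3)[OF U, of i] by (elim exE conjE)
  moreover have "compact (C - U (Suc i))" by (rule neighborhood_system_complement(1)[OF U])
  ultimately show ?thesis using order_trans[OF i] by (intro that[of V "C - U (Suc i)"]) simp_all
qed

lemma continuous_bounded_above:
  fixes f :: "'a::topological_space \<Rightarrow> real"
  assumes "continuous_on K f" "compact K"
  obtains b where "b \<ge> 0" "\<And>x. x \<in> K \<Longrightarrow> f x \<le> b"
proof (cases "K = {}")
  case False
  obtain y where "\<forall>x\<in>K. f x \<le> f y"
    using continuous_attains_sup[OF assms(2) False assms(1)] by (elim bexE)
  then show ?thesis by (intro that[of "max (f y) 0"]) (simp_all add: max.coboundedI1)
qed (use that[of 0] in auto)

lemma coordinate_family:
  fixes \<A> :: "('a::topological_space set \<times> ('a \<Rightarrow> complex ^ 'n)) set"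
  assumes st: "stein_manifold M \<A>" and L: "compact L" "L \<subseteq> M"
  obtains J where "finite J" "J \<subseteq> holomorphic_functions \<A>"
    "\<And>x. x \<in> L \<Longrightarrow> \<exists>W \<psi>. x \<in> W \<and> holomorphic_coordinates M \<A> W \<psi> \<and> (\<forall>i. (\<lambda>y. \<psi> y $ i) \<in> J)"
proof -
  define good where "good x W \<psi> \<longleftrightarrow> x \<in> W \<and> holomorphic_coordinates M \<A> W \<psi> \<and>
      (\<forall>i. (\<lambda>y. \<psi> y $ i) \<in> holomorphic_functions \<A>)" for x W and \<psi> :: "'a \<Rightarrow> complex ^ 'n"
  have "\<forall>x\<in>L. \<exists>W \<psi>. good x W \<psi>"
  proof
    fix x assume "x \<in> L"
    then have "x \<in> M" using L(2) by blast
    then show "\<exists>W \<psi>. good x W \<psi>"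
      using st unfolding stein_manifold_def good_def by (elim conjE) (rule bspec)
  qed
  then obtain W \<psi> where "\<forall>x\<in>L. good x (W x) (\<psi> x)" by metis
  then have W: "x \<in> W x" "holomorphic_coordinates M \<A> (W x) (\<psi> x)"
    "(\<lambda>y. \<psi> x y $ i) \<in> holomorphic_functions \<A>" if "x \<in> L" for x i
    using that unfolding good_def by blast+
  have op: "openin (top_of_set M) (W x)" if "x \<in> L" for x
    using W(2)[OF that] by (auto simp: holomorphic_coordinates_def chart_def)
  have "compactin (top_of_set M) L" using L by (simp add: compactin_subtopology)
  then obtain \<F> where "finite \<F>" "\<F> \<subseteq> W ` L" "L \<subseteq> \<Union>\<F>"
    using compactinD[of "top_of_set M" L "W ` L"] op W(1) by blast
  then obtain P where P: "finite P" "P \<subseteq> L" "L \<subseteq> \<Union>(W ` P)" by (metis finite_subset_image)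
  define J where "J = (\<lambda>(x, i) y. \<psi> x y $ i) ` (P \<times> (UNIV :: 'n set))"
  show ?thesis
  proof (rule that[of J])
    show "finite J" using P(1) by (simp add: J_def)
    show "J \<subseteq> holomorphic_functions \<A>" using W(3) P(2) by (auto simp: J_def)
    fix x assume "x \<in> L"
    then obtain z where z: "z \<in> P" "x \<in> W z" using P(3) by blast
    have "(\<lambda>y. \<psi> z y $ i) \<in> J" for i
      unfolding J_def by (rule image_eqI[of _ _ "(z, i)"]) (use z in auto)
    then show "\<exists>W \<psi>. x \<in> W \<and> holomorphic_coordinates M \<A> W \<psi> \<and> (\<forall>i. (\<lambda>y. \<psi> y $ i) \<in> J)"
      using z W(2)[of z] P(2) by blast
  qed
qed

lemma component_openin_manifold:
  assumes "complex_atlas M \<A>" "C \<in> components M"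
  shows "openin (top_of_set M) C"
  by (rule openin_components_locally_connected[OF locally_path_connected_imp_locally_connected[OF
      locally_path_connected_manifold[OF assms(1)]] assms(2)])

lemma component_path_connected:
  assumes A: "complex_atlas M \<A>" and C: "C \<in> components M"
  shows "locally path_connected C" "path_connected C"
proof -
  show lpc: "locally path_connected C"
    by (rule locally_open_subset[OF locally_path_connected_manifold[OF A] component_openin_manifold[OF A C]])
  have "connected C" by (rule in_components_connected[OF C])
  then have "connected_component C x y" if "x \<in> C" "y \<in> C" for x y
    using that by (simp add: connected_iff_connected_component)
  then show "path_connected C"
    unfolding path_connected_component path_component_eq_connected_component[OF lpc] by blast
qed

lemma component_hausdorff_regular:
  fixes \<A> :: "('a::topological_space set \<times> ('a \<Rightarrow> complex ^ 'n)) set"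
  assumes M: "complex_manifold M \<A>" and C: "C \<in> components M"
  shows "Hausdorff_space (top_of_set C)" "regular_space (top_of_set C)"
proof -
  have sub: "top_of_set C = subtopology (top_of_set M) C"
    using in_components_subset[OF C] by (simp add: subtopology_subtopology inf.absorb2)
  show H: "Hausdorff_space (top_of_set C)"
    unfolding sub by (rule Hausdorff_space_subtopology) (use M in \<open>simp add: complex_manifold_def\<close>)
  have "locally_compact_space (top_of_set C)"
    unfolding sub using locally_compact_complex_manifold[OF M] closedin_component[OF C]
    by (rule locally_compact_space_closed_subset)
  then show "regular_space (top_of_set C)" using H by (rule locally_compact_Hausdorff_imp_regular_space)
qed

lemma compact_Int_closedin_top_of_set:
  assumes "compact K" "K \<subseteq> X" "closedin (top_of_set X) S"
  shows "compact (K \<inter> S)"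
proof -
  have "compactin (top_of_set X) (K \<inter> S)"
    by (rule compact_Int_closedin) (use assms in \<open>simp_all add: compactin_subtopology\<close>)
  then show ?thesis by (simp add: compactin_subtopology)
qed

text \<open>
A path outside \<open>K'\<close> runs above \<open>c1\<close>, and pushing it above \<open>c2\<close> takes it off \<open>L\<close>; throughout it stays above
\<open>c0\<close>, hence off \<open>K\<close>. Its ends do not move if they are outside \<open>L'\<close>. As \<open>F\<close> and \<open>c0\<close> are
nonnegative, the level \<open>-1\<close> lies below \<open>c1\<close> and below all values of \<open>F\<close>.
\<close>

definition pushing_function ::
    "'a::topological_space set \<Rightarrow> 'a set \<Rightarrow> 'a set \<Rightarrow> 'a set \<Rightarrow> ('a \<Rightarrow> real) \<Rightarrow> real \<Rightarrow> real \<Rightarrow> real \<Rightarrow> 'a set \<Rightarrow> bool"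
  where "pushing_function C K K' L F c0 c1 c2 L' \<longleftrightarrow>
       continuous_on C F \<and> compact {x \<in> C. F x \<le> c2} \<and>
       0 \<le> c0 \<and> c0 < c1 \<and> c1 \<le> c2 \<and> (\<forall>p\<in>C. F p \<le> c2 \<longrightarrow> ascending_at C F p) \<and> (\<forall>x. F x \<ge> 0) \<and>
       (\<forall>x\<in>K. F x < c0) \<and> (\<forall>x\<in>C - K'. F x > c1) \<and> (\<forall>x\<in>L. F x \<le> c2) \<and>
       compact L' \<and> L' \<subseteq> C \<and> (\<forall>x\<in>C - L'. F x > c2)"

text \<open>
The function is a sum of squares over three families. The coordinates \<open>J0\<close> make it ascending. The family \<open>J1\<close>
peaks off the hull of \<open>K\<close> and separates \<open>K\<close> from the complement of \<open>K'\<close>, by more than \<open>J0\<close> can spoil. The family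
\<open>J2\<close> peaks off the hull of a compact set \<open>L1\<close> that contains \<open>L\<close>, and is so large outside a neighborhood \<open>V1\<close>
of that hull that the sum can be cut off at the constant \<open>c2 + 1\<close>. The result is continuous on all of \<open>C\<close>,
and its sublevel set at \<open>c2\<close> is compact. The set \<open>K'\<close> is found from the hull of \<open>K\<close> before \<open>L\<close> is given.
\<close>

lemma stein_exhaustion:
  fixes \<A> :: "('a::topological_space set \<times> ('a \<Rightarrow> complex ^ 'n)) set"
  assumes st: "stein_manifold M \<A>" and n: "CARD('n) \<ge> 2" and C: "C \<in> components M"
    and U: "neighborhood_system C U" and K: "compact K" "K \<subseteq> C"
  obtains K' where "compact K'" "K' \<subseteq> C"
    "\<forall>L. compact L \<and> L \<subseteq> C \<longrightarrow> (\<exists>F c0 c1 c2 L'. pushing_function C K K' L F c0 c1 c2 L')"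
proof -
  have M: "complex_manifold M \<A>" and hull: "\<And>K. K \<subseteq> M \<Longrightarrow> compact K \<Longrightarrow> compact (holomorphic_hull M \<A> K)"
    using st unfolding stein_manifold_def by blast+
  have A: "complex_atlas M \<A>" using M by (simp add: complex_manifold_def)
  have CM: "C \<subseteq> M" by (rule in_components_subset[OF C])
  have Co: "openin (top_of_set M) C" by (rule component_openin_manifold[OF A C])
  have hC: "compact (holomorphic_hull M \<A> Q \<inter> C)" if "compact Q" "Q \<subseteq> C" for Q
    by (rule compact_Int_closedin_top_of_set[of _ M])
      (use that CM hull closedin_component[OF C] in \<open>auto simp: holomorphic_hull_def\<close>)
  have cptdiff: "compact (L - V)" if "compact L" "L \<subseteq> C" "openin (top_of_set C) V" for L V
  proof -
    have "closedin (top_of_set C) (C - V)"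
      using that(3) openin_imp_subset[OF that(3)] by (simp add: closedin_def double_diff)
    then have "compact (L \<inter> (C - V))" by (rule compact_Int_closedin_top_of_set[OF that(1,2)])
    moreover have "L \<inter> (C - V) = L - V" using that(2) by blast
    ultimately show ?thesis by simp
  qed
  obtain V K' where V: "openin (top_of_set C) V" "holomorphic_hull M \<A> K \<inter> C \<subseteq> V" "V \<subseteq> K'" "compact K'" "K' \<subseteq> C"
    by (rule compact_neighborhood[OF U hC[OF K]]) auto
  show ?thesis
  proof (rule that[OF V(4,5)], intro allI impI, elim conjE)
    fix L assume L: "compact L" "L \<subseteq> C"
    define L1 where "L1 = L \<union> K' \<union> K"
    have L1: "compact L1" "L1 \<subseteq> C" using L V K by (auto simp: L1_def intro!: compact_Un)
    obtain V1 D1 where V1: "openin (top_of_set C) V1" "holomorphic_hull M \<A> L1 \<inter> C \<union> L1 \<subseteq> V1" "V1 \<subseteq> D1"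
      "compact D1" "D1 \<subseteq> C"
      by (rule compact_neighborhood[OF U compact_Un[OF hC[OF L1] L1(1)]]) (use L1 in auto)
    obtain V2 L2 where V2: "openin (top_of_set C) V2" "D1 \<subseteq> V2" "V2 \<subseteq> L2" "compact L2" "L2 \<subseteq> C"
      by (rule compact_neighborhood[OF U V1(4,5)])
    have L2M: "L2 \<subseteq> M" using V2(5) CM by blast
    obtain J0 where J0: "finite J0" "J0 \<subseteq> holomorphic_functions \<A>"
      and coord: "\<And>x. x \<in> L2 \<Longrightarrow> \<exists>W \<psi>. x \<in> W \<and> holomorphic_coordinates M \<A> W \<psi> \<and> (\<forall>i. (\<lambda>y. \<psi> y $ i) \<in> J0)"
      using coordinate_family[OF st V2(4) L2M] by metis
    have cont: "continuous_on S (sum_sq J)" if "J \<subseteq> holomorphic_functions \<A>" "S \<subseteq> C" for J S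
      using continuous_on_subset[OF continuous_on_sum_sq[OF A that(1)]] that(2) CM by blast
    obtain b0 where b0: "b0 \<ge> 0" "\<And>x. x \<in> K \<Longrightarrow> sum_sq J0 x \<le> b0"
      using continuous_bounded_above[OF cont[OF J0(2) K(2)] K(1)] by metis
    obtain J1 where J1: "finite J1" "J1 \<subseteq> holomorphic_functions \<A>"
      "\<And>x. x \<in> K \<Longrightarrow> sum_sq J1 x < 1" "\<And>x. x \<in> L2 - V \<Longrightarrow> sum_sq J1 x > b0 + 3"
    proof (rule peak_family[OF A cptdiff[OF V2(4,5) V(1)], of K 1 "b0 + 3"])
      show "L2 - V \<subseteq> M" using L2M by blast
      show "(L2 - V) \<inter> holomorphic_hull M \<A> K = {}" using V(2) V2(5) by blast
    qed (use that in auto)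
    have J01: "J0 \<union> J1 \<subseteq> holomorphic_functions \<A>" using J0 J1 by blast
    obtain b1 where b1: "b1 \<ge> 0" "\<And>x. x \<in> L1 \<Longrightarrow> sum_sq (J0 \<union> J1) x \<le> b1"
      using continuous_bounded_above[OF cont[OF J01 L1(2)] L1(1)] by metis
    \<comment> \<open>On \<open>L1\<close> the sum is below \<open>b1 + 1\<close>, as \<open>J2\<close> contributes less than 1. On \<open>K\<close> it is below \<open>b0 + 2\<close>, and
      off \<open>K'\<close> above \<open>b0 + 3\<close>; these become the levels \<open>c0\<close> and \<open>c1\<close>.\<close>
    define c2 where "c2 = max (b1 + 1) (b0 + 3)"
    obtain J2 where J2: "finite J2" "J2 \<subseteq> holomorphic_functions \<A>"
      "\<And>x. x \<in> L1 \<Longrightarrow> sum_sq J2 x < 1" "\<And>x. x \<in> L2 - V1 \<Longrightarrow> sum_sq J2 x > c2 + 1"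
    proof (rule peak_family[OF A cptdiff[OF V2(4,5) V1(1)], of L1 1 "c2 + 1"])
      show "L2 - V1 \<subseteq> M" using L2M by blast
      show "(L2 - V1) \<inter> holomorphic_hull M \<A> L1 = {}" using V1(2) V2(5) by blast
    qed (use that in auto)
    define J where "J = (J0 \<union> J1) \<union> J2"
    have J: "finite J" "J \<subseteq> holomorphic_functions \<A>" using J0 J1 J2 by (auto simp: J_def)
    let ?f = "sum_sq J"
    define F where "F x = (if x \<in> V2 then min (?f x) (c2 + 1) else c2 + 1)" for x
    have out: "F x = c2 + 1" if "x \<in> C - V1" for x
    proof (cases "x \<in> V2")
      case True
      then have "sum_sq J2 x > c2 + 1" using J2(4) that V2(3) by blast
      also have "sum_sq J2 x \<le> ?f x" by (rule sum_sq_mono[OF J(1)]) (simp add: J_def)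
      finally show ?thesis using True by (simp add: F_def)
    qed (simp add: F_def)
    have contF: "continuous_on C F"
    proof -
      have Ceq: "C = V2 \<union> (C - D1)" using V2 by blast
      have "closedin (top_of_set C) D1"
        by (rule compactin_imp_closedin[OF component_hausdorff_regular(1)[OF M C]])
          (use V1(4,5) in \<open>simp add: compactin_subtopology\<close>)
      then have "openin (top_of_set C) (C - D1)" by (rule openin_diff[OF openin_subtopology_self])
      moreover have "continuous_on V2 F"
      proof (rule continuous_on_eq)
        show "continuous_on V2 (\<lambda>x. min (?f x) (c2 + 1))"
          by (intro continuous_intros cont[OF J(2)]) (use V2 in blast)
      qed (simp add: F_def)
      moreover have "continuous_on (C - D1) F"
      proof (rule continuous_on_eq[OF continuous_on_const[of _ "c2 + 1"]])
        show "c2 + 1 = F x" if "x \<in> C - D1" for x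
        proof -
          have "x \<in> C - V1" using that V1(3) by blast
          from out[OF this] show ?thesis by simp
        qed
      qed
      ultimately have "continuous_on (V2 \<union> (C - D1)) F"
        using V2(1) Ceq by (intro continuous_on_Un_local_open) auto
      then show ?thesis using Ceq by simp
    qed
    have inV1: "p \<in> V1" "F p = ?f p" "?f p < c2 + 1" if "p \<in> C" "F p \<le> c2" for p
    proof -
      show "p \<in> V1"
      proof (rule ccontr)
        assume "p \<notin> V1"
        then have "F p = c2 + 1" using that(1) by (intro out) blast
        then show False using that(2) by simp
      qed
      then have "p \<in> V2" using V1(3) V2(2) by blast
      then show "F p = ?f p" "?f p < c2 + 1" using that(2) by (auto simp: F_def min_def split: if_splits)
    qed
    have cpt: "compact {x \<in> C. F x \<le> c2}"
    proof -
      have "closedin (top_of_set C) {x \<in> C. F x \<le> c2}"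
        using continuous_closedin_preimage[OF contF, of "{..c2}"] by (simp add: vimage_def Int_def)
      then have "compact (D1 \<inter> {x \<in> C. F x \<le> c2})" by (rule compact_Int_closedin_top_of_set[OF V1(4,5)])
      moreover have "D1 \<inter> {x \<in> C. F x \<le> c2} = {x \<in> C. F x \<le> c2}" using inV1(1) V1(3) by blast
      ultimately show ?thesis by simp
    qed
    have asc: "ascending_at C F p" if p: "p \<in> C" "F p \<le> c2" for p
    proof -
      have pL2: "p \<in> L2" "p \<in> V2" using inV1(1)[OF p] V1(3) V2(2,3) by blast+
      obtain W and \<psi> :: "'a \<Rightarrow> complex ^ 'n" where W: "p \<in> W" "holomorphic_coordinates M \<A> W \<psi>"
        "\<And>i. (\<lambda>y. \<psi> y $ i) \<in> J0" using coord[OF pL2(1)] by blast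
      have "ascending_at M ?f p"
        by (rule ascending_at_sum_sq[OF A n J W(2,1)]) (use W(3) in \<open>simp add: J_def\<close>)
      moreover have "openin (top_of_set C) (V2 \<inter> (V2 \<inter> ?f -` {..<c2 + 1}))"
      proof (rule openin_Int[OF V2(1)])
        have "openin (top_of_set V2) (V2 \<inter> ?f -` {..<c2 + 1})"
          by (rule continuous_openin_preimage_gen[OF cont[OF J(2)]]) (use V2 in auto)
        then show "openin (top_of_set C) (V2 \<inter> ?f -` {..<c2 + 1})" using V2(1) by (rule openin_trans)
      qed
      then have "openin (top_of_set M) (V2 \<inter> ?f -` {..<c2 + 1})"
        using openin_trans[OF _ Co] by (simp only: Int_assoc[symmetric] Int_absorb)
      ultimately show ?thesis
      proof (rule ascending_at_local)
        show "p \<in> V2 \<inter> ?f -` {..<c2 + 1}" using pL2(2) inV1(3)[OF p] by simp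
        show "V2 \<inter> ?f -` {..<c2 + 1} \<subseteq> C" using V2 by blast
      qed (use CM Co in \<open>auto simp: F_def\<close>)
    qed
    have "F x \<le> c2" if "x \<in> L1" for x
    proof -
      have "?f x \<le> sum_sq (J0 \<union> J1) x + sum_sq J2 x"
        unfolding J_def by (rule sum_sq_Un_le) (use J0 J1 J2 in auto)
      then have "?f x \<le> c2" using b1(2)[OF that] J2(3)[OF that] by (simp add: c2_def)
      moreover have "x \<in> V2" using that V1(2,3) V2(2) by blast
      ultimately show ?thesis by (simp add: F_def)
    qed
    then have FL: "\<forall>x\<in>L. F x \<le> c2" by (simp add: L1_def)
    have FK: "\<forall>x\<in>K. F x < b0 + 2"
    proof
      fix x assume x: "x \<in> K"
      have "?f x \<le> sum_sq (J0 \<union> J1) x + sum_sq J2 x"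
        unfolding J_def by (rule sum_sq_Un_le) (use J0 J1 J2 in auto)
      also have "sum_sq (J0 \<union> J1) x \<le> sum_sq J0 x + sum_sq J1 x"
        by (rule sum_sq_Un_le[OF J0(1) J1(1)])
      finally have "?f x < b0 + 2" using b0(2)[OF x] J1(3)[OF x] J2(3)[of x] x by (simp add: L1_def)
      moreover have "x \<in> L1" using x by (simp add: L1_def)
      then have "x \<in> V2" using V1(2,3) V2(2) by blast
      ultimately show "F x < b0 + 2" by (simp add: F_def)
    qed
    have FK': "\<forall>x\<in>C - K'. F x > b0 + 3"
    proof
      fix x assume x: "x \<in> C - K'"
      show "F x > b0 + 3"
      proof (cases "x \<in> V2")
        case True
        then have "x \<in> L2 - V" using x V(3) V2(3) by blast
        then have "sum_sq J1 x > b0 + 3" by (rule J1(4))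
        also have "sum_sq J1 x \<le> ?f x" by (rule sum_sq_mono[OF J(1)]) (auto simp: J_def)
        finally show ?thesis using True by (simp add: F_def c2_def)
      qed (simp add: F_def c2_def)
    qed
    have F0: "\<forall>x. F x \<ge> 0" using sum_sq_nonneg[of J] b0 b1 by (auto simp: F_def c2_def)
    have FL2: "\<forall>x\<in>C - L2. F x > c2" using V2(3) by (auto simp: F_def)
    show "\<exists>F c0 c1 c2 L'. pushing_function C K K' L F c0 c1 c2 L'"
      unfolding pushing_function_def
      by (rule exI[of _ F], rule exI[of _ "b0 + 2"], rule exI[of _ "b0 + 3"], rule exI[of _ c2], rule exI[of _ L2])
        (use contF cpt asc b0(1) F0 FK FK' FL V2(4,5) FL2 in \<open>simp add: c2_def\<close>)
  qed
qed

section \<open>Pushing paths to infinity\<close>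

text \<open>
For the first property, push a path between the two points from level \<open>-1\<close>, below all values of \<open>F\<close>, to \<open>c1\<close>;
for the second, push from \<open>c1\<close> to \<open>c2\<close>. If \<open>C - L\<close> were empty, \<open>F\<close> would attain its maximum on the compact
set \<open>C\<close> at a level where it is ascending.
\<close>

lemma stein_push:
  fixes \<A> :: "('a::topological_space set \<times> ('a \<Rightarrow> complex ^ 'n)) set"
  assumes st: "stein_manifold M \<A>" and n: "CARD('n) \<ge> 2" and C: "C \<in> components M"
    and U: "neighborhood_system C U" and K: "compact K" "K \<subseteq> C"
  obtains K' where "compact K'" "K' \<subseteq> C"
    "\<forall>x\<in>C - K'. \<forall>y\<in>C - K'. path_component (C - K) x y"
    "\<forall>L. compact L \<and> L \<subseteq> C \<longrightarrow> (\<exists>L'. compact L' \<and> L' \<subseteq> C \<and>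
       (\<forall>\<sigma>. path \<sigma> \<and> path_image \<sigma> \<subseteq> C - K' \<and> pathstart \<sigma> \<in> C - L' \<and> pathfinish \<sigma> \<in> C - L' \<longrightarrow>
          (\<exists>\<tau>. path \<tau> \<and> path_image \<tau> \<subseteq> C - L \<and> homotopic_paths (C - K) \<sigma> \<tau>)))"
    "\<forall>L. compact L \<and> L \<subseteq> C \<longrightarrow> C - L \<noteq> {}"
proof -
  have M: "complex_manifold M \<A>" using st unfolding stein_manifold_def by blast
  have A: "complex_atlas M \<A>" using M by (simp add: complex_manifold_def)
  note reg = component_hausdorff_regular(2)[OF M C] and pc = component_path_connected[OF A C]
  obtain K' where K': "compact K'" "K' \<subseteq> C"
    and fam: "\<forall>L. compact L \<and> L \<subseteq> C \<longrightarrow> (\<exists>F c0 c1 c2 L'. pushing_function C K K' L F c0 c1 c2 L')"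
    by (rule stein_exhaustion[OF st n C U K])
  show ?thesis
  proof (rule that[OF K'])
    show "\<forall>x\<in>C - K'. \<forall>y\<in>C - K'. path_component (C - K) x y"
    proof (intro ballI)
      fix x y assume x: "x \<in> C - K'" and y: "y \<in> C - K'"
      obtain F c0 c1 c2 L' where "pushing_function C K K' {} F c0 c1 c2 L'" using fam[rule_format, of "{}"] by auto
      then have F: "continuous_on C F" "compact {x \<in> C. F x \<le> c2}" "c0 < c1" "c1 \<le> c2"
        "\<forall>p\<in>C. F p \<le> c2 \<longrightarrow> ascending_at C F p" "\<forall>x. F x \<ge> 0"
        "\<forall>x\<in>K. F x < c0" "\<forall>x\<in>C - K'. F x > c1" "0 \<le> c0"
        unfolding pushing_function_def by blast+
      have cl: "closedin (top_of_set C) {x \<in> C. F x \<le> c1}"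
        using continuous_closedin_preimage[OF F(1), of "{..c1}"] by (simp add: vimage_def Int_def)
      have "compact ({x \<in> C. F x \<le> c2} \<inter> {x \<in> C. F x \<le> c1})"
        by (rule compact_Int_closedin_top_of_set[OF F(2) _ cl]) auto
      moreover have "{x \<in> C. F x \<le> c2} \<inter> {x \<in> C. F x \<le> c1} = {x \<in> C. F x \<le> c1}" using F(4) by auto
      ultimately have cpt: "compact {x \<in> C. F x \<le> c1}" by simp
      obtain \<sigma> where \<sigma>: "path \<sigma>" "path_image \<sigma> \<subseteq> C" "pathstart \<sigma> = x" "pathfinish \<sigma> = y"
        using pc(2) x y unfolding path_connected_def by blast
      have all: "superlevel C F (-1) = C" using F(6) by (auto intro: less_le_trans[of "-1" 0])
      obtain \<tau> where \<tau>: "path \<tau>" "path_image \<tau> \<subseteq> superlevel C F c1"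
        "homotopic_paths (superlevel C F (-2)) \<sigma> \<tau>"
      proof (rule push_paths_upwards[OF reg pc(1) F(1) cpt])
        show "path_image \<sigma> \<subseteq> superlevel C F (-1)" unfolding all by (rule \<sigma>(2))
        show "ascending_at C F p" if "p \<in> C" "F p \<le> c1" for p using F(4,5) that by auto
        show "F (pathstart \<sigma>) > c1" "F (pathfinish \<sigma>) > c1" using F(8) \<sigma> x y by auto
        show "- 2 < (- 1 :: real)" "- 1 \<le> c1" using F(3,9) by auto
      qed (rule \<sigma>(1))
      have "pathstart \<tau> = x" "pathfinish \<tau> = y"
        using homotopic_paths_imp_pathstart[OF \<tau>(3)] homotopic_paths_imp_pathfinish[OF \<tau>(3)] \<sigma> by auto
      moreover have "superlevel C F c1 \<subseteq> C - K" using F(3,7) by force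
      ultimately show "path_component (C - K) x y"
        using \<tau>(1,2) unfolding path_component_def by blast
    qed
  next
    show "\<forall>L. compact L \<and> L \<subseteq> C \<longrightarrow> (\<exists>L'. compact L' \<and> L' \<subseteq> C \<and>
       (\<forall>\<sigma>. path \<sigma> \<and> path_image \<sigma> \<subseteq> C - K' \<and> pathstart \<sigma> \<in> C - L' \<and> pathfinish \<sigma> \<in> C - L' \<longrightarrow>
          (\<exists>\<tau>. path \<tau> \<and> path_image \<tau> \<subseteq> C - L \<and> homotopic_paths (C - K) \<sigma> \<tau>)))"
    proof (intro allI impI, goal_cases)
      case (1 L)
      then obtain F c0 c1 c2 L' where "pushing_function C K K' L F c0 c1 c2 L'" using fam[rule_format, of L] by auto
      then have F: "continuous_on C F" "compact {x \<in> C. F x \<le> c2}" "c0 < c1" "c1 \<le> c2"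
        "\<forall>p\<in>C. F p \<le> c2 \<longrightarrow> ascending_at C F p"
        "\<forall>x\<in>K. F x < c0" "\<forall>x\<in>C - K'. F x > c1" "\<forall>x\<in>L. F x \<le> c2" "compact L'" "L' \<subseteq> C" "\<forall>x\<in>C - L'. F x > c2"
        unfolding pushing_function_def by blast+
      have sub: "superlevel C F c2 \<subseteq> C - L" "superlevel C F c0 \<subseteq> C - K" "C - K' \<subseteq> superlevel C F c1"
        using F(6,7,8) by force+
      have "\<exists>\<tau>. path \<tau> \<and> path_image \<tau> \<subseteq> C - L \<and> homotopic_paths (C - K) \<sigma> \<tau>"
        if \<sigma>: "path \<sigma>" "path_image \<sigma> \<subseteq> C - K'" "pathstart \<sigma> \<in> C - L'" "pathfinish \<sigma> \<in> C - L'" for \<sigma>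
      proof -
        obtain \<tau> where \<tau>: "path \<tau>" "path_image \<tau> \<subseteq> superlevel C F c2"
          "homotopic_paths (superlevel C F c0) \<sigma> \<tau>"
        proof (rule push_paths_upwards[OF reg pc(1) F(1) F(2) F(3) F(4)])
          show "path_image \<sigma> \<subseteq> superlevel C F c1" using \<sigma>(2) sub(3) by blast
          show "F (pathstart \<sigma>) > c2" "F (pathfinish \<sigma>) > c2" using F(11) \<sigma>(3,4) by auto
        qed (use F(5) \<sigma>(1) in auto)
        then show ?thesis using sub homotopic_paths_subset[OF \<tau>(3) sub(2)] by blast
      qed
      then show ?case
        using F(9,10) by (intro exI[of _ L']) simp
    qed
    show "\<forall>L. compact L \<and> L \<subseteq> C \<longrightarrow> C - L \<noteq> {}"
    proof (intro allI impI notI)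
      fix L assume L: "compact L \<and> L \<subseteq> C" and "C - L = {}"
      then have CL: "C = L" by blast
      obtain F c0 c1 c2 L' where "pushing_function C K K' L F c0 c1 c2 L'" using fam[rule_format, of L] L by auto
      then have F: "continuous_on C F" "\<forall>p\<in>C. F p \<le> c2 \<longrightarrow> ascending_at C F p" "\<forall>x\<in>L. F x \<le> c2"
        unfolding pushing_function_def by blast+
      have "C \<noteq> {}" by (rule in_components_nonempty[OF C])
      then obtain p where p: "p \<in> C" "\<forall>x\<in>C. F x \<le> F p"
        using continuous_attains_sup[of C F] F(1) L CL by auto
      then have "ascending_at C F p" using F(2,3) CL by simp
      then have "\<exists>x\<in>C. F x > F p"
        unfolding ascending_at_def using openin_subtopology_self p(1) by blast
      then show False using p(2) by force
    qed
  qed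
qed

section \<open>Composite bonding maps as conjugations\<close>

lemma homotopic_conj_cancel:
  fixes a q :: "real \<Rightarrow> 'a::topological_space"
  assumes a: "path a" "path_image a \<subseteq> X" and q: "path q" "path_image q \<subseteq> X" "pathstart q = pathstart a" "pathfinish q = pathstart a"
  shows "homotopic_paths X (a +++ ((reversepath a +++ (q +++ a)) +++ reversepath a)) q"
proof -
  let ?r = "reversepath a"
  note [simp] = a q
  note [trans] = homotopic_paths_trans
  have im [simp]: "path_image (f +++ g) \<subseteq> X"
    if "path_image f \<subseteq> X" "path_image g \<subseteq> X" for f g :: "real \<Rightarrow> 'a"
    using that by (rule subset_path_image_join)
  have "homotopic_paths X (a +++ ((?r +++ (q +++ a)) +++ ?r)) (a +++ (?r +++ ((q +++ a) +++ ?r)))"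
    by (rule homotopic_paths_join, simp, rule homotopic_paths_sym, rule homotopic_paths_assoc) simp_all
  also have "homotopic_paths X \<dots> ((a +++ ?r) +++ ((q +++ a) +++ ?r))"
    by (rule homotopic_paths_assoc) simp_all
  also have "homotopic_paths X \<dots> ((\<lambda>_. pathstart a) +++ ((q +++ a) +++ ?r))"
    by (rule homotopic_paths_join, rule homotopic_paths_reverse_right) simp_all
  also have "homotopic_paths X \<dots> ((q +++ a) +++ ?r)"
    by (rule homotopic_paths_const_left) simp_all
  also have "homotopic_paths X \<dots> (q +++ (a +++ ?r))"
    by (rule homotopic_paths_sym, rule homotopic_paths_assoc) simp_all
  also have "homotopic_paths X \<dots> (q +++ (\<lambda>_. pathstart a))"
    by (rule homotopic_paths_join, simp, rule homotopic_paths_reverse_right) simp_all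
  also have "homotopic_paths X \<dots> q"
    by (rule homotopic_paths_const_right) simp_all
  finally show ?thesis .
qed

lemma homotopic_conj_assoc:
  fixes a b p :: "real \<Rightarrow> 'a::topological_space"
  assumes a: "path a" "path_image a \<subseteq> X" and b: "path b" "path_image b \<subseteq> X" "pathstart b = pathfinish a"
    and p: "path p" "path_image p \<subseteq> X" "pathstart p = pathfinish b" "pathfinish p = pathfinish b"
  shows "homotopic_paths X (a +++ ((b +++ (p +++ reversepath b)) +++ reversepath a))
           ((a +++ b) +++ (p +++ reversepath (a +++ b)))"
proof -
  let ?ra = "reversepath a" and ?rb = "reversepath b"
  note [simp] = a b p
  note [trans] = homotopic_paths_trans
  have im [simp]: "path_image (f +++ g) \<subseteq> X"
    if "path_image f \<subseteq> X" "path_image g \<subseteq> X" for f g :: "real \<Rightarrow> 'a"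
    using that by (rule subset_path_image_join)
  have "homotopic_paths X (a +++ ((b +++ (p +++ ?rb)) +++ ?ra)) (a +++ (b +++ ((p +++ ?rb) +++ ?ra)))"
    by (rule homotopic_paths_join, simp, rule homotopic_paths_sym, rule homotopic_paths_assoc) simp_all
  also have "homotopic_paths X \<dots> ((a +++ b) +++ ((p +++ ?rb) +++ ?ra))"
    by (rule homotopic_paths_assoc) simp_all
  also have "homotopic_paths X \<dots> ((a +++ b) +++ (p +++ (?rb +++ ?ra)))"
    by (rule homotopic_paths_join, simp, rule homotopic_paths_sym, rule homotopic_paths_assoc) simp_all
  finally show ?thesis by (simp add: reversepath_joinpaths)
qed

text \<open>
The ray from \<open>\<gamma> i\<close> to \<open>\<gamma> (i + m)\<close>, concatenated from segments in the way in which \<open>bond_comp\<close> composes the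
bonding maps.
\<close>

primrec ray_path :: "(real \<Rightarrow> 'a::topological_space) \<Rightarrow> nat \<Rightarrow> nat \<Rightarrow> real \<Rightarrow> 'a" where
  "ray_path \<gamma> i 0 = (\<lambda>_. \<gamma> (real i))"
| "ray_path \<gamma> i (Suc m) = ray_path \<gamma> i m +++ ray_segment \<gamma> (i + m)"

lemma ray_segment_path:
  fixes U :: "nat \<Rightarrow> 'a::topological_space set"
  assumes cont: "continuous_on {0..} \<gamma>" and sub: "\<And>i. \<gamma> ` {real i..} \<subseteq> U i"
  shows "path (ray_segment \<gamma> i)" "path_image (ray_segment \<gamma> i) \<subseteq> U i"
    "pathstart (ray_segment \<gamma> i) = \<gamma> (real i)" "pathfinish (ray_segment \<gamma> i) = \<gamma> (real (Suc i))"
proof -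
  show "path (ray_segment \<gamma> i)"
    unfolding path_def ray_segment_def
    by (rule continuous_on_compose2[OF cont]) (auto intro!: continuous_intros)
  show "path_image (ray_segment \<gamma> i) \<subseteq> U i"
    using sub[of i] by (auto simp: path_image_def ray_segment_def)
qed (simp_all add: pathstart_def pathfinish_def ray_segment_def add.commute)

lemma ray_path_path:
  fixes U :: "nat \<Rightarrow> 'a::topological_space set"
  assumes U: "neighborhood_system C U"
    and cont: "continuous_on {0..} \<gamma>" and sub: "\<And>i. \<gamma> ` {real i..} \<subseteq> U i"
  shows "path (ray_path \<gamma> i m) \<and> path_image (ray_path \<gamma> i m) \<subseteq> U i \<and>
    pathstart (ray_path \<gamma> i m) = \<gamma> (real i) \<and> pathfinish (ray_path \<gamma> i m) = \<gamma> (real (i + m))"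
proof (induction m)
  case 0
  have "\<gamma> (real i) \<in> U i" using sub[of i] by auto
  then show ?case by (simp add: path_const)
next
  case (Suc m)
  have "U (i + m) \<subseteq> U i" by (rule neighborhood_system_decreasing[OF U]) simp
  then show ?case
    using Suc ray_segment_path[OF cont sub, of "i + m"]
    by (auto simp: path_image_join)
qed

lemma bond_comp_path_class:
  fixes U :: "nat \<Rightarrow> 'a::topological_space set"
  assumes U: "neighborhood_system C U"
    and cont: "continuous_on {0..} \<gamma>" and sub: "\<And>i. \<gamma> ` {real i..} \<subseteq> U i"
    and p: "p \<in> loops (U (i + m)) (\<gamma> (real (i + m)))"
  shows "bond_comp (progroup_bond U \<gamma>) i m (path_class (U (i + m)) p) =
    path_class (U i) (ray_path \<gamma> i m +++ (p +++ reversepath (ray_path \<gamma> i m)))"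
  using p
proof (induction m arbitrary: p)
  case 0
  note [trans] = homotopic_paths_trans
  let ?c = "\<lambda>_::real. \<gamma> (real i)"
  have p: "path p" "path_image p \<subseteq> U i" "pathstart p = \<gamma> (real i)" "pathfinish p = \<gamma> (real i)"
    using 0 by (auto simp: loops_def)
  have in_U: "\<gamma> (real i) \<in> U i" using sub[of i] by auto
  have rc: "reversepath ?c = ?c" by (simp add: reversepath_def)
  have 1: "homotopic_paths (U i) (p +++ ?c) p"
    by (rule homotopic_paths_const_right) (use p in simp_all)
  have "homotopic_paths (U i) (?c +++ (p +++ ?c)) (?c +++ p)"
    by (rule homotopic_paths_join[OF _ 1]) (use in_U p in \<open>simp_all add: path_const\<close>)
  also have "homotopic_paths (U i) (?c +++ p) p"
    by (rule homotopic_paths_const_left) (use p in simp_all)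
  finally have "path_class (U i) (?c +++ (p +++ ?c)) = path_class (U i) p"
    by (rule path_class_eqI)
  then show ?case by (simp add: rc)
next
  case (Suc m)
  let ?s = "ray_segment \<gamma> (i + m)" and ?S = "ray_path \<gamma> i m"
  note s = ray_segment_path[OF cont sub, of "i + m"]
  have S: "path ?S" "path_image ?S \<subseteq> U i" "pathstart ?S = \<gamma> (real i)" "pathfinish ?S = \<gamma> (real (i + m))"
    using ray_path_path[OF U cont sub, of i m] by blast+
  have dec: "U (Suc (i + m)) \<subseteq> U (i + m)" "U (i + m) \<subseteq> U i"
    by (rule neighborhood_system_decreasing[OF U], simp)+
  have pl: "p \<in> loops (U (Suc (i + m))) (pathfinish ?s)" using Suc.prems s(4) by simp
  then have p: "path p" "path_image p \<subseteq> U (Suc (i + m))" "pathstart p = pathfinish ?s" "pathfinish p = pathfinish ?s"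
    by (auto simp: loops_def)
  have "progroup_bond U \<gamma> (i + m) (path_class (U (Suc (i + m))) p) =
      path_class (U (i + m)) (?s +++ (p +++ reversepath ?s))"
    unfolding progroup_bond_def by (rule transport_path_class[OF s(1,2) pl dec(1)])
  moreover have "?s +++ (p +++ reversepath ?s) \<in> loops (U (i + m)) (\<gamma> (real (i + m)))"
    using p s dec by (auto simp: loops_def path_image_join)
  ultimately have "bond_comp (progroup_bond U \<gamma>) i (Suc m) (path_class (U (i + Suc m)) p) =
      path_class (U i) (?S +++ ((?s +++ (p +++ reversepath ?s)) +++ reversepath ?S))"
    using Suc.IH by simp
  also have "\<dots> = path_class (U i) ((?S +++ ?s) +++ (p +++ reversepath (?S +++ ?s)))"
  proof (rule path_class_eqI, rule homotopic_conj_assoc)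
    show "path_image ?s \<subseteq> U i" "path_image p \<subseteq> U i" using s(2) p(2) dec by blast+
  qed (use S s p in simp_all)
  finally show ?case by simp
qed

lemma bond_comp_add: "bond_comp f i (m + k) = bond_comp f i m \<circ> bond_comp f (i + m) k"
  by (induction k) (simp_all add: add.assoc comp_assoc)

lemma bond_comp_carrier:
  assumes "inverse_sequence G f" "x \<in> carrier (G (i + m))"
  shows "bond_comp f i m x \<in> carrier (G i)"
  using assms(2)
proof (induction m arbitrary: x)
  case (Suc m)
  have "f (i + m) \<in> hom (G (Suc (i + m))) (G (i + m))" using assms(1) by (simp add: inverse_sequence_def)
  then have "f (i + m) x \<in> carrier (G (i + m))" using Suc.prems by (simp add: hom_in_carrier)
  then show ?case using Suc.IH by simp
qed simp

section \<open>The unique end and its rays\<close>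

lemma continuous_on_half_line_glue:
  fixes p :: "nat \<Rightarrow> real \<Rightarrow> 'a::topological_space"
  assumes path: "\<And>i. path (p i)" and join: "\<And>i. pathfinish (p i) = pathstart (p (Suc i))"
    and \<gamma>: "\<And>i t. t \<in> {real i..<real (Suc i)} \<Longrightarrow> \<gamma> t = p i (t - real i)"
  shows "continuous_on {0..} \<gamma>"
proof -
  have seg: "\<gamma> t = p i (t - real i)" if "t \<in> {real i..real (Suc i)}" for i t
  proof (cases "t = real (Suc i)")
    case True
    then have "\<gamma> t = p (Suc i) 0" using \<gamma>[of t "Suc i"] by simp
    also have "\<dots> = p i 1" using join[of i] by (simp add: pathstart_def pathfinish_def)
    finally show ?thesis using True by simp
  qed (use that \<gamma> in auto)
  have piece: "continuous_on {real i..real (Suc i)} \<gamma>" for i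
  proof -
    have "continuous_on {real i..real (Suc i)} (\<lambda>t. p i (t - real i))"
      by (rule continuous_on_compose2[OF path[of i, unfolded path_def]])
        (auto intro!: continuous_intros)
    then show ?thesis by (rule continuous_on_eq) (rule seg[symmetric])
  qed
  have upto: "continuous_on {0..real n} \<gamma>" for n
  proof (induction n)
    case (Suc n)
    have "{0..real (Suc n)} = {0..real n} \<union> {real n..real (Suc n)}" by auto
    then show ?case using continuous_on_closed_Un[OF _ _ Suc piece[of n]] by simp
  qed simp
  show ?thesis
    unfolding continuous_on_eq_continuous_within
  proof
    fix t :: real assume t: "t \<in> {0..}"
    obtain n :: nat where n: "t < real n" using reals_Archimedean2 by blast
    have "at t within {0..} = at t within {0..real n}"
      by (rule at_within_nhd[of t "{..<real n}"]) (use n in auto)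
    moreover have "continuous (at t within {0..real n}) \<gamma>"
      using upto[of n] t n by (simp add: continuous_on_eq_continuous_within)
    ultimately show "continuous (at t within {0..}) \<gamma>" by simp
  qed
qed

text \<open>
Points \<open>x i\<close> chosen deep enough can be joined to \<open>x (Suc i)\<close> in \<open>U i\<close>, and the paths are concatenated. The ray
is proper because every compact set is disjoint from some \<open>U i\<close>.
\<close>

lemma ray_exists:
  fixes U :: "nat \<Rightarrow> 'a::topological_space set"
  assumes haus: "Hausdorff_space (top_of_set C)" and U: "neighborhood_system C U"
    and J: "\<And>i x y. x \<in> U (J i) \<Longrightarrow> y \<in> U (J i) \<Longrightarrow> path_component (U i) x y"
    and ne: "\<And>i. U i \<noteq> {}"
  obtains \<gamma> where "singular_ray C \<gamma>" "\<forall>i. \<gamma> ` {real i..} \<subseteq> U i"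
proof -
  \<comment> \<open>A bound for \<open>J 0, \<dots>, J i\<close>: both \<open>x i\<close> and \<open>x (Suc i)\<close> have to lie in \<open>U (J i)\<close>.\<close>
  define m where "m i = (\<Sum>k\<le>i. J k)" for i
  have m: "J k \<le> m i" if "k \<le> i" for i k
    unfolding m_def by (rule member_le_sum) (use that in auto)
  have "\<forall>i. \<exists>x. x \<in> U (m i)" using ne by blast
  then obtain x where x: "\<And>i. x i \<in> U (m i)" by metis
  have xJ: "x i \<in> U (J k)" if "k \<le> i" for i k
    using x[of i] neighborhood_system_decreasing[OF U m[OF that]] by blast
  have "\<exists>p. path p \<and> path_image p \<subseteq> U i \<and> pathstart p = x i \<and> pathfinish p = x (Suc i)" for i
    using J[OF xJ[of i i] xJ[of i "Suc i"]] unfolding path_component_def by simp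
  then obtain p where p: "\<And>i. path (p i)" "\<And>i. path_image (p i) \<subseteq> U i" "\<And>i. pathstart (p i) = x i"
    "\<And>i. pathfinish (p i) = x (Suc i)" by metis
  define \<gamma> where "\<gamma> t = p (nat \<lfloor>t\<rfloor>) (t - real (nat \<lfloor>t\<rfloor>))" for t :: real
  have \<gamma>: "\<gamma> t = p i (t - real i)" if "t \<in> {real i..<real (Suc i)}" for i t
  proof -
    have "\<lfloor>t\<rfloor> = int i" using that by (intro floor_unique) auto
    then show ?thesis by (simp add: \<gamma>_def)
  qed
  have cont: "continuous_on {0..} \<gamma>"
    by (rule continuous_on_half_line_glue[of p]) (use p \<gamma> in auto)
  have sub: "\<gamma> ` {real i..} \<subseteq> U i" for i
  proof
    fix y assume "y \<in> \<gamma> ` {real i..}"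
    then obtain t where t: "t \<ge> real i" "y = \<gamma> t" by auto
    define k where "k = nat \<lfloor>t\<rfloor>"
    have k: "real k \<le> t" "t < real (Suc k)" "i \<le> k" using t(1) by (auto simp: k_def le_nat_floor) linarith+
    have "y = p k (t - real k)" using \<gamma>[of t k] k t(2) by simp
    also have "\<dots> \<in> path_image (p k)" using k by (auto simp: path_image_def)
    finally show "y \<in> U i" using p(2)[of k] neighborhood_system_decreasing[OF U k(3)] by blast
  qed
  have im: "\<gamma> ` {0..} \<subseteq> C" using sub[of 0] neighborhood_system_complement(2)[OF U, of 0] by simp
  have "compact {t \<in> {0..}. \<gamma> t \<in> K}" if K: "K \<subseteq> C" "compact K" for K
  proof -
    obtain i where i: "K \<subseteq> C - U i" by (rule compact_subset_exhausted[OF U K(2,1)])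
    have "{t \<in> {0..}. \<gamma> t \<in> K} = {0..real i} \<inter> \<gamma> -` K"
    proof (intro equalityI subsetI)
      fix t assume t: "t \<in> {t \<in> {0..}. \<gamma> t \<in> K}"
      have "\<not> t \<ge> real i"
      proof
        assume "t \<ge> real i"
        then have "\<gamma> t \<in> U i" using sub[of i] by auto
        then show False using t i by blast
      qed
      then show "t \<in> {0..real i} \<inter> \<gamma> -` K" using t by auto
    qed auto
    moreover have "closedin (top_of_set C) K"
      by (rule compactin_imp_closedin[OF haus]) (use K in \<open>simp add: compactin_subtopology\<close>)
    then have "closedin (top_of_set {0..real i}) ({0..real i} \<inter> \<gamma> -` K)"
      by (rule continuous_closedin_preimage_gen[OF continuous_on_subset[OF cont], rotated -1])
        (use im in auto)
    then have "compact ({0..real i} \<inter> \<gamma> -` K)"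
      by (rule closedin_compact[OF compact_Icc])
    ultimately show ?thesis by simp
  qed
  then have "singular_ray C \<gamma>" using cont im by (simp add: singular_ray_def)
  then show ?thesis using sub by (intro that allI)
qed

text \<open>
The members of an end at index \<open>i\<close> contain points of arbitrarily deep \<open>U k\<close>, hence of \<open>U (J i)\<close>, which lies in a
single path component of \<open>U i\<close>.
\<close>

lemma ends_singleton:
  fixes U :: "nat \<Rightarrow> 'a::topological_space set"
  assumes U: "neighborhood_system C U"
    and J: "\<And>i x y. x \<in> U (J i) \<Longrightarrow> y \<in> U (J i) \<Longrightarrow> path_component (U i) x y"
    and ne: "\<And>i. U i \<noteq> {}"
  obtains e where "ends U = {e}" "\<forall>i. U (J i) \<subseteq> e i"
proof -
  have "\<forall>i. \<exists>x. x \<in> U (J i)" using ne by blast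
  then obtain x where x: "\<And>i. x i \<in> U (J i)" by metis
  define e where "e i = path_component_set (U i) (x i)" for i
  have sub: "U (J i) \<subseteq> e i" for i using J[OF x[of i]] by (auto simp: e_def)
  have xU: "x i \<in> U i" for i
    using J[OF x[of i] x[of i]] path_component_mem(1) by fast
  have eI: "path_component_set (U i) y = e i" if "y \<in> e i" for i y
    using path_component_eq[of y "U i" "x i"] that by (simp add: e_def)
  have "e (Suc i) \<subseteq> e i" for i
  proof
    fix y assume y: "y \<in> e (Suc i)"
    define k where "k = max (J i) (J (Suc i))"
    obtain z where z: "z \<in> U k" using ne by blast
    have "U k \<subseteq> U (J i)" "U k \<subseteq> U (J (Suc i))"
      by (rule neighborhood_system_decreasing[OF U], simp add: k_def)+
    then have zJ: "z \<in> e i" "z \<in> e (Suc i)" using z sub by blast+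
    have "U (Suc i) \<subseteq> U i" by (rule neighborhood_system_decreasing[OF U]) simp
    moreover have "path_component (U (Suc i)) z y" using eI[OF zJ(2)] y by blast
    ultimately have "path_component (U i) z y" by (rule path_component_of_subset)
    then show "y \<in> e i" using eI[OF zJ(1)] by blast
  qed
  moreover have "e i \<in> pi0 (U i)" for i using xU by (auto simp: pi0_def e_def)
  ultimately have "e \<in> ends U" by (simp add: ends_def)
  moreover have "e' = e" if e': "e' \<in> ends U" for e'
  proof
    fix i
    have pi: "e' k \<in> pi0 (U k)" and dec: "e' (Suc k) \<subseteq> e' k" for k using e' by (auto simp: ends_def)
    have refl: "\<exists>w\<in>U k. w \<in> e' k \<and> e' k = path_component_set (U k) w" for k
    proof -
      obtain w where "w \<in> U k" "e' k = path_component_set (U k) w" using pi[of k] by (auto simp: pi0_def)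
      then show ?thesis by (intro bexI[of _ w]) (simp_all add: path_component_refl)
    qed
    define j where "j = max i (J i)"
    have "e' j \<subseteq> e' i" using lift_Suc_antimono_le[of e' i j] dec by (simp add: j_def)
    moreover obtain w where w: "w \<in> U j" "w \<in> e' j" using refl by blast
    moreover have "U j \<subseteq> U (J i)" by (rule neighborhood_system_decreasing[OF U]) (simp add: j_def)
    ultimately have "w \<in> e' i" "w \<in> e i" using sub[of i] by blast+
    moreover obtain v where "e' i = path_component_set (U i) v" using refl[of i] by blast
    ultimately show "e' i = e i" using eI[of w i] path_component_eq[of w "U i" v] by simp
  qed
  ultimately have "ends U = {e}" by blast
  then show ?thesis using sub by (intro that allI)
qed

section \<open>The Mittag-Leffler property\<close>

text \<open>
Let \<open>p\<close> be a loop at \<open>\<gamma> j\<close>. Carried along the ray to a far point \<open>\<gamma> l\<close>, it is a loop \<open>\<sigma>\<close> in \<open>U j\<close> with ends in \<open>U l\<close>,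
and the hypothesis deforms it within \<open>U i\<close> to a loop \<open>\<tau>\<close> in \<open>U k\<close>. Carried back to \<open>\<gamma> k\<close>, this gives a loop
\<open>q\<close> in \<open>U k\<close> whose image in the group of index \<open>i\<close> is that of \<open>p\<close>. So the images of the groups of index
\<open>j\<close> and \<open>k\<close> agree.
\<close>

lemma mittag_leffler_ray:
  fixes U :: "nat \<Rightarrow> 'a::topological_space set"
  assumes U: "neighborhood_system C U" and \<gamma>: "ray_for_end C U e \<gamma>"
    and push: "\<And>i. \<exists>j. \<forall>k. \<exists>l. \<forall>\<sigma>. path \<sigma> \<and> path_image \<sigma> \<subseteq> U j \<and> pathstart \<sigma> \<in> U l \<and> pathfinish \<sigma> \<in> U l \<longrightarrow>
       (\<exists>\<tau>. path \<tau> \<and> path_image \<tau> \<subseteq> U k \<and> homotopic_paths (U i) \<sigma> \<tau>)"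
  shows "mittag_leffler (progroup_group U \<gamma>) (progroup_bond U \<gamma>)"
proof -
  note [trans] = homotopic_paths_trans
  let ?G = "progroup_group U \<gamma>" and ?f = "progroup_bond U \<gamma>"
  have inv: "inverse_sequence ?G ?f" by (rule inverse_sequence_progroup[OF U \<gamma>])
  have sub: "\<gamma> ` {real i..} \<subseteq> U i" and cont: "continuous_on {0..} \<gamma>" for i
    using \<gamma> by (auto simp: ray_for_end_def singular_ray_def)
  note dec = neighborhood_system_decreasing[OF U]
  have carr: "carrier (?G k) = path_class (U k) ` loops (U k) (\<gamma> (real k))" for k
    by (simp add: progroup_group_def fundamental_group_def)
  have ray: "path (ray_path \<gamma> i m)" "path_image (ray_path \<gamma> i m) \<subseteq> U i" "pathstart (ray_path \<gamma> i m) = \<gamma> (real i)"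
    "pathfinish (ray_path \<gamma> i m) = \<gamma> (real (i + m))" for i m
    using ray_path_path[OF U cont sub, of i m] by blast+
  have "\<exists>j\<ge>i. \<forall>k\<ge>j. bond_comp ?f i (k - i) ` carrier (?G k) = bond_comp ?f i (j - i) ` carrier (?G j)" for i
  proof -
    obtain j0 where j0: "\<forall>k. \<exists>l. \<forall>\<sigma>. path \<sigma> \<and> path_image \<sigma> \<subseteq> U j0 \<and> pathstart \<sigma> \<in> U l \<and> pathfinish \<sigma> \<in> U l \<longrightarrow>
       (\<exists>\<tau>. path \<tau> \<and> path_image \<tau> \<subseteq> U k \<and> homotopic_paths (U i) \<sigma> \<tau>)"
      using push[of i] by (rule exE)
    define j where "j = max i j0"
    have ij: "i \<le> j" and Uj: "U j \<subseteq> U j0" "U j \<subseteq> U i" by (simp add: j_def, (rule dec, simp add: j_def)+)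
    have "bond_comp ?f i (k - i) ` carrier (?G k) = bond_comp ?f i (j - i) ` carrier (?G j)" if jk: "j \<le> k" for k
    proof -
      have split: "bond_comp ?f i (k - i) = bond_comp ?f i (j - i) \<circ> bond_comp ?f j (k - j)"
        using bond_comp_add[of ?f i "j - i" "k - j"] ij jk by simp
      show ?thesis
      proof (intro equalityI subsetI)
        fix y assume "y \<in> bond_comp ?f i (k - i) ` carrier (?G k)"
        then obtain a where a: "a \<in> carrier (?G k)" "y = bond_comp ?f i (j - i) (bond_comp ?f j (k - j) a)"
          by (auto simp: split)
        have "bond_comp ?f j (k - j) a \<in> carrier (?G j)"
          by (rule bond_comp_carrier[OF inv]) (use a(1) jk in simp)
        then show "y \<in> bond_comp ?f i (j - i) ` carrier (?G j)" using a(2) by blast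
      next
        fix y assume "y \<in> bond_comp ?f i (j - i) ` carrier (?G j)"
        then obtain p where p_loop: "p \<in> loops (U j) (\<gamma> (real j))"
          and y: "y = bond_comp ?f i (j - i) (path_class (U j) p)"
          by (auto simp: carr)
        then have p: "path p" "path_image p \<subseteq> U j" "pathstart p = \<gamma> (real j)" "pathfinish p = \<gamma> (real j)"
          by (auto simp: loops_def)
        obtain l0 where l0: "\<And>\<sigma>. path \<sigma> \<Longrightarrow> path_image \<sigma> \<subseteq> U j0 \<Longrightarrow> pathstart \<sigma> \<in> U l0 \<Longrightarrow> pathfinish \<sigma> \<in> U l0 \<Longrightarrow>
            \<exists>\<tau>. path \<tau> \<and> path_image \<tau> \<subseteq> U k \<and> homotopic_paths (U i) \<sigma> \<tau>"
          using j0 by metis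
        define l where "l = max k l0"
        have kl: "k \<le> l" "U l \<subseteq> U l0" by (simp add: l_def, rule dec, simp add: l_def)
        define T where "T = ray_path \<gamma> j (k - j)"
        define R where "R = ray_path \<gamma> k (l - k)"
        have T: "path T" "path_image T \<subseteq> U j" "pathstart T = \<gamma> (real j)" "pathfinish T = \<gamma> (real k)"
          using ray[of j "k - j"] jk by (simp_all add: T_def)
        have R: "path R" "path_image R \<subseteq> U k" "pathstart R = \<gamma> (real k)" "pathfinish R = \<gamma> (real l)"
          using ray[of k "l - k"] kl by (simp_all add: R_def)
        have Uk: "U k \<subseteq> U j" "U k \<subseteq> U i" using dec[OF jk] Uj by blast+
        let ?s = "reversepath T +++ (p +++ T)"
        let ?\<sigma> = "reversepath R +++ (?s +++ R)"
        have s: "path ?s" "path_image ?s \<subseteq> U j" "pathstart ?s = \<gamma> (real k)" "pathfinish ?s = \<gamma> (real k)"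
          using T p by (simp_all add: subset_path_image_join)
        have \<sigma>: "path ?\<sigma>" "path_image ?\<sigma> \<subseteq> U j" "pathstart ?\<sigma> = \<gamma> (real l)" "pathfinish ?\<sigma> = \<gamma> (real l)"
        proof -
          have "path_image R \<subseteq> U j" using R(2) Uk by blast
          then show "path_image ?\<sigma> \<subseteq> U j"
            by (intro subset_path_image_join s(2)) simp_all
        qed (use R s in simp_all)
        have "\<gamma> (real l) \<in> U l0" using sub[of l] kl by auto
        then obtain \<tau> where \<tau>: "path \<tau>" "path_image \<tau> \<subseteq> U k" "homotopic_paths (U i) ?\<sigma> \<tau>"
          using l0[OF \<sigma>(1)] \<sigma>(2,3,4) Uj by (metis order_trans)
        have \<tau>_ends: "pathstart \<tau> = \<gamma> (real l)" "pathfinish \<tau> = \<gamma> (real l)"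
          using homotopic_paths_imp_pathstart[OF \<tau>(3)] homotopic_paths_imp_pathfinish[OF \<tau>(3)] \<sigma>(3,4) by simp_all
        define q where "q = R +++ (\<tau> +++ reversepath R)"
        have q: "path q" "path_image q \<subseteq> U k" "pathstart q = \<gamma> (real k)" "pathfinish q = \<gamma> (real k)"
          using R \<tau> \<tau>_ends by (simp_all add: q_def subset_path_image_join)
        have im: "path_image R \<subseteq> U i" "path_image T \<subseteq> U i" "path_image p \<subseteq> U i" "path_image ?s \<subseteq> U i"
          "path_image q \<subseteq> U i"
          using R(2) T(2) p(2) q(2) s(2) Uk Uj by blast+
        have "homotopic_paths (U i) q (R +++ (?\<sigma> +++ reversepath R))"
          unfolding q_def
          by (rule homotopic_paths_join[OF _ homotopic_paths_join[OF homotopic_paths_sym[OF \<tau>(3)]]])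
            (use R im \<tau>_ends in simp_all)
        also have "homotopic_paths (U i) \<dots> ?s"
          by (rule homotopic_conj_cancel) (use R s im in simp_all)
        finally have qs: "homotopic_paths (U i) q ?s" .
        let ?q' = "T +++ (q +++ reversepath T)"
        have "homotopic_paths (U i) ?q' (T +++ (?s +++ reversepath T))"
          by (rule homotopic_paths_join[OF _ homotopic_paths_join[OF qs]]) (use T im q in simp_all)
        also have "homotopic_paths (U i) \<dots> p"
          by (rule homotopic_conj_cancel) (use T p im in simp_all)
        finally have q'p: "homotopic_paths (U i) ?q' p" .
        have q'_loop: "?q' \<in> loops (U j) (\<gamma> (real j))"
          using T q Uk by (auto simp: loops_def path_image_join)
        have q_loop: "q \<in> loops (U k) (\<gamma> (real k))" using q by (simp add: loops_def)
        have "bond_comp ?f j (k - j) (path_class (U k) q) = path_class (U j) ?q'"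
          using bond_comp_path_class[OF U cont sub, of q j "k - j"] q_loop jk by (simp add: T_def)
        then have "bond_comp ?f i (k - i) (path_class (U k) q) = bond_comp ?f i (j - i) (path_class (U j) ?q')"
          by (simp add: split)
        also have "\<dots> = y"
        proof -
          let ?S = "ray_path \<gamma> i (j - i)"
          have S: "path ?S" "path_image ?S \<subseteq> U i" "pathfinish ?S = \<gamma> (real j)" using ray[of i "j - i"] ij by simp_all
          have "homotopic_paths (U i) (?S +++ (?q' +++ reversepath ?S)) (?S +++ (p +++ reversepath ?S))"
            by (rule homotopic_paths_join[OF _ homotopic_paths_join[OF q'p]]) (use S T p in simp_all)
          then have "path_class (U i) (?S +++ (?q' +++ reversepath ?S)) = path_class (U i) (?S +++ (p +++ reversepath ?S))"
            by (rule path_class_eqI)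
          then show ?thesis
            using bond_comp_path_class[OF U cont sub, of ?q' i "j - i"] bond_comp_path_class[OF U cont sub, of p i "j - i"]
              q'_loop p_loop ij by (simp add: y)
        qed
        finally show "y \<in> bond_comp ?f i (k - i) ` carrier (?G k)"
          using q_loop by (intro image_eqI[of _ _ "path_class (U k) q"]) (simp_all add: carr)
      qed
    qed
    then show ?thesis using ij by blast
  qed
  then show ?thesis using inv by (simp add: mittag_leffler_def)
qed

theorem corollary4p4:
  fixes M :: "'a::topological_space set"
    and \<A> :: "('a set \<times> ('a \<Rightarrow> complex ^ 'n)) set"
    and C :: "'a set"
    and U :: "nat \<Rightarrow> 'a set"
  assumes "stein_manifold M \<A>"
    and "CARD('n) \<ge> 2"
    and "C \<in> components M"
    and "neighborhood_system C U"
  shows "\<exists>e. ends U = {e} \<and> mittag_leffler_end C U e"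
proof -
  note U = assms(4)
  have M: "complex_manifold M \<A>" using assms(1) by (simp add: stein_manifold_def)
  have compl: "compact (C - U i)" "C - U i \<subseteq> C" "C - (C - U i) = U i" for i
    using neighborhood_system_complement(1,2)[OF U, of i] by (auto simp: double_diff)
  have main: "(\<exists>j. \<forall>x\<in>U j. \<forall>y\<in>U j. path_component (U i) x y) \<and> U i \<noteq> {} \<and>
      (\<exists>j. \<forall>k. \<exists>l. \<forall>\<sigma>. path \<sigma> \<and> path_image \<sigma> \<subseteq> U j \<and> pathstart \<sigma> \<in> U l \<and> pathfinish \<sigma> \<in> U l \<longrightarrow>
       (\<exists>\<tau>. path \<tau> \<and> path_image \<tau> \<subseteq> U k \<and> homotopic_paths (U i) \<sigma> \<tau>))" for i
  proof -
    obtain K' where K': "compact K'" "K' \<subseteq> C"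
      and conn: "\<forall>x\<in>C - K'. \<forall>y\<in>C - K'. path_component (C - (C - U i)) x y"
      and push: "\<forall>L. compact L \<and> L \<subseteq> C \<longrightarrow> (\<exists>L'. compact L' \<and> L' \<subseteq> C \<and>
       (\<forall>\<sigma>. path \<sigma> \<and> path_image \<sigma> \<subseteq> C - K' \<and> pathstart \<sigma> \<in> C - L' \<and> pathfinish \<sigma> \<in> C - L' \<longrightarrow>
          (\<exists>\<tau>. path \<tau> \<and> path_image \<tau> \<subseteq> C - L \<and> homotopic_paths (C - (C - U i)) \<sigma> \<tau>)))"
      and ne: "\<forall>L. compact L \<and> L \<subseteq> C \<longrightarrow> C - L \<noteq> {}"
      by (rule stein_push[OF assms compl(1,2)[of i]])
    obtain j where "K' \<subseteq> C - U j" by (rule compact_subset_exhausted[OF U K'])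
    then have j: "U j \<subseteq> C - K'" using neighborhood_system_complement(2)[OF U, of j] by blast
    have conn_j: "\<forall>x\<in>U j. \<forall>y\<in>U j. path_component (U i) x y" using conn j unfolding compl(3) by blast
    have ne_i: "U i \<noteq> {}" using ne[rule_format, of "C - U i"] compl[of i] by simp
    have push_j: "\<exists>l. \<forall>\<sigma>. path \<sigma> \<and> path_image \<sigma> \<subseteq> U j \<and> pathstart \<sigma> \<in> U l \<and> pathfinish \<sigma> \<in> U l \<longrightarrow>
       (\<exists>\<tau>. path \<tau> \<and> path_image \<tau> \<subseteq> U k \<and> homotopic_paths (U i) \<sigma> \<tau>)" for k
    proof -
      obtain L' where L': "compact L'" "L' \<subseteq> C"
       and push': "\<forall>\<sigma>. path \<sigma> \<and> path_image \<sigma> \<subseteq> C - K' \<and> pathstart \<sigma> \<in> C - L' \<and> pathfinish \<sigma> \<in> C - L' \<longrightarrow>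
          (\<exists>\<tau>. path \<tau> \<and> path_image \<tau> \<subseteq> U k \<and> homotopic_paths (U i) \<sigma> \<tau>)"
        using push[THEN spec, THEN mp, OF conjI[OF compl(1)[of k] compl(2)[of k]]] unfolding compl(3)
        by (elim exE conjE)
      obtain l where "L' \<subseteq> C - U l" by (rule compact_subset_exhausted[OF U L'])
      then have "U l \<subseteq> C - L'" using neighborhood_system_complement(2)[OF U, of l] by blast
      then have l: "x \<in> C - L'" if "x \<in> U l" for x using that by blast
      show ?thesis
      proof (intro exI[of _ l] allI impI, elim conjE)
        fix \<sigma> assume \<sigma>: "path \<sigma>" "path_image \<sigma> \<subseteq> U j" "pathstart \<sigma> \<in> U l" "pathfinish \<sigma> \<in> U l"
        show "\<exists>\<tau>. path \<tau> \<and> path_image \<tau> \<subseteq> U k \<and> homotopic_paths (U i) \<sigma> \<tau>"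
          by (rule push'[THEN spec, THEN mp], intro conjI \<sigma>(1) order_trans[OF \<sigma>(2) j] l \<sigma>(3,4))
      qed
    qed
    show ?thesis
      by (rule conjI, rule exI[of _ j], rule conn_j, rule conjI, rule ne_i,
          rule exI[of _ j], rule allI, rule push_j)
  qed
  then have "\<forall>i. \<exists>j. \<forall>x\<in>U j. \<forall>y\<in>U j. path_component (U i) x y" by blast
  then obtain J where "\<forall>i. \<forall>x\<in>U (J i). \<forall>y\<in>U (J i). path_component (U i) x y" by metis
  then have J: "path_component (U i) x y" if "x \<in> U (J i)" "y \<in> U (J i)" for i x y using that by blast
  have ne: "U i \<noteq> {}" for i using main by blast
  obtain e where e: "ends U = {e}" "\<forall>i. U (J i) \<subseteq> e i" by (rule ends_singleton[OF U J ne])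
  obtain \<gamma> where \<gamma>: "singular_ray C \<gamma>" "\<forall>i. \<gamma> ` {real i..} \<subseteq> U i"
    by (rule ray_exists[OF component_hausdorff_regular(1)[OF M assms(3)] U J ne])
  have "determines_end \<gamma> e"
    unfolding determines_end_def using order_trans[OF \<gamma>(2)[rule_format] e(2)[rule_format]] by blast
  then have "ray_for_end C U e \<gamma>" using \<gamma> by (simp add: ray_for_end_def)
  moreover have "mittag_leffler (progroup_group U \<gamma>) (progroup_bond U \<gamma>)" if "ray_for_end C U e \<gamma>" for \<gamma>
    by (rule mittag_leffler_ray[OF U that]) (use main in blast)
  ultimately have "mittag_leffler_end C U e" unfolding mittag_leffler_end_def by blast
  then show ?thesis using e(1) by blast
qed

end
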